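(* For all $N\geq 2$, the elements $\sigma_{q,Q}(i)$, $0\leq i\leq N$, and $s_{q,Q}(k)$, $k\geq 0$, are invariant under the operation $'$: $$(\sigma_{q,Q}(i))'=\sigma_{q,Q}(i),\qquad (s_{q,Q}(k))'=\mathrm{Tr}\big((D')^2(YX)^k\big)=\mathrm{Tr}\big(D^2(XY)^k\big)=s_{q,Q}(k).$$
   Context: Let $N\ge 1$ be an integer and $[N]=\{1,\dots,N\}$. Let $q$ and $q_{ij}$ ($i,j\in[N]$) be commuting invertible indeterminates subject only to $q_{ii}=1$ and $q_{ij}q_{ji}=q^2$ for $i\neq j$ (so $q$ and the $q_{ij}$ with $i<j$ are independent), and let $F$ be the field of rational functions over $\mathbb{C}$ in them; $Q=(q_{ij})$. With $e_{ij}$ the matrix units of size $N$, put $R=\sum_{i,j=1}^N q_{ij}e_{ii}\otimes e_{jj}+(1-q^2)\sum_{1\le i<j\le N}e_{ij}\otimes e_{ji}$, $\Sigma=\sum_{i,j}e_{ij}\otimes e_{ji}$ and $\hat R=\Sigma R$. For an $N\times N$ matrix $M$ over an $F$-algebra, $M_{0k}=\sum_{i,j}M_{ij}\otimes e_{ij}$ with $e_{ij}$ placed in the $k$-th leg of a tensor power of $M_N(F)$; $R_{12}$ is $R$ in legs 1,2 and $\hat R_{k,k+1}$ is $\hat R$ in legs $k,k+1$. $\mathcal{O}=\mathcal{O}_{q,Q}^{\mathbb R}(M_N(\mathbb C))$ is the unital associative $F$-algebra generated by the entries of $X=(X_{ij})$ and $Y=(Y_{ij})$ ($i,j\in[N]$)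 with relations $R_{12}X_{01}X_{02}=X_{02}X_{01}R_{12}$, $R_{12}Y_{02}Y_{01}=Y_{01}Y_{02}R_{12}$, $X_{01}R_{12}Y_{02}=Y_{02}R_{12}X_{01}$. It carries the involutive anti-automorphism $^*$ (complex conjugation on $\mathbb C$) with $q^*=q$, $q_{ij}^*=q_{ji}$, $X_{ij}^*=Y_{ji}$. Let $i'=N-i+1$ for $i\in[N]$. The operation $':\mathcal O\to\mathcal O$ is the unique $^*$-anti-isomorphism (additive, product-reversing bijection commuting with $^*$, identity on $\mathbb C$) with $q'=q$, $(q_{ij})'=q_{i'j'}$, $(X_{ij})'=X_{j'i'}$, $(Y_{ij})'=Y_{j'i'}$. Put $D=\mathrm{diag}(1,q,\dots,q^{N-1})$, $D'=\mathrm{diag}(q^{N-1},\dots,q,1)$ and $s_{q,Q}(k)=\mathrm{Tr}(D^2(XY)^k)$ for $k\ge 0$. For $\sigma\in S_N$ put $(-q)_{\sigma,r}=\prod_{i<j,\ \sigma(i)>\sigma(j)}(-q_{\sigma(i)\sigma(j)})$ and $(-q)_{\sigma,c}=\prod_{i<j,\ \sigma(i)>\sigma(j)}(-q_{\sigma(j)\sigma(i)})$. Let $[n]=1+q^2+\dots+q^{2(n-1)}$, $[n]!=[1]\cdots[n]$, $[0]!=1$. Let $u=\sum_{\sigma\in S_N}(-q)_{\sigma,c}\,e_{\sigma(1)}\otimes\dots\otimes e_{\sigma(N)}\in (F^N)^{\otimes N}$ (column vector), $v=u^*$ the row vector $\sum_{\sigma\in S_N}(-q)_{\sigma,r}\,e_{\sigma(1)}^T\otimes\dots\otimes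 e_{\sigma(N)}^T$, and $\alpha_i=\frac{1}{[N]!}\frac{[N]!}{[i]!\,[N-i]!}$. Then $\sigma_{q,Q}(0)=1$ and for $1\le i\le N$ $$\sigma_{q,Q}(i)=q^{-(i-1)i}\alpha_i\,v\,\big((XY)_{01}\hat R_{12}\hat R_{23}\cdots\hat R_{i-1,i}\big)^i u\in\mathcal{O}.$$ *)

theory Defs
  imports
    "HOL-Analysis.Determinants"
    "HOL-Library.Poly_Mapping"
    "HOL-Library.Countable"
    "HOL-Computational_Algebra.Fraction_Field"
begin

section \<open>The index set\<close>

text \<open>
  Throughout, \<open>N = CARD('n)\<close> for an index type \<open>'n\<close> that is finite and linearly ordered. The unique
  order isomorphism between \<open>'n\<close> and \<open>{1..N}\<close> identifies the two: \<open>pos i\<close> is the number of the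
  index \<open>i\<close>, and \<open>elt k\<close> is the \<open>k\<close>-th index.
\<close>

definition pos :: "'n::{finite,linorder} \<Rightarrow> nat" where
  "pos i = card {j. j \<le> i}"

definition elt :: "nat \<Rightarrow> 'n::{finite,linorder}" where
  "elt = inv pos"

definition opp :: "'n::{finite,linorder} \<Rightarrow> 'n" where
  "opp i = elt (CARD('n) - pos i + 1)"

lemma pos_less_iff: "pos i < pos j \<longleftrightarrow> i < (j::'n::{finite,linorder})"
proof -
  have *: "pos i < pos j" if "i < j" for i j :: 'n
    unfolding pos_def using that by (intro psubset_card_mono) (auto simp: less_le_not_le)
  show ?thesis using *[of i j] *[of j i] by (cases i j rule: linorder_cases) auto
qed

lemma pos_eq_iff: "pos i = pos j \<longleftrightarrow> i = (j::'n::{finite,linorder})"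
  by (metis less_irrefl neqE pos_less_iff)

lemma bij_betw_pos: "bij_betw (pos :: 'n::{finite,linorder} \<Rightarrow> nat) UNIV {1..CARD('n)}"
proof -
  have inj: "inj (pos :: 'n \<Rightarrow> nat)" by (rule injI) (simp add: pos_eq_iff)
  have "pos i \<in> {1..CARD('n)}" for i :: 'n
  proof -
    have "card {i} \<le> card {j. j \<le> i}" by (rule card_mono) auto
    moreover have "card {j. j \<le> i} \<le> CARD('n)" by (rule card_mono) auto
    ultimately show ?thesis by (simp add: pos_def)
  qed
  then have sub: "range (pos :: 'n \<Rightarrow> nat) \<subseteq> {1..CARD('n)}" by blast
  have "card (range (pos :: 'n \<Rightarrow> nat)) = card {1..CARD('n)}"
    by (simp add: card_image inj)
  then have "range (pos :: 'n \<Rightarrow> nat) = {1..CARD('n)}"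
    by (rule card_subset_eq[OF finite_atLeastAtMost sub])
  with inj show ?thesis by (simp add: bij_betw_def)
qed

lemma elt_pos [simp]: "elt (pos i) = i"
  unfolding elt_def using pos_eq_iff by (metis inv_f_f injI)

lemma pos_elt: "k \<in> {1..CARD('n)} \<Longrightarrow> pos (elt k :: 'n::{finite,linorder}) = k"
  using bij_betw_pos[where 'n='n] elt_pos unfolding bij_betw_def by (metis imageE)

lemma pos_range: "1 \<le> pos (i::'n::{finite,linorder})" "pos i \<le> CARD('n)"
  using bij_betw_pos[where 'n='n] unfolding bij_betw_def by (metis atLeastAtMost_iff rangeI)+

lemma pos_opp: "pos (opp i) = CARD('n) - pos (i::'n::{finite,linorder}) + 1"
  unfolding opp_def using pos_range[of i] by (intro pos_elt) auto

lemma opp_opp [simp]: "opp (opp i) = i"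
  using pos_range[of i] by (subst pos_eq_iff[symmetric]) (simp add: pos_opp)

lemma opp_less_iff: "opp i < opp j \<longleftrightarrow> j < i"
  using pos_range[of i] pos_range[of j]
  by (auto simp: pos_opp simp flip: pos_less_iff)

lemma opp_eq_iff [simp]: "opp i = opp j \<longleftrightarrow> i = j"
  by (metis opp_opp)


section \<open>The field of rational functions\<close>

text \<open>The independent indeterminates: \<open>None\<close> stands for \<open>q\<close>, and \<open>Some (i, j)\<close> for \<open>q\<^sub>i\<^sub>j\<close> with \<open>i < j\<close>.\<close>

typedef (overloaded) 'n indet = "insert None (Some ` {(i, j :: 'n::{finite,linorder}). i < j})"
  by auto

instance indet :: ("{finite,linorder}") finite
proof
  have "inj (Rep_indet :: 'a indet \<Rightarrow> _)" by (simp add: Rep_indet_inject inj_def)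
  then show "finite (UNIV :: 'a indet set)" by (rule finite_imageD[rotated]) simp
qed

text \<open>
  An arbitrary linear order on the indeterminates; it only serves to see that Laurent polynomials
  form an integral domain.
\<close>

instantiation indet :: ("{finite,linorder}") linorder
begin

definition "x \<le> y \<longleftrightarrow> to_nat x \<le> to_nat (y :: 'a indet)"
definition "x < y \<longleftrightarrow> to_nat x < to_nat (y :: 'a indet)"

instance by standard (auto simp: less_eq_indet_def less_indet_def)

end

text \<open>
  Laurent polynomials in the indeterminates over \<open>\<complex>\<close>, i.e. the group ring of the free abelian group
  of Laurent monomials, and their field of fractions \<open>F\<close>.
\<close>

type_synonym 'n laurent = "('n indet \<Rightarrow>\<^sub>0 int) \<Rightarrow>\<^sub>0 complex"
type_synonym 'n ratfun = "'n laurent fract"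

definition of_laurent :: "'n::{finite,linorder} laurent \<Rightarrow> 'n ratfun" where
  "of_laurent p = Fract p 1"

definition cst :: "complex \<Rightarrow> 'n::{finite,linorder} ratfun" where
  "cst z = of_laurent (Poly_Mapping.single 0 z)"

definition indet :: "('n \<times> 'n) option \<Rightarrow> 'n::{finite,linorder} ratfun" where
  "indet x = of_laurent (Poly_Mapping.single (Poly_Mapping.single (Abs_indet x) 1) 1)"

definition qpar :: "'n::{finite,linorder} ratfun" where
  "qpar = indet None"

definition qent :: "'n \<Rightarrow> 'n \<Rightarrow> 'n::{finite,linorder} ratfun" where
  "qent i j =
     (if i = j then 1 else if i < j then indet (Some (i, j)) else qpar\<^sup>2 / indet (Some (j, i)))"


section \<open>Matrices and tensor legs\<close>

primrec matpow :: "'a::semiring_1^'n^'n \<Rightarrow> nat \<Rightarrow> 'a^'n^'n" where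
  "matpow A 0 = mat 1"
| "matpow A (Suc k) = A ** matpow A k"

definition diagmat :: "('n \<Rightarrow> 'a::zero) \<Rightarrow> 'a^'n^'n" where
  "diagmat d = (\<chi> i j. if i = j then d i else 0)"

definition munit :: "'n \<Rightarrow> 'n \<Rightarrow> 'a::semiring_1^'n^'n" where
  "munit i j = (\<chi> a b. if a = i \<and> b = j then 1 else 0)"

definition smat :: "'a::semiring_1 \<Rightarrow> 'a^'n^'m \<Rightarrow> 'a^'n^'m" where
  "smat c A = (\<chi> i j. c * A $ i $ j)"

definition kron :: "'a::semiring_1^'n^'n \<Rightarrow> 'a^'n^'n \<Rightarrow> 'a^('n::finite \<times> 'n)^('n \<times> 'n)" where
  "kron A B = (\<chi> i j. A $ fst i $ fst j * B $ snd i $ snd j)"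

text \<open>
  A tensor power of the column space with legs indexed by the type \<open>'l\<close> has the basis \<open>'l \<Rightarrow> 'n\<close>:
  the multi-index \<open>J\<close> stands for the tensor product of the basis vectors \<open>e (J k)\<close> over all legs \<open>k\<close>.
  Entries from a noncommutative coefficient algebra play the role of the leg 0.
  The matrices \<open>leg1 k M\<close> and \<open>leg2 k l M\<close> act by \<open>M\<close> in leg \<open>k\<close>, respectively in legs \<open>k\<close>, \<open>l\<close>, and
  trivially in all other legs.
\<close>

definition leg1 :: "'l::finite \<Rightarrow> 'a::zero^'n^'n \<Rightarrow> 'a^('l \<Rightarrow> 'n::finite)^('l \<Rightarrow> 'n)" where
  "leg1 k M = (\<chi> I J. if \<forall>m. m \<noteq> k \<longrightarrow> I m = J m then M $ I k $ J k else 0)"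

definition leg2 ::
  "'l::finite \<Rightarrow> 'l \<Rightarrow> 'a::zero^('n \<times> 'n)^('n \<times> 'n) \<Rightarrow> 'a^('l \<Rightarrow> 'n::finite)^('l \<Rightarrow> 'n)" where
  "leg2 k l M =
     (\<chi> I J. if \<forall>m. m \<noteq> k \<and> m \<noteq> l \<longrightarrow> I m = J m then M $ (I k, I l) $ (J k, J l) else 0)"

definition Rmat :: "'n::{finite,linorder} ratfun^('n \<times> 'n)^('n \<times> 'n)" where
  "Rmat = (\<Sum>i\<in>UNIV. \<Sum>j\<in>UNIV. smat (qent i j) (kron (munit i i) (munit j j)))
        + smat (1 - qpar\<^sup>2) (\<Sum>(i, j)\<in>{(i, j). i < j}. kron (munit i j) (munit j i))"

definition flipmat :: "'n::{finite,linorder} ratfun^('n \<times> 'n)^('n \<times> 'n)" where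
  "flipmat = (\<Sum>i\<in>UNIV. \<Sum>j\<in>UNIV. kron (munit i j) (munit j i))"

definition Rhat :: "'n::{finite,linorder} ratfun^('n \<times> 'n)^('n \<times> 'n)" where
  "Rhat = flipmat ** Rmat"


section \<open>The algebra\<close>

subsection \<open>The free algebra\<close>

datatype 'n gen = GX 'n 'n | GY 'n 'n

datatype 'g word = Word (letters: "'g list")

instantiation word :: (type) monoid_add
begin

definition "0 = Word []"
definition "v + w = Word (letters v @ letters w)"

instance by standard (auto simp: zero_word_def plus_word_def)

end

type_synonym 'n free = "'n gen word \<Rightarrow>\<^sub>0 'n ratfun"

definition fcoef :: "'n::{finite,linorder} ratfun \<Rightarrow> 'n free" where
  "fcoef c = Poly_Mapping.single 0 c"

definition fgen :: "'n gen \<Rightarrow> 'n::{finite,linorder} free" where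
  "fgen g = Poly_Mapping.single (Word [g]) 1"

definition fX :: "'n free^'n::{finite,linorder}^'n::{finite,linorder}" where
  "fX = (\<chi> i j. fgen (GX i j))"

definition fY :: "'n free^'n::{finite,linorder}^'n::{finite,linorder}" where
  "fY = (\<chi> i j. fgen (GY i j))"

subsection \<open>The defining relations\<close>

text \<open>
  Matrices over the free algebra with two legs. The legs are the two elements \<open>1\<close> and \<open>2\<close> (\<open>= 0\<close>) of
  the numeral type \<^typ>\<open>2\<close>.
\<close>

abbreviation fR12 :: "'n::{finite,linorder} free^(2 \<Rightarrow> 'n)^(2 \<Rightarrow> 'n)" where
  "fR12 \<equiv> leg2 1 2 (map_matrix fcoef Rmat)"

definition rel1 :: "'n::{finite,linorder} free^(2 \<Rightarrow> 'n)^(2 \<Rightarrow> 'n)" where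
  "rel1 = fR12 ** leg1 1 fX ** leg1 2 fX - leg1 2 fX ** leg1 1 fX ** fR12"

definition rel2 :: "'n::{finite,linorder} free^(2 \<Rightarrow> 'n)^(2 \<Rightarrow> 'n)" where
  "rel2 = fR12 ** leg1 2 fY ** leg1 1 fY - leg1 1 fY ** leg1 2 fY ** fR12"

definition rel3 :: "'n::{finite,linorder} free^(2 \<Rightarrow> 'n)^(2 \<Rightarrow> 'n)" where
  "rel3 = leg1 1 fX ** fR12 ** leg1 2 fY - leg1 2 fY ** fR12 ** leg1 1 fX"

text \<open>The two-sided ideal generated by the relations.\<close>

inductive_set relideal :: "'n::{finite,linorder} free set" where
  rel1: "rel1 $ I $ J \<in> relideal"
| rel2: "rel2 $ I $ J \<in> relideal"
| rel3: "rel3 $ I $ J \<in> relideal"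
| zero: "0 \<in> relideal"
| add: "a \<in> relideal \<Longrightarrow> b \<in> relideal \<Longrightarrow> a + b \<in> relideal"
| mult_left: "a \<in> relideal \<Longrightarrow> c * a \<in> relideal"
| mult_right: "a \<in> relideal \<Longrightarrow> a * c \<in> relideal"

lemma relideal_uminus: "a \<in> relideal \<Longrightarrow> - a \<in> relideal"
  using relideal.mult_left[of a "- 1"] by simp

lemma relideal_diff: "a \<in> relideal \<Longrightarrow> b \<in> relideal \<Longrightarrow> a - b \<in> relideal"
  using relideal.add[of a "- b"] relideal_uminus[of b] by simp

subsection \<open>The quotient\<close>

quotient_type (overloaded) 'n qalg =
  "'n::{finite,linorder} free" / "\<lambda>a b. a - b \<in> relideal"
proof (rule equivpI)
  show "reflp (\<lambda>a b :: 'n free. a - b \<in> relideal)"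
    by (rule reflpI) (simp add: relideal.zero)
  show "symp (\<lambda>a b :: 'n free. a - b \<in> relideal)"
  proof (rule sympI)
    fix a b :: "'n free"
    assume "a - b \<in> relideal"
    from relideal_uminus[OF this] show "b - a \<in> relideal" by simp
  qed
  show "transp (\<lambda>a b :: 'n free. a - b \<in> relideal)"
  proof (rule transpI)
    fix a b c :: "'n free"
    assume "a - b \<in> relideal" "b - c \<in> relideal"
    from relideal.add[OF this] show "a - c \<in> relideal" by simp
  qed
qed


subsection \<open>Evaluation of (skew) polynomials\<close>

definition is_antihom :: "('a::ring_1 \<Rightarrow> 'b::ring_1) \<Rightarrow> bool" where
  "is_antihom f \<longleftrightarrow>
     (\<forall>a b. f (a + b) = f a + f b) \<and> (\<forall>a b. f (a * b) = f b * f a) \<and> f 1 = 1"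

lemma antihomD:
  assumes "is_antihom f"
  shows "f (a + b) = f a + f b" "f (a * b) = f b * f a" "f 1 = 1" "f 0 = 0" "f (- a) = - f a"
    "f (a - b) = f a - f b" "f (sum g S) = (\<Sum>x\<in>S. f (g x))"
proof -
  show add: "f (a + b) = f a + f b" for a b using assms by (simp add: is_antihom_def)
  show "f (a * b) = f b * f a" "f 1 = 1" using assms by (simp_all add: is_antihom_def)
  show z: "f 0 = 0" using add[of 0 0] by simp
  show m: "f (- a) = - f a" for a by (metis add minus_unique right_minus z)
  show "f (a - b) = f a - f b" using add[of a "- b"] m[of b] by simp
  show "f (sum g S) = (\<Sum>x\<in>S. f (g x))"
    by (induction S rule: infinite_finite_induct) (simp_all add: z add)
qed

lemma pm_expand:
  fixes p :: "'m \<Rightarrow>\<^sub>0 'c::comm_monoid_add"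
  shows "(\<Sum>m\<in>Poly_Mapping.keys p. Poly_Mapping.single m (Poly_Mapping.lookup p m)) = p"
  proof (rule poly_mapping_eqI)
    fix k
    have "Poly_Mapping.lookup (\<Sum>m\<in>Poly_Mapping.keys p. Poly_Mapping.single m (Poly_Mapping.lookup p m)) k =
      (\<Sum>m\<in>Poly_Mapping.keys p. if m = k then Poly_Mapping.lookup p m else 0)"
      by (auto simp: lookup_sum lookup_single when_def intro!: sum.cong)
    then show "Poly_Mapping.lookup (\<Sum>m\<in>Poly_Mapping.keys p. Poly_Mapping.single m (Poly_Mapping.lookup p m)) k =
      Poly_Mapping.lookup p k"
      by (simp add: sum.delta' in_keys_iff)
  qed

definition pmeval :: "('c \<Rightarrow> 'a) \<Rightarrow> ('m \<Rightarrow> 'a) \<Rightarrow> ('m \<Rightarrow>\<^sub>0 'c::zero) \<Rightarrow> 'a::ring_1" where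
  "pmeval f g p = (\<Sum>m\<in>Poly_Mapping.keys p. f (Poly_Mapping.lookup p m) * g m)"

lemma pmeval_superset:
  assumes "finite S" "Poly_Mapping.keys p \<subseteq> S" "f 0 = 0"
  shows "pmeval f g p = (\<Sum>m\<in>S. f (Poly_Mapping.lookup p m) * g m)"
  unfolding pmeval_def using assms by (intro sum.mono_neutral_left) (auto simp: in_keys_iff)

lemma pmeval_single: "f 0 = 0 \<Longrightarrow> pmeval f g (Poly_Mapping.single m c) = f c * g m"
  by (subst pmeval_superset[of "{m}"]) (auto simp: )

lemma pmeval_add:
  fixes f :: "'c::monoid_add \<Rightarrow> 'a::ring_1"
  assumes "\<And>a b. f (a + b) = f a + f b"
  shows "pmeval f g (p + q) = pmeval f g p + pmeval f g q"
proof -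
  have z: "f 0 = 0" using assms[of 0 0] by simp
  let ?S = "Poly_Mapping.keys p \<union> Poly_Mapping.keys q \<union> Poly_Mapping.keys (p + q)"
  have "pmeval f g r = (\<Sum>m\<in>?S. f (Poly_Mapping.lookup r m) * g m)" if "r \<in> {p, q, p + q}" for r
    using that by (intro pmeval_superset) (auto simp: z)
  then show ?thesis by (simp add: lookup_add assms distrib_right sum.distrib)
qed

lemma pmeval_antihom:
  fixes f :: "'c::comm_ring_1 \<Rightarrow> 'a::ring_1" and g :: "'m::monoid_add \<Rightarrow> 'a"
  assumes f: "is_antihom f" and g: "\<And>m n. g (m + n) = g n * g m" "g 0 = 1"
    and comm: "\<And>c m. f c * g m = g m * f c"
  shows "is_antihom (pmeval f g)"
proof -
  note fD = antihomD[OF f]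
  have add: "pmeval f g (p + q) = pmeval f g p + pmeval f g q" for p q
    by (rule pmeval_add) (rule fD)
  have z: "pmeval f g 0 = 0" by (simp add: pmeval_def)
  have sum: "pmeval f g (sum h S) = (\<Sum>x\<in>S. pmeval f g (h x))" for h :: "'x \<Rightarrow> _" and S
    by (induction S rule: infinite_finite_induct) (simp_all add: z add)
  have single: "pmeval f g (Poly_Mapping.single m c) = f c * g m" for m c
    by (rule pmeval_single) (rule fD)
  have mon: "f (a * b) * g (m + n) = (f b * g n) * (f a * g m)" for a b m n
  proof -
    have "f (a * b) = f b * f a" by (rule fD)
    then show ?thesis by (simp add: g mult.assoc) (metis comm mult.assoc)
  qed
  have "pmeval f g (p * q) = pmeval f g q * pmeval f g p" for p q
  proof -
    have "pmeval f g (p * q) =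
      pmeval f g ((\<Sum>m\<in>Poly_Mapping.keys p. Poly_Mapping.single m (Poly_Mapping.lookup p m)) *
                  (\<Sum>n\<in>Poly_Mapping.keys q. Poly_Mapping.single n (Poly_Mapping.lookup q n)))"
      by (simp only: pm_expand)
    also have "\<dots> = (\<Sum>m\<in>Poly_Mapping.keys p. \<Sum>n\<in>Poly_Mapping.keys q. f (Poly_Mapping.lookup p m * Poly_Mapping.lookup q n) * g (m + n))"
      by (simp only: sum_product sum mult_single single)
    also have "\<dots> = (\<Sum>n\<in>Poly_Mapping.keys q. \<Sum>m\<in>Poly_Mapping.keys p. (f (Poly_Mapping.lookup q n) * g n) * (f (Poly_Mapping.lookup p m) * g m))"
      by (subst sum.swap) (simp only: mon)
    also have "\<dots> = pmeval f g q * pmeval f g p"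
      by (simp only: pmeval_def sum_product)
    finally show ?thesis .
  qed
  moreover have "pmeval f g 1 = 1"
    using single[of 0 1] by (simp add: fD g)
  ultimately show ?thesis by (simp add: is_antihom_def add)
qed

definition Tmat :: "('a \<Rightarrow> 'b) \<Rightarrow> 'a^'n^'m \<Rightarrow> 'b^'m^'n" where
  "Tmat f A = (\<chi> i j. f (A $ j $ i))"

lemma Tmat_mult: "is_antihom f \<Longrightarrow> Tmat f (A ** B) = Tmat f B ** Tmat f A"
  by (simp add: Tmat_def matrix_matrix_mult_def vec_eq_iff antihomD)

lemma Tmat_diff: "is_antihom f \<Longrightarrow> Tmat f (A - B) = Tmat f A - Tmat f B"
  by (simp add: Tmat_def vec_eq_iff antihomD)

lemma Tmat_leg1: "is_antihom f \<Longrightarrow> Tmat f (leg1 k A) = leg1 k (Tmat f A)"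
  by (auto simp: Tmat_def leg1_def vec_eq_iff antihomD)

lemma Tmat_leg2: "is_antihom f \<Longrightarrow> Tmat f (leg2 k l A) = leg2 k l (Tmat f A)"
  by (auto simp: Tmat_def leg2_def vec_eq_iff antihomD)

subsection \<open>The quotient is a nontrivial ring\<close>

lemma one_notin_relideal: "1 \<notin> (relideal :: 'n::{finite,linorder} free set)"
proof -
  define aug :: "'n free \<Rightarrow> 'n ratfun" where "aug = pmeval id (\<lambda>w. if w = 0 then 1 else 0)"
  have w0: "v + w = 0 \<longleftrightarrow> v = 0 \<and> w = 0" for v w :: "'n gen word"
    by (cases v; cases w) (auto simp: zero_word_def plus_word_def)
  have A: "is_antihom aug" unfolding aug_def
    by (rule pmeval_antihom) (auto simp: is_antihom_def w0)
  have gen: "aug (fgen g) = 0" for g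
    by (simp add: aug_def fgen_def pmeval_single zero_word_def)
  have leg: "Tmat aug (leg1 k fX) = 0" "Tmat aug (leg1 k fY) = 0" for k :: 2
    by (simp_all add: Tmat_def leg1_def fX_def fY_def vec_eq_iff gen antihomD[OF A])
  have mult0: "0 ** B = 0" "B ** 0 = 0" for B :: "'n ratfun^(2 \<Rightarrow> 'n)^(2 \<Rightarrow> 'n)"
    by (simp_all add: matrix_matrix_mult_def vec_eq_iff)
  have "Tmat aug rel1 = 0" "Tmat aug rel2 = 0" "Tmat aug rel3 = 0"
    by (simp_all add: rel1_def rel2_def rel3_def Tmat_diff[OF A] Tmat_mult[OF A] leg mult0)
  then have rel: "aug (rel1 $ I $ J) = 0" "aug (rel2 $ I $ J) = 0" "aug (rel3 $ I $ J) = 0" for I J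
    by (simp_all add: Tmat_def vec_eq_iff)
  have "aug a = 0" if "a \<in> relideal" for a
    using that by induction (simp_all add: rel antihomD[OF A])
  moreover have "aug 1 = 1" by (rule antihomD[OF A])
  ultimately show ?thesis by force
qed

instantiation qalg :: ("{finite,linorder}") ring_1
begin

lift_definition zero_qalg :: "'a qalg" is 0 .
lift_definition one_qalg :: "'a qalg" is 1 .

lift_definition plus_qalg :: "'a qalg \<Rightarrow> 'a qalg \<Rightarrow> 'a qalg" is "(+)"
  using relideal.add by (metis add_diff_add)

lift_definition uminus_qalg :: "'a qalg \<Rightarrow> 'a qalg" is uminus
  using relideal_uminus by (metis minus_diff_minus)

lift_definition minus_qalg :: "'a qalg \<Rightarrow> 'a qalg \<Rightarrow> 'a qalg" is "(-)"
proof -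
  fix a b c d :: "'a free"
  assume "a - b \<in> relideal" "c - d \<in> relideal"
  from relideal_diff[OF this] show "a - c - (b - d) \<in> relideal" by (simp add: algebra_simps)
qed

lift_definition times_qalg :: "'a qalg \<Rightarrow> 'a qalg \<Rightarrow> 'a qalg" is "(*)"
proof -
  fix a b c d :: "'a free"
  assume "a - b \<in> relideal" "c - d \<in> relideal"
  then have "(a - b) * c + b * (c - d) \<in> relideal"
    by (intro relideal.add relideal.mult_left relideal.mult_right)
  then show "a * c - b * d \<in> relideal" by (simp add: algebra_simps)
qed

instance
proof
  show "(0 :: 'a qalg) \<noteq> 1"
  proof (transfer, rule notI)
    assume "0 - 1 \<in> (relideal :: 'a free set)"
    from relideal_uminus[OF this] show False by (simp add: one_notin_relideal)
  qed
qed (transfer; simp add: algebra_simps relideal.zero)+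

end

definition of_F :: "'n::{finite,linorder} ratfun \<Rightarrow> 'n qalg" where
  "of_F c = abs_qalg (fcoef c)"

definition Xmat :: "'n qalg^'n::{finite,linorder}^'n::{finite,linorder}" where
  "Xmat = (\<chi> i j. abs_qalg (fgen (GX i j)))"

definition Ymat :: "'n qalg^'n::{finite,linorder}^'n::{finite,linorder}" where
  "Ymat = (\<chi> i j. abs_qalg (fgen (GY i j)))"

lemma abs_qalg_simps:
  "abs_qalg (a + b) = abs_qalg a + abs_qalg b"
  "abs_qalg (a * b) = abs_qalg a * abs_qalg b"
  "abs_qalg (a - b) = abs_qalg a - abs_qalg b"
  "abs_qalg 0 = 0" "abs_qalg 1 = 1"
  by (simp_all add: plus_qalg.abs_eq times_qalg.abs_eq minus_qalg.abs_eq zero_qalg.abs_eq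
      one_qalg.abs_eq)

lemma abs_qalg_sum: "abs_qalg (sum g S) = (\<Sum>x\<in>S. abs_qalg (g x))"
  by (induction S rule: infinite_finite_induct) (simp_all add: abs_qalg_simps)

lemma of_F_add: "of_F (a + b) = of_F a + of_F b"
  by (simp add: of_F_def fcoef_def single_add abs_qalg_simps)

lemma of_F_mult: "of_F (a * b) = of_F a * of_F b"
  by (simp add: of_F_def fcoef_def mult_single flip: abs_qalg_simps)

lemma of_F_one [simp]: "of_F 1 = 1"
  by (simp add: of_F_def fcoef_def flip: abs_qalg_simps)

lemma of_F_zero [simp]: "of_F 0 = 0"
  by (simp add: of_F_def fcoef_def flip: abs_qalg_simps)



section \<open>The two anti-automorphisms\<close>

text \<open>
  Both are defined as the unique map with the prescribed properties; existence and uniqueness are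
  established below (facts \<open>star\<close>, \<open>is_star_unique\<close>, \<open>prime_op\<close>, \<open>is_prime_op_unique\<close>).
  The scalars of \<open>F\<close> are not fixed by these maps, so their action on \<open>q\<close>, on the \<open>q\<^sub>i\<^sub>j\<close> and on \<open>\<complex>\<close> is
  part of the specification.
\<close>

definition is_star :: "('n::{finite,linorder} qalg \<Rightarrow> 'n qalg) \<Rightarrow> bool" where
  "is_star f \<longleftrightarrow>
     (\<forall>a b. f (a + b) = f a + f b) \<and>
     (\<forall>a b. f (a * b) = f b * f a) \<and>
     (\<forall>a. f (f a) = a) \<and>
     (\<forall>z. f (of_F (cst z)) = of_F (cst (cnj z))) \<and>
     f (of_F qpar) = of_F qpar \<and>
     (\<forall>i j. f (of_F (qent i j)) = of_F (qent j i)) \<and>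
     (\<forall>i j. f (Xmat $ i $ j) = Ymat $ j $ i)"

definition star :: "'n::{finite,linorder} qalg \<Rightarrow> 'n qalg" where
  "star = (THE f. is_star f)"

definition is_prime_op :: "('n::{finite,linorder} qalg \<Rightarrow> 'n qalg) \<Rightarrow> bool" where
  "is_prime_op f \<longleftrightarrow>
     (\<forall>a b. f (a + b) = f a + f b) \<and>
     (\<forall>a b. f (a * b) = f b * f a) \<and>
     bij f \<and>
     (\<forall>a. f (star a) = star (f a)) \<and>
     (\<forall>z. f (of_F (cst z)) = of_F (cst z)) \<and>
     f (of_F qpar) = of_F qpar \<and>
     (\<forall>i j. f (of_F (qent i j)) = of_F (qent (opp i) (opp j))) \<and>
     (\<forall>i j. f (Xmat $ i $ j) = Xmat $ opp j $ opp i) \<and>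
     (\<forall>i j. f (Ymat $ i $ j) = Ymat $ opp j $ opp i)"

definition prime_op :: "'n::{finite,linorder} qalg \<Rightarrow> 'n qalg" where
  "prime_op = (THE f. is_prime_op f)"

subsection \<open>Generators\<close>

lemma Fract_nonzero_iff: "Fract a 1 = 0 \<longleftrightarrow> a = 0"
  by (simp add: Zero_fract_def eq_fract)

lemma of_laurent_add: "of_laurent (a + b) = of_laurent a + of_laurent b"
  by (simp add: of_laurent_def)

lemma of_laurent_mult: "of_laurent (a * b) = of_laurent a * of_laurent b"
  by (simp add: of_laurent_def)

lemma of_laurent_one [simp]: "of_laurent 1 = 1"
  by (simp add: of_laurent_def One_fract_def)

lemma of_laurent_zero_iff [simp]: "of_laurent a = 0 \<longleftrightarrow> a = 0"
  by (simp add: of_laurent_def Fract_nonzero_iff)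

lemma cst_one [simp]: "cst 1 = 1"
  by (simp add: cst_def)

lemma indet_nonzero [simp]: "(indet x :: 'a::{finite,linorder} ratfun) \<noteq> 0"
proof -
  have "Poly_Mapping.single (Poly_Mapping.single (Abs_indet x) 1) 1 \<noteq> (0 :: 'a laurent)" for x
    by (metis lookup_single_eq lookup_zero zero_neq_one)
  then show ?thesis by (simp add: indet_def)
qed

lemma qpar_nonzero [simp]: "qpar \<noteq> 0"
  by (simp add: qpar_def)

lemma qent_mult: "i \<noteq> j \<Longrightarrow> qent i j * qent j i = qpar\<^sup>2"
  by (auto simp: qent_def)

lemma qent_nonzero [simp]: "qent i j \<noteq> 0"
  by (auto simp: qent_def)

lemma pm_induct [case_names single add]:
  fixes a :: "'m \<Rightarrow>\<^sub>0 'c::comm_monoid_add"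
  assumes "\<And>m c. P (Poly_Mapping.single m c)" and "\<And>a b. P a \<Longrightarrow> P b \<Longrightarrow> P (a + b)"
  shows "P a"
proof -
  have 0: "P 0" using assms(1)[of undefined 0] by simp
  have "P (\<Sum>m\<in>S. Poly_Mapping.single m (Poly_Mapping.lookup a m))" for S
    by (induction S rule: infinite_finite_induct) (auto simp: assms 0)
  from this[of "Poly_Mapping.keys a"] show ?thesis by (simp add: pm_expand)
qed

lemma fcoef_central: "fcoef c * a = a * fcoef c"
  by (induction a rule: pm_induct)
     (simp_all add: fcoef_def mult_single mult.commute distrib_left distrib_right)

lemma of_F_central: "of_F c * a = a * of_F c"
proof (induction a rule: qalg.abs_induct)
  case (1 y)
  then show ?case using fcoef_central[of c y] by (simp add: of_F_def flip: abs_qalg_simps)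
qed

lemma ratfun_induct [case_names cst qpar qent add mult inverse]:
  fixes x :: "'n::{finite,linorder} ratfun"
  assumes cst: "\<And>z. P (cst z)" and qpar: "P qpar" and qent: "\<And>i j. P (qent i j)"
    and add: "\<And>a b. P a \<Longrightarrow> P b \<Longrightarrow> P (a + b)"
    and mult: "\<And>a b. P a \<Longrightarrow> P b \<Longrightarrow> P (a * b)"
    and inv: "\<And>a. P a \<Longrightarrow> a \<noteq> 0 \<Longrightarrow> P (inverse a)"
  shows "P x"
proof -
  define M :: "('n indet \<Rightarrow>\<^sub>0 int) \<Rightarrow> 'n ratfun"
    where "M e = of_laurent (Poly_Mapping.single e 1)" for e
  have Madd: "M (a + b) = M a * M b" for a b
    by (simp add: M_def mult_single flip: of_laurent_mult)
  have M0: "M 0 = 1" by (simp add: M_def)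
  have Mminus: "M (- a) = inverse (M a)" for a
    using Madd[of a "- a"] M0 by (simp add: inverse_unique)
  have Mnz: "M a \<noteq> 0" for a
    using Madd[of a "- a"] M0 by auto
  have Mgen: "P (M (Poly_Mapping.single y 1))" for y
  proof -
    obtain z where z: "y = Abs_indet z" "z \<in> insert None (Some ` {(i, j :: 'n). i < j})"
      by (cases y rule: Abs_indet_cases)
    have eq: "M (Poly_Mapping.single y 1) = indet z" by (simp add: M_def indet_def z)
    show ?thesis
    proof (cases z)
      case None
      then show ?thesis using eq qpar by (simp add: qpar_def)
    next
      case (Some p)
      then obtain i j where "z = Some (i, j)" "i < j" using z by auto
      moreover from this have "i \<noteq> j" by auto
      ultimately show ?thesis using eq qent[of i j] by (simp add: qent_def)
    qed
  qed
  have Msingle: "P (M (Poly_Mapping.single y n))" for y and n :: int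
  proof (induction n rule: int_induct[where k = 0])
    case base
    then show ?case using cst[of 1] by (simp add: M0)
  next
    case (step1 n)
    have "M (Poly_Mapping.single y (n + 1)) = M (Poly_Mapping.single y n) * M (Poly_Mapping.single y 1)"
      by (simp add: single_add Madd)
    then show ?case using step1 Mgen mult by simp
  next
    case (step2 n)
    have "M (Poly_Mapping.single y (n - 1)) =
        M (Poly_Mapping.single y n + - Poly_Mapping.single y 1)"
      by (simp add: single_diff)
    also have "\<dots> = M (Poly_Mapping.single y n) * inverse (M (Poly_Mapping.single y 1))"
      by (simp add: Madd Mminus del: add_uminus_conv_diff)
    finally show ?case using step2 Mgen mult inv Mnz by simp
  qed
  have PM: "P (M e)" for e
    by (induction e rule: pm_induct) (simp_all add: Msingle Madd mult)
  have PL: "P (of_laurent p)" for p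
  proof (induction p rule: pm_induct)
    case (single m c)
    have "of_laurent (Poly_Mapping.single m c) = cst c * M m"
      by (simp add: cst_def M_def mult_single flip: of_laurent_mult)
    then show ?case by (simp add: mult cst PM)
  qed (simp add: of_laurent_add add)
  show ?thesis
  proof (cases x)
    case (Fract a b)
    have "x = of_laurent a * inverse (of_laurent b)" by (simp add: Fract of_laurent_def)
    then show ?thesis using mult[OF PL inv[OF PL]] Fract by simp
  qed
qed

lemma qalg_induct_F [case_names of_F X Y add mult]:
  fixes x :: "'n::{finite,linorder} qalg"
  assumes F: "\<And>c. P (of_F c)" and X: "\<And>i j. P (Xmat $ i $ j)" and Y: "\<And>i j. P (Ymat $ i $ j)"
    and add: "\<And>a b. P a \<Longrightarrow> P b \<Longrightarrow> P (a + b)"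
    and mult: "\<And>a b. P a \<Longrightarrow> P b \<Longrightarrow> P (a * b)"
  shows "P x"
proof (induction x rule: qalg.abs_induct)
  case (1 y)
  show ?case
  proof (induction y rule: pm_induct)
    case (single w c)
    have gen: "P (abs_qalg (fgen g))" for g
      using X Y by (cases g) (auto simp: Xmat_def Ymat_def)
    have "P (abs_qalg (Poly_Mapping.single (Word gs) c))" for gs
    proof (induction gs)
      case Nil
      then show ?case using F[of c] by (simp add: of_F_def fcoef_def zero_word_def)
    next
      case (Cons g gs)
      have "Poly_Mapping.single (Word (g # gs)) c = fgen g * Poly_Mapping.single (Word gs) c"
        by (simp add: fgen_def mult_single plus_word_def)
      then show ?case using Cons gen mult by (simp add: abs_qalg_simps)
    qed
    then show ?case by (cases w) simp
  qed (simp add: abs_qalg_simps add)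
qed

lemma qalg_induct [case_names cst qpar qent X Y add mult inverse]:
  fixes x :: "'n::{finite,linorder} qalg"
  assumes cst: "\<And>z. P (of_F (cst z))" and qpar: "P (of_F qpar)"
    and qent: "\<And>i j. P (of_F (qent i j))"
    and X: "\<And>i j. P (Xmat $ i $ j)" and Y: "\<And>i j. P (Ymat $ i $ j)"
    and add: "\<And>a b. P a \<Longrightarrow> P b \<Longrightarrow> P (a + b)"
    and mult: "\<And>a b. P a \<Longrightarrow> P b \<Longrightarrow> P (a * b)"
    and inv: "\<And>a b. P a \<Longrightarrow> a * b = 1 \<Longrightarrow> b * a = 1 \<Longrightarrow> P b"
  shows "P x"
proof -
  have F: "P (of_F c)" for c
  proof (induction c rule: ratfun_induct)
    case (add a b)
    from assms(6)[OF this] show ?case by (simp only: of_F_add)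
  next
    case (mult a b)
    from assms(7)[OF this] show ?case by (simp only: of_F_mult)
  next
    case (inverse a)
    then have "of_F a * of_F (Fields.inverse a) = 1" "of_F (Fields.inverse a) * of_F a = 1"
      unfolding of_F_mult[symmetric] by simp_all
    with inverse(1) show ?case by (rule inv)
  qed (fact cst qpar qent)+
  show ?thesis
    by (rule qalg_induct_F[of P, OF F X Y add mult])
qed

subsection \<open>Automorphisms of the field\<close>

lemma laurent_involution:
  fixes \<tau> :: "'n::{finite,linorder} indet \<Rightarrow> 'n indet" and c :: "complex \<Rightarrow> complex"
  assumes \<tau>: "\<And>x. \<tau> (\<tau> x) = x" "\<tau> (Abs_indet None) = Abs_indet None"
    and c: "is_antihom c" "\<And>z. c (c z) = z"
  obtains f :: "'n laurent \<Rightarrow> 'n laurent" where "is_antihom f" "\<And>p. f (f p) = p"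
    "\<And>z. f (Poly_Mapping.single 0 z) = Poly_Mapping.single 0 (c z)"
    "f (Poly_Mapping.single (Poly_Mapping.single (Abs_indet None) 1) 1) =
       Poly_Mapping.single (Poly_Mapping.single (Abs_indet None) 1) 1"
    "\<And>x. x \<noteq> Abs_indet None \<Longrightarrow>
       f (Poly_Mapping.single (Poly_Mapping.single x 1) 1) * Poly_Mapping.single (Poly_Mapping.single (\<tau> x) 1) 1 =
       (Poly_Mapping.single (Poly_Mapping.single (Abs_indet None) 1) 1)\<^sup>2"
proof -
  define q :: "'n indet" where "q = Abs_indet None"
  define h :: "('n indet \<Rightarrow>\<^sub>0 int) \<Rightarrow> ('n indet \<Rightarrow>\<^sub>0 int)" where
    "h e = Abs_poly_mapping (\<lambda>x. if x = q
       then Poly_Mapping.lookup e q + 2 * (\<Sum>y\<in>-{q}. Poly_Mapping.lookup e y)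
       else - Poly_Mapping.lookup e (\<tau> x))" for e
  have lh: "Poly_Mapping.lookup (h e) x = (if x = q
       then Poly_Mapping.lookup e q + 2 * (\<Sum>y\<in>-{q}. Poly_Mapping.lookup e y)
       else - Poly_Mapping.lookup e (\<tau> x))" for e x
    unfolding h_def by (subst lookup_Abs_poly_mapping) auto
  have \<tau>q: "\<tau> q = q" using \<tau> by (simp add: q_def)
  have \<tau>q_iff: "\<tau> x = q \<longleftrightarrow> x = q" for x using \<tau>q \<tau>(1) by metis
  have hadd: "h (a + b) = h a + h b" for a b
    by (rule poly_mapping_eqI) (simp add: lh lookup_add sum.distrib)
  have h0: "h 0 = 0"
    by (rule poly_mapping_eqI) (simp add: lh)
  have sum\<tau>: "(\<Sum>y\<in>-{q}. g (\<tau> y)) = (\<Sum>y\<in>-{q}. g y)" for g :: "_ \<Rightarrow> int"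
    by (rule sum.reindex_bij_witness[of _ \<tau> \<tau>]) (auto simp: \<tau> \<tau>q_iff)
  have hh: "h (h e) = e" for e
  proof (rule poly_mapping_eqI)
    fix x
    have "(\<Sum>y\<in>-{q}. Poly_Mapping.lookup (h e) y) = (\<Sum>y\<in>-{q}. - Poly_Mapping.lookup e (\<tau> y))"
      by (rule sum.cong) (auto simp: lh)
    also have "\<dots> = - (\<Sum>y\<in>-{q}. Poly_Mapping.lookup e y)"
      by (simp add: sum_negf sum\<tau>)
    finally show "Poly_Mapping.lookup (h (h e)) x = Poly_Mapping.lookup e x"
      by (subst lh) (simp add: lh \<tau>q_iff \<tau>)
  qed
  define f :: "'n laurent \<Rightarrow> 'n laurent" where
    "f = pmeval (\<lambda>z. Poly_Mapping.single 0 (c z)) (\<lambda>e. Poly_Mapping.single (h e) 1)"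
  have f: "is_antihom f" unfolding f_def
    using c(1) by (intro pmeval_antihom)
      (auto simp: is_antihom_def single_add mult_single hadd h0 mult.commute add.commute)
  have fs: "f (Poly_Mapping.single e z) = Poly_Mapping.single (h e) (c z)" for e z
    unfolding f_def by (subst pmeval_single) (auto simp: antihomD[OF c(1)] mult_single)
  have ff: "f (f p) = p" for p
    by (induction p rule: pm_induct) (simp_all add: fs hh c antihomD[OF f])
  have hq: "h (Poly_Mapping.single q 1) = Poly_Mapping.single q 1"
    by (rule poly_mapping_eqI) (auto simp: lh lookup_single when_def \<tau>q_iff)
  have hx: "h (Poly_Mapping.single x 1) + Poly_Mapping.single (\<tau> x) 1 = Poly_Mapping.single q 2"
    if "x \<noteq> q" for x
  proof (rule poly_mapping_eqI)
    fix y
    have "(\<Sum>y\<in>-{q}. Poly_Mapping.lookup (Poly_Mapping.single x (1::int)) y) = 1"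
      using that by (simp add: lookup_single when_def sum.delta)
    then show "Poly_Mapping.lookup (h (Poly_Mapping.single x 1) + Poly_Mapping.single (\<tau> x) 1) y
        = Poly_Mapping.lookup (Poly_Mapping.single q 2) y"
      using that \<tau>(1) \<tau>q_iff[of x]
      by (auto simp: lh lookup_add lookup_single when_def)
  qed
  show ?thesis
  proof (rule that[OF f ff])
    show "f (Poly_Mapping.single 0 z) = Poly_Mapping.single 0 (c z)" for z
      by (simp add: fs h0)
    show "f (Poly_Mapping.single (Poly_Mapping.single (Abs_indet None) 1) 1) =
       Poly_Mapping.single (Poly_Mapping.single (Abs_indet None) 1) 1"
      using hq by (simp add: fs q_def antihomD[OF c(1)])
    show "f (Poly_Mapping.single (Poly_Mapping.single x 1) 1) * Poly_Mapping.single (Poly_Mapping.single (\<tau> x) 1) 1 =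
       (Poly_Mapping.single (Poly_Mapping.single (Abs_indet None) 1) 1)\<^sup>2"
      if "x \<noteq> Abs_indet None" for x
      using hx[of x] that
      by (simp add: fs q_def antihomD[OF c(1)] mult_single power2_eq_square flip: single_add)
  qed
qed

lemma fract_extend:
  fixes f :: "'a::idom \<Rightarrow> 'a"
  assumes f: "is_antihom f" and inj: "\<And>p. f p = 0 \<Longrightarrow> p = 0"
  obtains \<phi> :: "'a fract \<Rightarrow> 'a fract" where "is_antihom \<phi>" "\<And>p. \<phi> (Fract p 1) = Fract (f p) 1"
proof -
  define \<phi> where "\<phi> x = (THE y. \<exists>a b. b \<noteq> 0 \<and> x = Fract a b \<and> y = Fract (f a) (f b))" for x
  note fD = antihomD[OF f]
  have nz: "f p \<noteq> 0" if "p \<noteq> 0" for p using inj that by blast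
  have \<phi>: "\<phi> (Fract a b) = Fract (f a) (f b)" if b: "b \<noteq> 0" for a b
    unfolding \<phi>_def
  proof (rule the_equality)
    show "\<exists>a' b'. b' \<noteq> 0 \<and> Fract a b = Fract a' b' \<and> Fract (f a) (f b) = Fract (f a') (f b')"
      using b by blast
  next
    fix y
    assume "\<exists>a' b'. b' \<noteq> 0 \<and> Fract a b = Fract a' b' \<and> y = Fract (f a') (f b')"
    then obtain a' b' where *: "b' \<noteq> 0" "Fract a b = Fract a' b'" "y = Fract (f a') (f b')"
      by blast
    then have "a * b' = a' * b" using b by (simp add: eq_fract)
    then have "f (a * b') = f (a' * b)" by simp
    then have "f a * f b' = f a' * f b" by (simp add: fD mult.commute)
    then show "y = Fract (f a) (f b)" using * b nz by (simp add: eq_fract)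
  qed
  show ?thesis
  proof (rule that)
    show "\<phi> (Fract p 1) = Fract (f p) 1" for p by (simp add: \<phi> fD)
    have "\<phi> (x + y) = \<phi> x + \<phi> y" for x y
      by (cases x; cases y) (simp add: \<phi> fD nz mult.commute)
    moreover have "\<phi> (x * y) = \<phi> y * \<phi> x" for x y
      by (cases x; cases y) (simp add: \<phi> fD nz mult.commute)
    moreover have "\<phi> 1 = 1" by (simp add: One_fract_def \<phi> fD)
    ultimately show "is_antihom \<phi>" by (simp add: is_antihom_def)
  qed
qed

lemma field_automorphism:
  fixes \<tau> :: "'n::{finite,linorder} indet \<Rightarrow> 'n indet" and c :: "complex \<Rightarrow> complex"
  assumes \<tau>: "\<And>x. \<tau> (\<tau> x) = x" "\<tau> (Abs_indet None) = Abs_indet None"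
    and c: "is_antihom c" "\<And>z. c (c z) = z"
  obtains \<phi> :: "'n ratfun \<Rightarrow> 'n ratfun" where "is_antihom \<phi>" "\<And>z. \<phi> (cst z) = cst (c z)"
    "\<phi> qpar = qpar"
    "\<And>i j k l. i < j \<Longrightarrow> k < l \<Longrightarrow> \<tau> (Abs_indet (Some (i, j))) = Abs_indet (Some (k, l)) \<Longrightarrow>
       \<phi> (qent i j) = qent l k"
proof -
  obtain f :: "'n laurent \<Rightarrow> 'n laurent" where f: "is_antihom f" "\<And>p. f (f p) = p"
    and f1: "\<And>z. f (Poly_Mapping.single 0 z) = Poly_Mapping.single 0 (c z)"
    and f2: "f (Poly_Mapping.single (Poly_Mapping.single (Abs_indet None) 1) 1) =
       Poly_Mapping.single (Poly_Mapping.single (Abs_indet None) 1) 1"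
    and f3: "\<And>x. x \<noteq> Abs_indet None \<Longrightarrow>
       f (Poly_Mapping.single (Poly_Mapping.single x 1) 1) * Poly_Mapping.single (Poly_Mapping.single (\<tau> x) 1) 1 =
       (Poly_Mapping.single (Poly_Mapping.single (Abs_indet None) 1) 1)\<^sup>2"
    using laurent_involution[OF \<tau> c] by blast
  have "f p = 0 \<Longrightarrow> p = 0" for p using f(2)[of p] antihomD(4)[OF f(1)] by simp
  then obtain \<phi> :: "'n ratfun \<Rightarrow> 'n ratfun"
    where \<phi>: "is_antihom \<phi>" "\<And>p. \<phi> (of_laurent p) = of_laurent (f p)"
    using fract_extend[OF f(1)] unfolding of_laurent_def by blast
  show ?thesis
  proof (rule that[OF \<phi>(1)])
    show "\<phi> (cst z) = cst (c z)" for z by (simp add: cst_def \<phi> f1)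
    show "\<phi> qpar = qpar" by (simp add: qpar_def indet_def \<phi> f2)
    fix i j k l :: 'n
    assume ij: "i < j" and kl: "k < l"
      and t: "\<tau> (Abs_indet (Some (i, j))) = Abs_indet (Some (k, l))"
    have "Abs_indet (Some (i, j)) \<noteq> Abs_indet None"
      using ij by (subst Abs_indet_inject) auto
    from f3[OF this] have "\<phi> (indet (Some (i, j))) * indet (Some (k, l)) = qpar\<^sup>2"
      by (simp add: indet_def qpar_def \<phi> t power2_eq_square flip: of_laurent_mult)
    then have "\<phi> (indet (Some (i, j))) = qpar\<^sup>2 / indet (Some (k, l))"
      by (simp add: field_simps)
    then show "\<phi> (qent i j) = qent l k"
      using ij kl by (auto simp: qent_def)
  qed
qed

lemma field_automorphism_qent:
  assumes \<phi>: "is_antihom \<phi>" "\<phi> qpar = qpar"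
    and q: "\<And>i j. i < j \<Longrightarrow> \<phi> (qent i j) = qent (s i j) (t i j)"
    and st: "\<And>i j. i \<noteq> j \<Longrightarrow> s i j \<noteq> t i j" "\<And>i j. s j i = t i j" "\<And>i. s i i = t i i"
  shows "\<phi> (qent i j) = qent (s i j) (t i j)"
proof (cases i j rule: linorder_cases)
  case equal
  then show ?thesis by (simp add: qent_def st antihomD[OF \<phi>(1)])
next
  case greater
  have "qent i j * qent j i = qpar\<^sup>2" using greater by (intro qent_mult) auto
  then have "\<phi> (qent i j * qent j i) = \<phi> (qpar\<^sup>2)" by simp
  then have "\<phi> (qent i j) * qent (t i j) (s i j) = qpar\<^sup>2"
    using q[OF greater] st(2)[of i j] st(2)[of j i]
    by (simp add: antihomD[OF \<phi>(1)] \<phi>(2) power2_eq_square mult.commute)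
  also have "\<dots> = qent (s i j) (t i j) * qent (t i j) (s i j)"
    using greater st(1)[of i j] by (intro qent_mult[symmetric]) auto
  finally show ?thesis by simp
qed (rule q)

subsection \<open>Anti-automorphisms of the algebra\<close>

lemma Rmat_nth:
  "Rmat $ (a, b) $ (c, d) =
     (if a = c \<and> b = d then qent a b else 0) + (if a < b \<and> c = b \<and> d = a then 1 - qpar\<^sup>2 else 0)"
proof -
  have 1: "(\<Sum>i\<in>UNIV. \<Sum>j\<in>UNIV. smat (qent i j) (kron (munit i i) (munit j j))) $ (a, b) $ (c, d)
     = (\<Sum>i\<in>UNIV. \<Sum>j\<in>UNIV. if i = a then if j = b then (if a = c \<and> b = d then qent a b else 0) else 0 else 0)"
    by (auto simp: smat_def kron_def munit_def intro!: sum.cong)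
  have "(\<Sum>(i, j)\<in>{(i, j). i < j}. kron (munit i j) (munit j i)) $ (a, b) $ (c, d)
     = (\<Sum>x\<in>{(i, j). i < j}. if x = (a, b) then (if c = b \<and> d = a then 1 else 0) else (0 :: 'a ratfun))"
    unfolding sum_component
    by (rule sum.cong) (auto simp: kron_def munit_def split: if_splits)
  then have 2: "(\<Sum>(i, j)\<in>{(i, j). i < j}. kron (munit i j) (munit j i)) $ (a, b) $ (c, d)
     = (if a < b \<and> c = b \<and> d = a then 1 else (0 :: 'a ratfun))"
    by simp
  have 3: "(\<Sum>i\<in>UNIV. \<Sum>j\<in>UNIV. if i = a then if j = b then (if a = c \<and> b = d then qent a b else 0) else 0 else 0)
     = (if a = c \<and> b = d then qent a b else (0 :: 'a ratfun))"
  proof -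
    have "(\<Sum>j\<in>UNIV. if i = a then if j = b then (if a = c \<and> b = d then qent a b else 0) else 0 else 0)
        = (if i = a then (if a = c \<and> b = d then qent a b else (0 :: 'a ratfun)) else 0)" for i
      by (cases "i = a") simp_all
    then show ?thesis by simp
  qed
  have 4: "smat c A $ x $ y = c * A $ x $ y" for c :: "'a ratfun" and A :: "'a ratfun^('a \<times> 'a)^('a \<times> 'a)" and x y
    by (simp add: smat_def)
  show ?thesis
    unfolding Rmat_def vector_add_component 4 1 2 3
    by (cases "a < b \<and> c = b \<and> d = a") (simp_all only: if_True if_False mult_1_right mult_zero_right simp_thms)
qed

definition reix :: "('i \<Rightarrow> 'i) \<Rightarrow> 'a^'i^'i \<Rightarrow> 'a^'i^'i" where
  "reix p A = (\<chi> i j. A $ p i $ p j)"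

lemma reix_mult:
  assumes "bij p"
  shows "reix p (A ** B) = reix p A ** reix p B"
proof -
  have "(\<Sum>k\<in>UNIV. A $ p i $ k * B $ k $ p j) = (\<Sum>k\<in>UNIV. A $ p i $ p k * B $ p k $ p j)" for i j
    by (rule sum.reindex_bij_betw[symmetric]) (rule assms)
  then show ?thesis by (simp add: reix_def matrix_matrix_mult_def vec_eq_iff)
qed

lemma qalg_relations:
  defines "R \<equiv> leg2 1 2 (map_matrix of_F Rmat) :: 'n::{finite,linorder} qalg^(2 \<Rightarrow> 'n)^(2 \<Rightarrow> 'n)"
  shows "R ** leg1 1 Xmat ** leg1 2 Xmat = leg1 2 Xmat ** leg1 1 Xmat ** R"
    and "R ** leg1 2 Ymat ** leg1 1 Ymat = leg1 1 Ymat ** leg1 2 Ymat ** R"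
    and "leg1 1 Xmat ** R ** leg1 2 Ymat = leg1 2 Ymat ** R ** leg1 1 Xmat"
proof -
  let ?m = "map_matrix abs_qalg :: 'n free^(2 \<Rightarrow> 'n)^(2 \<Rightarrow> 'n) \<Rightarrow> 'n qalg^(2 \<Rightarrow> 'n)^(2 \<Rightarrow> 'n)"
  have m: "?m (A ** B) = ?m A ** ?m B" "?m (A - B) = ?m A - ?m B" for A B
    by (simp_all add: map_matrix_def matrix_matrix_mult_def vec_eq_iff abs_qalg_sum abs_qalg_simps)
  have l: "?m (leg1 k fX) = leg1 k Xmat" "?m (leg1 k fY) = leg1 k Ymat" "?m fR12 = R" for k
    by (auto simp: map_matrix_def leg1_def leg2_def vec_eq_iff abs_qalg_simps fX_def fY_def
        Xmat_def Ymat_def R_def of_F_def)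
  have z: "abs_qalg a = 0" if "a \<in> relideal" for a :: "'n free"
    using that by (simp add: zero_qalg_def qalg.abs_eq_iff)
  have "?m rel1 = 0" "?m rel2 = 0" "?m rel3 = 0"
    by (simp_all add: map_matrix_def vec_eq_iff z relideal.intros)
  then show "R ** leg1 1 Xmat ** leg1 2 Xmat = leg1 2 Xmat ** leg1 1 Xmat ** R"
    and "R ** leg1 2 Ymat ** leg1 1 Ymat = leg1 1 Ymat ** leg1 2 Ymat ** R"
    and "leg1 1 Xmat ** R ** leg1 2 Ymat = leg1 2 Ymat ** R ** leg1 1 Xmat"
    by (simp_all only: rel1_def rel2_def rel3_def m l right_minus_eq)
qed

lemma qalg_antihom:
  fixes \<phi> :: "'n::{finite,linorder} ratfun \<Rightarrow> 'n ratfun"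
    and A B :: "'n qalg^'n::{finite,linorder}^'n::{finite,linorder}"
  defines "R \<equiv> leg2 1 2 (map_matrix of_F (Tmat \<phi> Rmat)) :: 'n qalg^(2 \<Rightarrow> 'n)^(2 \<Rightarrow> 'n)"
  assumes \<phi>: "is_antihom \<phi>"
    and r1: "R ** leg1 1 A ** leg1 2 A = leg1 2 A ** leg1 1 A ** R"
    and r2: "R ** leg1 2 B ** leg1 1 B = leg1 1 B ** leg1 2 B ** R"
    and r3: "leg1 1 A ** R ** leg1 2 B = leg1 2 B ** R ** leg1 1 A"
  obtains \<alpha> :: "'n qalg \<Rightarrow> 'n qalg" where "is_antihom \<alpha>" "\<And>x. \<alpha> (of_F x) = of_F (\<phi> x)"
    "\<And>i j. \<alpha> (Xmat $ i $ j) = A $ j $ i" "\<And>i j. \<alpha> (Ymat $ i $ j) = B $ j $ i"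
proof -
  define g where "g x = (case x of GX i j \<Rightarrow> A $ j $ i | GY i j \<Rightarrow> B $ j $ i)" for x
  define \<beta> :: "'n free \<Rightarrow> 'n qalg"
    where "\<beta> = pmeval (\<lambda>x. of_F (\<phi> x)) (\<lambda>w. prod_list (rev (map g (letters w))))"
  have \<beta>: "is_antihom \<beta>" unfolding \<beta>_def
  proof (rule pmeval_antihom)
    show "is_antihom (\<lambda>x. of_F (\<phi> x))"
      by (simp add: is_antihom_def antihomD[OF \<phi>] of_F_add of_F_mult)
    show "of_F (\<phi> x) * a = a * of_F (\<phi> x)" for x a
      by (rule of_F_central)
  qed (simp_all add: plus_word_def zero_word_def)
  have \<beta>c: "\<beta> (fcoef x) = of_F (\<phi> x)" for x
    unfolding \<beta>_def fcoef_def
    by (subst pmeval_single) (simp_all add: antihomD[OF \<phi>] zero_word_def)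
  have \<beta>g: "\<beta> (fgen x) = g x" for x
    unfolding \<beta>_def fgen_def
    by (subst pmeval_single) (simp_all add: antihomD[OF \<phi>])
  have TX: "Tmat \<beta> fX = A" and TY: "Tmat \<beta> fY = B"
    and TR: "Tmat \<beta> (map_matrix fcoef Rmat) = map_matrix of_F (Tmat \<phi> Rmat)"
    by (simp_all add: Tmat_def fX_def fY_def vec_eq_iff \<beta>g g_def \<beta>c)
  have "Tmat \<beta> rel1 = 0" "Tmat \<beta> rel2 = 0" "Tmat \<beta> rel3 = 0"
    using r1 r2 r3
    by (simp_all add: rel1_def rel2_def rel3_def Tmat_diff[OF \<beta>] Tmat_mult[OF \<beta>] Tmat_leg1[OF \<beta>]
        Tmat_leg2[OF \<beta>] TX TY TR R_def[symmetric] matrix_mul_assoc)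
  then have rel: "\<beta> (rel1 $ I $ J) = 0" "\<beta> (rel2 $ I $ J) = 0" "\<beta> (rel3 $ I $ J) = 0" for I J
    by (simp_all add: Tmat_def vec_eq_iff)
  have ker: "\<beta> a = 0" if "a \<in> relideal" for a
    using that by induction (simp_all add: rel antihomD[OF \<beta>])
  define \<alpha> where "\<alpha> x = \<beta> (rep_qalg x)" for x
  have \<alpha>: "\<alpha> (abs_qalg a) = \<beta> a" for a
  proof -
    have "abs_qalg (rep_qalg (abs_qalg a)) = abs_qalg a"
      by (rule Quotient_abs_rep[OF Quotient_qalg])
    then have "rep_qalg (abs_qalg a) - a \<in> relideal" by (simp add: qalg.abs_eq_iff)
    from ker[OF this] show ?thesis by (simp add: \<alpha>_def antihomD[OF \<beta>])
  qed
  show ?thesis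
  proof (rule that)
    have "\<alpha> (x + y) = \<alpha> x + \<alpha> y" for x y
      by (induction x rule: qalg.abs_induct; induction y rule: qalg.abs_induct)
         (simp add: \<alpha> antihomD[OF \<beta>] flip: abs_qalg_simps)
    moreover have "\<alpha> (x * y) = \<alpha> y * \<alpha> x" for x y
      by (induction x rule: qalg.abs_induct; induction y rule: qalg.abs_induct)
         (simp add: \<alpha> antihomD[OF \<beta>] flip: abs_qalg_simps)
    moreover have "\<alpha> 1 = 1"
      by (simp add: \<alpha> antihomD[OF \<beta>] flip: abs_qalg_simps)
    ultimately show "is_antihom \<alpha>" by (simp add: is_antihom_def)
    show "\<alpha> (of_F x) = of_F (\<phi> x)" for x by (simp add: of_F_def \<alpha> \<beta>c[unfolded of_F_def])
    show "\<alpha> (Xmat $ i $ j) = A $ j $ i" "\<alpha> (Ymat $ i $ j) = B $ j $ i" for i j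
      by (simp_all add: Xmat_def Ymat_def \<alpha> \<beta>g g_def)
  qed
qed

subsection \<open>Existence and uniqueness\<close>

lemma is_star_exists: "\<exists>f. is_star (f :: 'n::{finite,linorder} qalg \<Rightarrow> 'n qalg)"
proof -
  obtain \<phi> :: "'n ratfun \<Rightarrow> 'n ratfun" where \<phi>: "is_antihom \<phi>" "\<And>z. \<phi> (cst z) = cst (cnj z)"
    "\<phi> qpar = qpar"
    and "\<And>i j k l. i < j \<Longrightarrow> k < l \<Longrightarrow> id (Abs_indet (Some (i, j))) = Abs_indet (Some (k, l)) \<Longrightarrow>
       \<phi> (qent i j) = qent l k"
    by (rule field_automorphism[of id cnj]) (auto simp: is_antihom_def)
  then have "\<phi> (qent i j) = qent j i" if "i < j" for i j using that by simp
  then have \<phi>q: "\<phi> (qent i j) = qent j i" for i j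
    by (rule field_automorphism_qent[OF \<phi>(1,3)]) auto
  define sw :: "(2 \<Rightarrow> 'n) \<Rightarrow> (2 \<Rightarrow> 'n)" where "sw I = (\<lambda>k. if k = 1 then I 2 else I 1)" for I
  have [simp]: "(2::2) \<noteq> 1" "(1::2) \<noteq> 2" by simp_all
  have swsw: "sw (sw I) = I" for I
    unfolding fun_eq_iff by (simp only: forall_2) (simp add: sw_def)
  have sw: "bij sw" by (rule o_bij[of sw]) (auto simp: swsw)
  have \<phi>add: "\<phi> (x + y) = \<phi> x + \<phi> y" for x y by (rule antihomD[OF \<phi>(1)])
  have \<phi>1: "\<phi> 0 = 0" "\<phi> (1 - qpar\<^sup>2) = 1 - qpar\<^sup>2"
    by (simp_all add: antihomD[OF \<phi>(1)] \<phi>(3) power2_eq_square)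
  have TR: "Tmat \<phi> Rmat $ (a, b) $ (c, d) = Rmat $ (b, a) $ (d, c)" for a b c d
    unfolding Tmat_def vec_lambda_beta Rmat_nth \<phi>add if_distrib[of \<phi>] \<phi>q \<phi>1
    by (intro arg_cong2[of _ _ _ _ "(+)"] if_cong) blast+
  let ?R = "leg2 1 2 (map_matrix of_F Rmat) :: 'n qalg^(2 \<Rightarrow> 'n)^(2 \<Rightarrow> 'n)"
  have R: "leg2 1 2 (map_matrix of_F (Tmat \<phi> Rmat)) = reix sw ?R"
    by (simp add: vec_eq_iff leg2_def reix_def TR forall_2 sw_def)
  have legs: "leg1 1 M = reix sw (leg1 2 M)" "leg1 2 M = reix sw (leg1 1 M)" for M :: "'n qalg^'n::{finite,linorder}^'n::{finite,linorder}"
    by (auto simp: vec_eq_iff leg1_def reix_def forall_2 sw_def)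
  have "\<exists>f. is_antihom f \<and> (\<forall>x. f (of_F x) = of_F (\<phi> x)) \<and>
    (\<forall>i j. f (Xmat $ i $ j) = Ymat $ j $ i) \<and> (\<forall>i j. f (Ymat $ i $ j) = Xmat $ j $ i)"
  proof (rule qalg_antihom[OF \<phi>(1), of Ymat Xmat], goal_cases)
    case 1
    show ?case using arg_cong[OF qalg_relations(2)[where 'n='n], of "reix sw"]
      by (simp only: reix_mult[OF sw] legs[symmetric] R)
  next
    case 2
    show ?case using arg_cong[OF qalg_relations(1)[where 'n='n], of "reix sw"]
      by (simp only: reix_mult[OF sw] legs[symmetric] R)
  next
    case 3
    show ?case using arg_cong[OF qalg_relations(3)[where 'n='n], of "reix sw"]
      by (simp only: reix_mult[OF sw] legs[symmetric] R)
  next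
    case (4 \<alpha>)
    then show ?case by blast
  qed
  then obtain f where f: "is_antihom f" "\<And>x. f (of_F x) = of_F (\<phi> x)"
    "\<And>i j. f (Xmat $ i $ j) = Ymat $ j $ i" "\<And>i j. f (Ymat $ i $ j) = Xmat $ j $ i"
    by blast
  note fD = antihomD[OF f(1)]
  have "f (f a) = a" for a
  proof (induction a rule: qalg_induct)
    case (inverse a b)
    have "f (f b) * f (f a) = f (f (b * a))" by (simp only: fD)
    also have "\<dots> = 1" by (simp only: inverse(3) fD)
    finally have *: "f (f b) * a = 1" by (simp only: inverse(1))
    have "f (f b) = f (f b) * (a * b)" by (simp only: inverse(2) mult_1_right)
    also have "\<dots> = b" by (simp only: mult.assoc[symmetric] * mult_1_left)
    finally show ?case .
  qed (simp_all add: f \<phi> \<phi>q fD)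
  then have "is_star f" by (simp add: is_star_def f \<phi> \<phi>q fD)
  then show ?thesis by blast
qed

lemma antihom_ext:
  fixes f g :: "'n::{finite,linorder} qalg \<Rightarrow> 'n qalg"
  assumes f: "is_antihom f" and g: "is_antihom g"
    and gens: "\<And>z. f (of_F (cst z)) = g (of_F (cst z))" "f (of_F qpar) = g (of_F qpar)"
      "\<And>i j. f (of_F (qent i j)) = g (of_F (qent i j))"
      "\<And>i j. f (Xmat $ i $ j) = g (Xmat $ i $ j)" "\<And>i j. f (Ymat $ i $ j) = g (Ymat $ i $ j)"
  shows "f = g"
proof
  fix a
  show "f a = g a"
  proof (induction a rule: qalg_induct)
    case (add a b)
    then show ?case by (simp only: antihomD(1)[OF f] antihomD(1)[OF g])
  next
    case (mult a b)
    then show ?case by (simp only: antihomD(2)[OF f] antihomD(2)[OF g])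
  next
    case (inverse a b)
    have "g a * g b = g (b * a)" by (simp only: antihomD(2)[OF g])
    then have 1: "g a * g b = 1" by (simp only: inverse(3) antihomD(3)[OF g])
    have "f b * f a = f (a * b)" by (simp only: antihomD(2)[OF f])
    then have 2: "f b * g a = 1" by (simp only: inverse(1,2) antihomD(3)[OF f])
    have "f b = f b * (g a * g b)" by (simp only: 1 mult_1_right)
    also have "\<dots> = g b" by (simp only: mult.assoc[symmetric] 2 mult_1_left)
    finally show ?case .
  qed (fact gens)+
qed

lemma is_star_antihom:
  assumes "is_star f"
  shows "is_antihom f"
proof -
  have "f (of_F (cst 1)) = of_F (cst (cnj 1))" using assms unfolding is_star_def by blast
  then have "f 1 = 1" by simp
  with assms show ?thesis unfolding is_star_def is_antihom_def by blast
qed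

lemma is_star_simps:
  assumes "is_star f"
  shows "f (of_F (cst z)) = of_F (cst (cnj z))" "f (of_F qpar) = of_F qpar"
    "f (of_F (qent i j)) = of_F (qent j i)" "f (Xmat $ i $ j) = Ymat $ j $ i"
    "f (Ymat $ i $ j) = Xmat $ j $ i"
proof -
  note D = assms[unfolded is_star_def]
  show "f (of_F (cst z)) = of_F (cst (cnj z))" "f (of_F qpar) = of_F qpar"
    "f (of_F (qent i j)) = of_F (qent j i)" "f (Xmat $ i $ j) = Ymat $ j $ i"
    using D by blast+
  have "f (Xmat $ j $ i) = Ymat $ i $ j" "f (f (Xmat $ j $ i)) = Xmat $ j $ i" using D by blast+
  then show "f (Ymat $ i $ j) = Xmat $ j $ i" by simp
qed

lemma is_star_unique: "is_star f \<Longrightarrow> is_star g \<Longrightarrow> f = g"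
  by (rule antihom_ext) (simp_all only: is_star_antihom is_star_simps)

lemma star: "is_star star"
  proof -
  have "\<exists>!f. is_star (f :: 'a qalg \<Rightarrow> 'a qalg)"
    using is_star_exists is_star_unique by (rule ex_ex1I)
  then show ?thesis unfolding star_def by (rule theI')
qed

lemma is_prime_op_exists: "\<exists>f. is_prime_op (f :: 'n::{finite,linorder} qalg \<Rightarrow> 'n qalg)"
proof -
  define \<tau> :: "'n indet \<Rightarrow> 'n indet" where
    "\<tau> x = Abs_indet (map_option (\<lambda>(i, j). (opp j, opp i)) (Rep_indet x))" for x
  have rep: "map_option (\<lambda>(i, j). (opp j, opp i)) (Rep_indet x) \<in>
      insert None (Some ` {(i, j :: 'n). i < j})" for x
    using Rep_indet[of x] by (auto simp: opp_less_iff)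
  have \<tau>\<tau>: "\<tau> (\<tau> x) = x" for x
  proof -
    have "map_option (\<lambda>(i, j). (opp j, opp i)) (map_option (\<lambda>(i, j). (opp j, opp i)) z) = z"
      for z :: "('n \<times> 'n) option"
      by (cases z) auto
    then show ?thesis by (simp only: \<tau>_def Abs_indet_inverse[OF rep] Rep_indet_inverse)
  qed
  have \<tau>s: "\<tau> (Abs_indet (Some (i, j))) = Abs_indet (Some (opp j, opp i))" if "i < j" for i j
    using that by (simp add: \<tau>_def Abs_indet_inverse)
  have \<tau>n: "\<tau> (Abs_indet None) = Abs_indet None"
    by (simp add: \<tau>_def Abs_indet_inverse)
  have id: "is_antihom (id :: complex \<Rightarrow> complex)" "id (id z) = z" for z :: complex
    by (auto simp: is_antihom_def)
  obtain \<phi> :: "'n ratfun \<Rightarrow> 'n ratfun" where \<phi>: "is_antihom \<phi>" "\<And>z. \<phi> (cst z) = cst (id z)"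
    "\<phi> qpar = qpar"
    and "\<And>i j k l. i < j \<Longrightarrow> k < l \<Longrightarrow> \<tau> (Abs_indet (Some (i, j))) = Abs_indet (Some (k, l)) \<Longrightarrow>
       \<phi> (qent i j) = qent l k"
    using field_automorphism[OF \<tau>\<tau> \<tau>n id] by blast
  then have "\<phi> (qent i j) = qent (opp i) (opp j)" if "i < j" for i j
    using that \<tau>s opp_less_iff by metis
  then have \<phi>q: "\<phi> (qent i j) = qent (opp i) (opp j)" for i j
    by (rule field_automorphism_qent[OF \<phi>(1,3)]) auto
  define op2 :: "(2 \<Rightarrow> 'n) \<Rightarrow> (2 \<Rightarrow> 'n)" where "op2 I = (\<lambda>k. opp (I k))" for I
  have op2: "bij op2" by (rule o_bij[of op2]) (auto simp: op2_def)
  have \<phi>add: "\<phi> (x + y) = \<phi> x + \<phi> y" for x y by (rule antihomD[OF \<phi>(1)])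
  have \<phi>1: "\<phi> 0 = 0" "\<phi> (1 - qpar\<^sup>2) = 1 - qpar\<^sup>2"
    by (simp_all add: antihomD[OF \<phi>(1)] \<phi>(3) power2_eq_square)
  have TR: "Tmat \<phi> Rmat $ (a, b) $ (c, d) = Rmat $ (opp a, opp b) $ (opp c, opp d)" for a b c d
    unfolding Tmat_def vec_lambda_beta Rmat_nth \<phi>add if_distrib[of \<phi>] \<phi>q \<phi>1
      opp_less_iff opp_eq_iff
    by (intro arg_cong2[of _ _ _ _ "(+)"] if_cong) blast+
  let ?R = "leg2 1 2 (map_matrix of_F Rmat) :: 'n qalg^(2 \<Rightarrow> 'n)^(2 \<Rightarrow> 'n)"
  have R: "leg2 1 2 (map_matrix of_F (Tmat \<phi> Rmat)) = reix op2 ?R"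
    by (simp add: vec_eq_iff leg2_def reix_def TR op2_def forall_2)
  have legs: "leg1 k (reix opp M) = reix op2 (leg1 k M)" for M :: "'n qalg^'n::{finite,linorder}^'n::{finite,linorder}" and k
    by (auto simp: vec_eq_iff leg1_def reix_def op2_def)
  have "\<exists>f. is_antihom f \<and> (\<forall>x. f (of_F x) = of_F (\<phi> x)) \<and>
    (\<forall>i j. f (Xmat $ i $ j) = Xmat $ opp j $ opp i) \<and>
    (\<forall>i j. f (Ymat $ i $ j) = Ymat $ opp j $ opp i)"
  proof (rule qalg_antihom[OF \<phi>(1), of "reix opp Xmat" "reix opp Ymat"], goal_cases)
    case 1
    show ?case using arg_cong[OF qalg_relations(1)[where 'n='n], of "reix op2"]
      by (simp only: reix_mult[OF op2] legs R)
  next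
    case 2
    show ?case using arg_cong[OF qalg_relations(2)[where 'n='n], of "reix op2"]
      by (simp only: reix_mult[OF op2] legs R)
  next
    case 3
    show ?case using arg_cong[OF qalg_relations(3)[where 'n='n], of "reix op2"]
      by (simp only: reix_mult[OF op2] legs R)
  next
    case (4 \<alpha>)
    then show ?case by (intro exI[of _ \<alpha>]) (simp add: reix_def)
  qed
  then obtain f where f: "is_antihom f" "\<And>x. f (of_F x) = of_F (\<phi> x)"
    "\<And>i j. f (Xmat $ i $ j) = Xmat $ opp j $ opp i" "\<And>i j. f (Ymat $ i $ j) = Ymat $ opp j $ opp i"
    by blast
  note fD = antihomD[OF f(1)]
  have ff: "f (f a) = a" for a
  proof (induction a rule: qalg_induct)
    case (inverse a b)
    have "f (f b) * f (f a) = f (f (b * a))" by (simp only: fD)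
    also have "\<dots> = 1" by (simp only: inverse(3) fD)
    finally have *: "f (f b) * a = 1" by (simp only: inverse(1))
    have "f (f b) = f (f b) * (a * b)" by (simp only: inverse(2) mult_1_right)
    also have "\<dots> = b" by (simp only: mult.assoc[symmetric] * mult_1_left)
    finally show ?case .
  qed (simp_all add: f \<phi> \<phi>q fD)
  have bij: "bij f" by (rule o_bij[of f]) (auto simp: ff)
  note sD' = is_star_simps[OF star]
  have sh: "is_antihom (star :: 'n qalg \<Rightarrow> 'n qalg)" by (rule is_star_antihom[OF star])
  note sD = antihomD[OF sh]
  have comm: "f (star a) = star (f a)" for a
  proof (induction a rule: qalg_induct)
    case (inverse a b)
    have 1: "f (star a) * f (star b) = 1" "star (f b) * star (f a) = 1"
      using inverse(2,3) by (metis fD(2,3) sD(2,3))+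
    have "star (f b) = star (f b) * (f (star a) * f (star b))" by (simp only: 1 mult_1_right)
    also have "\<dots> = (star (f b) * star (f a)) * f (star b)" by (simp only: inverse(1) mult.assoc)
    finally show ?case by (simp only: 1 mult_1_left)
  qed (simp_all add: f \<phi> \<phi>q fD sD sD')
  have "is_prime_op f" by (simp add: is_prime_op_def f \<phi> \<phi>q fD bij comm)
  then show ?thesis by blast
qed

lemma is_prime_op_antihom:
  assumes "is_prime_op f"
  shows "is_antihom f"
proof -
  have "f (of_F (cst 1)) = of_F (cst 1)" using assms unfolding is_prime_op_def by blast
  then have "f 1 = 1" by simp
  with assms show ?thesis unfolding is_prime_op_def is_antihom_def by blast
qed

lemma is_prime_op_simps:
  assumes "is_prime_op f"
  shows "f (of_F (cst z)) = of_F (cst z)" "f (of_F qpar) = of_F qpar"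
    "f (of_F (qent i j)) = of_F (qent (opp i) (opp j))"
    "f (Xmat $ i $ j) = Xmat $ opp j $ opp i" "f (Ymat $ i $ j) = Ymat $ opp j $ opp i"
  using assms unfolding is_prime_op_def by blast+

lemma is_prime_op_unique: "is_prime_op f \<Longrightarrow> is_prime_op g \<Longrightarrow> f = g"
  by (rule antihom_ext) (simp_all only: is_prime_op_antihom is_prime_op_simps)

lemma prime_op: "is_prime_op prime_op"
  proof -
  have "\<exists>!f. is_prime_op (f :: 'a qalg \<Rightarrow> 'a qalg)"
    using is_prime_op_exists is_prime_op_unique by (rule ex_ex1I)
  then show ?thesis unfolding prime_op_def by (rule theI')
qed


section \<open>The invariant elements\<close>

text \<open>The matrices and vectors over \<open>F\<close> are taken with entries in the algebra, via \<^const>\<open>of_F\<close>.\<close>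

definition Dmat :: "'n qalg^'n::{finite,linorder}^'n::{finite,linorder}" where
  "Dmat = diagmat (\<lambda>i. of_F (qpar ^ (pos i - 1)))"

definition Dmat' :: "'n qalg^'n::{finite,linorder}^'n::{finite,linorder}" where
  "Dmat' = diagmat (\<lambda>i. of_F (qpar ^ (CARD('n) - pos i)))"

definition s_elem :: "nat \<Rightarrow> 'n::{finite,linorder} qalg" where
  "s_elem k = trace (matpow Dmat 2 ** matpow (Xmat ** Ymat) k)"

definition mq_r :: "('n \<Rightarrow> 'n) \<Rightarrow> 'n::{finite,linorder} ratfun" where
  "mq_r \<sigma> = (\<Prod>(i, j)\<in>{(i, j). i < j \<and> \<sigma> i > \<sigma> j}. - qent (\<sigma> i) (\<sigma> j))"

definition mq_c :: "('n \<Rightarrow> 'n) \<Rightarrow> 'n::{finite,linorder} ratfun" where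
  "mq_c \<sigma> = (\<Prod>(i, j)\<in>{(i, j). i < j \<and> \<sigma> i > \<sigma> j}. - qent (\<sigma> j) (\<sigma> i))"

definition qint :: "nat \<Rightarrow> 'n::{finite,linorder} ratfun" where
  "qint n = (\<Sum>k<n. qpar ^ (2 * k))"

definition qfact :: "nat \<Rightarrow> 'n::{finite,linorder} ratfun" where
  "qfact n = (\<Prod>k=1..n. qint k)"

text \<open>
  The \<open>N\<close>-th tensor power of the column space has its legs indexed by \<open>'n\<close> itself, leg number \<open>k\<close>
  being \<open>elt k\<close>. Thus a permutation \<open>\<sigma>\<close>, viewed as a multi-index, stands for the basis tensor
  with factor \<open>e (\<sigma> k)\<close> in leg \<open>k\<close>.
\<close>

definition u_vec :: "'n qalg^('n::{finite,linorder} \<Rightarrow> 'n)" where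
  "u_vec = (\<Sum>\<sigma> | \<sigma> permutes UNIV. axis \<sigma> (of_F (mq_c \<sigma>)))"

definition v_vec :: "'n qalg^('n::{finite,linorder} \<Rightarrow> 'n)" where
  "v_vec = (\<Sum>\<sigma> | \<sigma> permutes UNIV. axis \<sigma> (of_F (mq_r \<sigma>)))"

definition alpha :: "nat \<Rightarrow> 'n::{finite,linorder} ratfun" where
  "alpha i = 1 / qfact CARD('n) * (qfact CARD('n) / (qfact i * qfact (CARD('n) - i)))"

definition hatleg :: "nat \<Rightarrow> 'n qalg^('n::{finite,linorder} \<Rightarrow> 'n)^('n \<Rightarrow> 'n)" where
  "hatleg k = leg2 (elt k) (elt (k + 1)) (map_matrix of_F Rhat)"

text \<open>The product of \<open>(XY)\<^sub>0\<^sub>1\<close> and \<open>hatleg k\<close> for \<open>k = 1, \<dots>, i - 1\<close>, in this order.\<close>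

definition chain :: "nat \<Rightarrow> 'n qalg^('n::{finite,linorder} \<Rightarrow> 'n)^('n \<Rightarrow> 'n)" where
  "chain i = foldl (**) (leg1 (elt 1) (Xmat ** Ymat)) (map hatleg [1..<i])"

definition sigma_elem :: "nat \<Rightarrow> 'n::{finite,linorder} qalg" where
  "sigma_elem i =
     (if i = 0 then 1
      else of_F (inverse (qpar ^ ((i - 1) * i)) * alpha i) *
           scalar_product v_vec (matpow (chain i) i *v u_vec))"

end

theory Submission
  imports Defs "HOL-Combinatorics.Multiset_Permutations"
begin

text \<open>
  Let \<open>N\<close> be the number of indices, and write \<open>X\<^sub>k\<close>, \<open>Y\<^sub>k\<close>, \<open>h\<^sub>k\<^sub>l\<close> for \<open>X\<close>, \<open>Y\<close>, \<open>Rhat\<close> placed on the indicated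
  legs. The operation in question reverses products and replaces every index by the opposite one.
  It therefore sends the trace of \<open>D\<^sup>2 (X Y)\<^sup>k\<close> to the trace of \<open>D'\<^sup>2 (Y X)\<^sup>k\<close>, and the theorem amounts to an exchange
  law: weighted traces may be computed with the factors \<open>Y\<close> behind or in front of the factors \<open>X\<close>, provided
  that the weight is changed from \<open>D\<^sup>2\<close> to \<open>D'\<^sup>2\<close>.

  In terms of the braid operator, the defining relations read
  \<open>h\<^sub>k\<^sub>l X\<^sub>k X\<^sub>l = X\<^sub>k X\<^sub>l h\<^sub>k\<^sub>l\<close>, \<open>h\<^sub>k\<^sub>l Y\<^sub>l Y\<^sub>k = Y\<^sub>l Y\<^sub>k h\<^sub>k\<^sub>l\<close> and \<open>Y\<^sub>k h\<^sub>k\<^sub>l X\<^sub>k = X\<^sub>l h\<^sub>k\<^sub>l Y\<^sub>l\<close> (\<open>relations\<close>).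
  The exchange law combines the last of them with the fact that the partial trace of \<open>h\<^sub>k\<^sub>l\<close> over \<open>k\<close> with
  weight \<open>D'\<^sup>2\<close>, and over \<open>l\<close> with weight \<open>D\<^sup>2\<close>, is the identity (\<open>partial_trace_braid_op_left\<close>,
  \<open>partial_trace_braid_op_right\<close>). The power sums need it on two legs only: \<open>T = (X Y)\<^sup>m X\<close> satisfies
  \<open>Y\<^sub>k h\<^sub>k\<^sub>l T\<^sub>k = T\<^sub>l h\<^sub>k\<^sub>l Y\<^sub>l\<close> like \<open>X\<close> itself, and the traces of both sides give \<open>trace_exchange\<close>.

  For the elementary symmetric functions, let \<open>A\<close> be the antisymmetrizer on \<open>i\<close> legs, given by the products
  of the entries of \<open>u\<close> and \<open>v\<close>. Between \<open>v\<close> and \<open>u\<close>, the \<open>i\<close>-th power in the definition of \<open>\<sigma>(i)\<close> is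
  \<open>X\<^sub>1 \<dots> X\<^sub>i Y\<^sub>i \<dots> Y\<^sub>1\<close> times a full twist, which is a scalar there (\<open>matpow_twist\<close>). Contracting the remaining
  \<open>N - i\<close> legs of \<open>v\<close> and \<open>u\<close> produces the weight \<open>D\<^sup>2\<close> on the first \<open>i\<close> legs (\<open>trace_antisymmetrizer_legs\<close>). So \<open>\<sigma>(i)\<close> is, up to
  a factor fixed by the operation, the trace of \<open>A X\<^sub>1 \<dots> X\<^sub>i Y\<^sub>i \<dots> Y\<^sub>1\<close> weighted by \<open>D\<^sup>2\<close>, and its image is
  the trace of \<open>Y\<^sub>i \<dots> Y\<^sub>1 A X\<^sub>1 \<dots> X\<^sub>i\<close> weighted by \<open>D'\<^sup>2\<close> (\<open>prime_mixed_trace\<close>). The two agree because the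
  factors \<open>Y\<close> can be moved around the trace one at a time (\<open>mixed_trace_step\<close>, \<open>mixed_trace_exchange\<close>): each
  step brings in a new leg with weight \<open>D'\<^sup>2\<close>, lets one \<open>Y\<close> travel to it along a braid word, and discards an
  old leg with weight \<open>D\<^sup>2\<close>; the braid words are created and absorbed by \<open>A\<close>.
\<close>

type_synonym ('l, 'n) leg_op = "'n qalg^('l \<Rightarrow> 'n)^('l \<Rightarrow> 'n)"

section \<open>Operators on tensor legs\<close>

text \<open>
  The operator acts trivially outside the legs in \<open>S\<close>: it leaves the other entries of a multi-index
  unchanged, and its matrix entries do not depend on them. Because the entries lie in a noncommutative
  algebra, operators on disjoint legs need not commute; they do when one of them has central entries.
\<close>

definition on_legs :: "'l set \<Rightarrow> 'a::zero^('l::finite \<Rightarrow> 'n::finite)^('l \<Rightarrow> 'n) \<Rightarrow> bool" where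
  "on_legs S A \<longleftrightarrow>
     (\<forall>I J. A $ I $ J \<noteq> 0 \<longrightarrow> (\<forall>m. m \<notin> S \<longrightarrow> I m = J m)) \<and>
     (\<forall>I J I' J'. (\<forall>m\<in>S. I m = I' m \<and> J m = J' m) \<longrightarrow> (\<forall>m. m \<notin> S \<longrightarrow> I m = J m \<and> I' m = J' m) \<longrightarrow>
        A $ I $ J = A $ I' $ J')"

lemma on_legs_zero: "on_legs S A \<Longrightarrow> m \<notin> S \<Longrightarrow> I m \<noteq> J m \<Longrightarrow> A $ I $ J = 0"
  unfolding on_legs_def by blast

lemma on_legs_cong:
  "on_legs S A \<Longrightarrow> (\<And>m. m \<in> S \<Longrightarrow> I m = I' m \<and> J m = J' m) \<Longrightarrow>
    (\<And>m. m \<notin> S \<Longrightarrow> I m = J m \<and> I' m = J' m) \<Longrightarrow> A $ I $ J = A $ I' $ J'"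
  unfolding on_legs_def by blast

lemma on_legs_leg1: "on_legs {k} (leg1 k A)"
  by (auto simp: on_legs_def leg1_def)

lemma on_legs_leg2: "on_legs {k, l} (leg2 k l A)"
  by (auto simp: on_legs_def leg2_def)

lemma matrix_mult_nth: "(A ** B) $ i $ j = (\<Sum>k\<in>UNIV. A $ i $ k * B $ k $ j)"
  by (simp add: matrix_matrix_mult_def)

definition central_entries :: "'a::semiring_1^'n^'m \<Rightarrow> bool" where
  "central_entries A \<longleftrightarrow> (\<forall>i j b. A $ i $ j * b = b * A $ i $ j)"

lemma on_legs_mult_entry:
  fixes A B :: "'a::semiring_1^('l::finite \<Rightarrow> 'n::finite)^('l \<Rightarrow> 'n)"
  assumes "on_legs S A" "on_legs T B" "S \<inter> T = {}"
  shows "(A ** B) $ I $ J =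
    A $ I $ (\<lambda>m. if m \<in> S then J m else I m) * B $ (\<lambda>m. if m \<in> S then J m else I m) $ J"
proof -
  have "K = (\<lambda>m. if m \<in> S then J m else I m)" if "A $ I $ K * B $ K $ J \<noteq> 0" for K
  proof
    fix m
    from that have "A $ I $ K \<noteq> 0" "B $ K $ J \<noteq> 0" by auto
    then have "m \<notin> S \<longrightarrow> I m = K m" "m \<notin> T \<longrightarrow> K m = J m"
      using assms(1,2) unfolding on_legs_def by blast+
    with assms(3) show "K m = (if m \<in> S then J m else I m)" by auto
  qed
  then have "(A ** B) $ I $ J = (\<Sum>K\<in>{\<lambda>m. if m \<in> S then J m else I m}. A $ I $ K * B $ K $ J)"
    unfolding matrix_mult_nth by (intro sum.mono_neutral_right) auto
  then show ?thesis by simp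
qed

lemma on_legs_commute:
  fixes A B :: "'a::semiring_1^('l::finite \<Rightarrow> 'n::finite)^('l \<Rightarrow> 'n)"
  assumes A: "on_legs S A" and B: "on_legs T B" and ST: "S \<inter> T = {}" and c: "central_entries A"
  shows "A ** B = B ** A"
proof -
  have "(A ** B) $ I $ J = (B ** A) $ I $ J" for I J
  proof (cases "\<forall>m. m \<notin> S \<union> T \<longrightarrow> I m = J m")
    case True
    let ?K = "\<lambda>m. if m \<in> S then J m else I m" and ?L = "\<lambda>m. if m \<in> T then J m else I m"
    have 1: "A $ I $ ?K = A $ ?L $ J"
      using ST True by (intro on_legs_cong[OF A]) auto
    have 2: "B $ ?K $ J = B $ I $ ?L"
      using ST True by (intro on_legs_cong[OF B]) auto
    have "(A ** B) $ I $ J = A $ I $ ?K * B $ ?K $ J" by (rule on_legs_mult_entry[OF A B ST])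
    also have "\<dots> = B $ I $ ?L * A $ ?L $ J" using c by (simp add: 1 2 central_entries_def)
    also have "\<dots> = (B ** A) $ I $ J" by (rule on_legs_mult_entry[OF B A, symmetric]) (use ST in auto)
    finally show ?thesis .
  next
    case False
    then obtain m where m: "m \<notin> S" "m \<notin> T" "I m \<noteq> J m" by auto
    let ?K = "\<lambda>m. if m \<in> S then J m else I m" and ?L = "\<lambda>m. if m \<in> T then J m else I m"
    have "B $ ?K $ J = 0" 
      using m by (intro on_legs_zero[OF B, of m]) auto
    moreover have "A $ ?L $ J = 0"
      using m by (intro on_legs_zero[OF A, of m]) auto
    moreover have "T \<inter> S = {}" using ST by auto
    ultimately show ?thesis by (simp add: on_legs_mult_entry[OF A B ST] on_legs_mult_entry[OF B A])
  qed
  then show ?thesis by (simp add: vec_eq_iff)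
qed

lemma leg1_mult:
  fixes A B :: "'a::semiring_1^'n::finite^'n"
  shows "leg1 k (A ** B) = leg1 k A ** (leg1 k B :: 'a^('l::finite \<Rightarrow> 'n)^('l \<Rightarrow> 'n))"
proof -
  have "(leg1 k A ** leg1 k B) $ I $ J = leg1 k (A ** B) $ I $ J" for I J :: "'l \<Rightarrow> 'n"
  proof (cases "\<forall>m. m \<noteq> k \<longrightarrow> I m = J m")
    case True
    have "(leg1 k A ** leg1 k B) $ I $ J =
        (\<Sum>K\<in>range (\<lambda>a. I(k := a)). leg1 k A $ I $ K * leg1 k B $ K $ J)"
      unfolding matrix_mult_nth
    proof (intro sum.mono_neutral_right ballI)
      fix K assume K: "K \<in> UNIV - range (\<lambda>a. I(k := a))"
      show "leg1 k A $ I $ K * leg1 k B $ K $ J = 0"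
      proof (rule ccontr)
        assume "leg1 k A $ I $ K * leg1 k B $ K $ J \<noteq> 0"
        then have "leg1 k A $ I $ K \<noteq> 0" by auto
        then have "\<forall>m. m \<noteq> k \<longrightarrow> I m = K m" by (auto simp: leg1_def split: if_splits)
        then have "K = I(k := K k)" by auto
        with K show False by blast
      qed
    qed auto
    also have "\<dots> = (\<Sum>a\<in>UNIV. A $ I k $ a * B $ a $ J k)"
      by (subst sum.reindex) (auto simp: leg1_def True intro!: inj_onI sum.cong dest: fun_cong[of _ _ k])
    also have "\<dots> = leg1 k (A ** B) $ I $ J" using True by (simp add: leg1_def matrix_matrix_mult_def)
    finally show ?thesis .
  next
    case False
    then obtain m where m: "m \<noteq> k" "I m \<noteq> J m" by auto
    have "leg1 k A $ I $ K * leg1 k B $ K $ J = 0" for K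
    proof (cases "I m = K m")
      case True
      with m have "leg1 k B $ K $ J = 0" by (auto simp: leg1_def)
      then show ?thesis by simp
    next
      case False
      with m have "leg1 k A $ I $ K = 0" by (auto simp: leg1_def)
      then show ?thesis by simp
    qed
    moreover have "leg1 k (A ** B) $ I $ J = 0" using False by (auto simp: leg1_def)
    ultimately show ?thesis by (simp add: matrix_mult_nth)
  qed
  then show ?thesis by (simp add: vec_eq_iff)
qed

subsection \<open>Renaming and adding legs\<close>

text \<open>
  Renames the legs along \<open>f\<close> and acts trivially on the legs that are not hit. For injective \<open>f\<close> this
  is multiplicative, so it carries identities on two legs to any two legs, and it compares traces
  over leg sets of different size.
\<close>

definition embed_legs :: "('k::finite \<Rightarrow> 'l::finite) \<Rightarrow> 'a::zero^('k \<Rightarrow> 'n::finite)^('k \<Rightarrow> 'n) \<Rightarrow> 'a^('l \<Rightarrow> 'n)^('l \<Rightarrow> 'n)" where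
  "embed_legs f A = (\<chi> I J. if \<forall>m. m \<notin> range f \<longrightarrow> I m = J m then A $ (I \<circ> f) $ (J \<circ> f) else 0)"

lemma bij_betw_comp_inj:
  fixes f :: "'k \<Rightarrow> 'l" and I :: "'l \<Rightarrow> 'n"
  assumes f: "inj f"
  shows "bij_betw (\<lambda>K. K \<circ> f) {K. \<forall>m. m \<notin> range f \<longrightarrow> I m = K m} UNIV"
proof (rule bij_betwI[where g = "\<lambda>L m. if m \<in> range f then L (inv f m) else I m"])
  fix L :: "'k \<Rightarrow> 'n"
  show "(\<lambda>m. if m \<in> range f then L (inv f m) else I m) \<circ> f = L"
    using f by (auto simp: fun_eq_iff)
next
  fix K :: "'l \<Rightarrow> 'n"
  assume "K \<in> {K. \<forall>m. m \<notin> range f \<longrightarrow> I m = K m}"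
  then show "(\<lambda>m. if m \<in> range f then (K \<circ> f) (inv f m) else I m) = K"
    using f by (auto simp: fun_eq_iff)
qed auto

lemma embed_legs_mult:
  fixes A B :: "'a::semiring_1^('k::finite \<Rightarrow> 'n::finite)^('k \<Rightarrow> 'n)" and f :: "'k \<Rightarrow> 'l::finite"
  assumes f: "inj f"
  shows "embed_legs f (A ** B) = embed_legs f A ** embed_legs f B"
proof -
  have "(embed_legs f A ** embed_legs f B) $ I $ J = embed_legs f (A ** B) $ I $ J" for I J
  proof (cases "\<forall>m. m \<notin> range f \<longrightarrow> I m = J m")
    case True
    have "(embed_legs f A ** embed_legs f B) $ I $ J =
        (\<Sum>K | \<forall>m. m \<notin> range f \<longrightarrow> I m = K m. embed_legs f A $ I $ K * embed_legs f B $ K $ J)"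
      unfolding matrix_mult_nth
      by (rule sum.mono_neutral_right) (auto simp: embed_legs_def split: if_splits)
    also have "\<dots> = (\<Sum>K | \<forall>m. m \<notin> range f \<longrightarrow> I m = K m. A $ (I \<circ> f) $ (K \<circ> f) * B $ (K \<circ> f) $ (J \<circ> f))"
      using True by (intro sum.cong) (auto simp: embed_legs_def)
    also have "\<dots> = (\<Sum>K\<in>UNIV. A $ (I \<circ> f) $ K * B $ K $ (J \<circ> f))"
      by (rule sum.reindex_bij_betw[OF bij_betw_comp_inj[OF f]])
    also have "\<dots> = embed_legs f (A ** B) $ I $ J"
      using True by (simp add: embed_legs_def matrix_matrix_mult_def)
    finally show ?thesis .
  next
    case False
    then obtain m where m: "m \<notin> range f" "I m \<noteq> J m" by auto
    have "embed_legs f A $ I $ K * embed_legs f B $ K $ J = 0" for K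
    proof (cases "I m = K m")
      case True
      with m have "embed_legs f B $ K $ J = 0" by (auto simp: embed_legs_def)
      then show ?thesis by simp
    next
      case False
      with m have "embed_legs f A $ I $ K = 0" by (auto simp: embed_legs_def)
      then show ?thesis by simp
    qed
    moreover have "embed_legs f (A ** B) $ I $ J = 0" using False by (auto simp: embed_legs_def)
    ultimately show ?thesis by (simp add: matrix_mult_nth)
  qed
  then show ?thesis by (simp add: vec_eq_iff)
qed

lemma off_range_iff:
  "(\<forall>m. m \<notin> range f \<longrightarrow> I m = J m) \<and> (\<forall>m. P m \<longrightarrow> (I \<circ> f) m = (J \<circ> f) m) \<longleftrightarrow>
     (\<forall>m. m \<notin> f ` {m. \<not> P m} \<longrightarrow> I m = J m)" if "inj f"
proof (intro iffI conjI allI impI; (elim conjE)?)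
  fix m assume 1: "\<forall>m. m \<notin> range f \<longrightarrow> I m = J m" "\<forall>m. P m \<longrightarrow> (I \<circ> f) m = (J \<circ> f) m"
    and m: "m \<notin> f ` {m. \<not> P m}"
  show "I m = J m"
  proof (cases "m \<in> range f")
    case True
    with m obtain k where "m = f k" "P k" by blast
    with 1(2) show ?thesis by simp
  qed (use 1 in simp)
next
  fix m assume "\<forall>m. m \<notin> f ` {m. \<not> P m} \<longrightarrow> I m = J m" "P m"
  moreover from this have "f m \<notin> f ` {m. \<not> P m}" using that by (auto simp: inj_eq)
  ultimately show "(I \<circ> f) m = (J \<circ> f) m" by simp
qed blast

lemma if_conj: "(P \<and> Q \<longleftrightarrow> R) \<Longrightarrow> (if P then (if Q then x else y) else y) = (if R then x else y)"
  by auto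

lemma embed_legs_leg1:
  fixes A :: "'a::zero^'n::finite^'n"
  assumes f: "inj f"
  shows "embed_legs f (leg1 k A) = leg1 (f k) A"
proof -
  have "(\<forall>m. m \<notin> range f \<longrightarrow> I m = J m) \<and> (\<forall>m. m \<noteq> k \<longrightarrow> (I \<circ> f) m = (J \<circ> f) m) \<longleftrightarrow>
     (\<forall>m. m \<noteq> f k \<longrightarrow> I m = J m)" for I J :: "_ \<Rightarrow> 'n"
    using off_range_iff[OF f, of I J "\<lambda>m. m \<noteq> k"] by simp
  then show ?thesis
    unfolding vec_eq_iff embed_legs_def leg1_def vec_lambda_beta comp_apply by (intro allI if_conj)
qed

lemma embed_legs_leg2:
  fixes A :: "'a::zero^('n::finite \<times> 'n)^('n \<times> 'n)"
  assumes f: "inj f"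
  shows "embed_legs f (leg2 k l A) = leg2 (f k) (f l) A"
proof -
  have "{m. \<not> (m \<noteq> k \<and> m \<noteq> l)} = {k, l}" by auto
  then have "(\<forall>m. m \<notin> range f \<longrightarrow> I m = J m) \<and> (\<forall>m. m \<noteq> k \<and> m \<noteq> l \<longrightarrow> (I \<circ> f) m = (J \<circ> f) m) \<longleftrightarrow>
     (\<forall>m. m \<noteq> f k \<and> m \<noteq> f l \<longrightarrow> I m = J m)" for I J :: "_ \<Rightarrow> 'n"
    using off_range_iff[OF f, of I J "\<lambda>m. m \<noteq> k \<and> m \<noteq> l"] by (simp only:) simp
  then show ?thesis
    unfolding vec_eq_iff embed_legs_def leg2_def vec_lambda_beta comp_apply by (intro allI if_conj)
qed

section \<open>The braid operators\<close>

text \<open>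
  Transposition turns \<open>Rhat\<close> into the same operator with \<open>q\<^sub>i\<^sub>j\<close> and \<open>q\<^sub>j\<^sub>i\<close> exchanged. Everything about the
  braid operator is therefore proved for parameters \<open>p\<close> with these two properties, a class closed under
  that exchange; statements about rows then follow from statements about columns.
\<close>

definition hecke_params :: "('n \<Rightarrow> 'n \<Rightarrow> 'n::{finite,linorder} ratfun) \<Rightarrow> bool" where
  "hecke_params p \<longleftrightarrow> (\<forall>a. p a a = 1) \<and> (\<forall>a b. a \<noteq> b \<longrightarrow> p a b * p b a = qpar\<^sup>2)"

lemma hecke_params_qent: "hecke_params qent"
  by (simp add: hecke_params_def qent_mult) (simp add: qent_def)

lemma hecke_params_flip: "hecke_params p \<Longrightarrow> hecke_params (\<lambda>a b. p b a)"
  by (auto simp: hecke_params_def)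

definition braid_mat :: "('n \<Rightarrow> 'n \<Rightarrow> 'n::{finite,linorder} ratfun) \<Rightarrow> 'n ratfun^('n \<times> 'n)^('n \<times> 'n)" where
  "braid_mat p = (\<chi> x y. (if y = prod.swap x then p (snd x) (fst x) else 0) +
                   (if y = x \<and> snd x < fst x then 1 - qpar\<^sup>2 else 0))"

lemma Rhat_eq: "Rhat = (braid_mat qent :: 'n::{finite,linorder} ratfun^('n \<times> 'n)^('n \<times> 'n))"
proof -
  have f: "flipmat $ (a, b) $ y = (if y = (b, a) then 1 else (0 :: 'n ratfun))" for a b :: 'n and y
  proof -
    have "flipmat $ (a, b) $ y =
       (\<Sum>i\<in>UNIV. \<Sum>j\<in>UNIV. if i = a then if j = b then (if y = (b, a) then 1 else 0) else 0 else (0 :: 'n ratfun))"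
      by (cases y) (auto simp: flipmat_def kron_def munit_def intro!: sum.cong)
    also have "\<dots> = (\<Sum>i\<in>UNIV. if i = a then (if y = (b, a) then 1 else 0) else (0 :: 'n ratfun))"
      by (intro sum.cong refl) simp
    finally show ?thesis by simp
  qed
  have "Rhat $ (a, b) $ y = (braid_mat qent :: 'n ratfun^_^_) $ (a, b) $ y" for a b :: 'n and y
  proof -
    have "Rhat $ (a, b) $ y = (\<Sum>k\<in>UNIV. if k = (b, a) then Rmat $ k $ y else (0 :: 'n ratfun))"
      unfolding Rhat_def matrix_mult_nth f
      by (intro sum.cong refl) (simp only: if_distrib[of "\<lambda>x. x * _"] mult_1_left mult_zero_left)
    also have "\<dots> = Rmat $ (b, a) $ (fst y, snd y)"
      by (simp only: sum.delta finite UNIV_I if_True prod.collapse)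
    also have "\<dots> = braid_mat qent $ (a, b) $ y"
      unfolding Rmat_nth braid_mat_def vec_lambda_beta fst_conv snd_conv swap_simp prod_eq_iff
      by (intro arg_cong2[of _ _ _ _ "(+)"] if_cong) (blast intro: sym)+
    finally show ?thesis .
  qed
  then show ?thesis by (simp add: vec_eq_iff)
qed

definition braid_op :: "('n \<Rightarrow> 'n \<Rightarrow> 'n::{finite,linorder} ratfun) \<Rightarrow> 'l::finite \<Rightarrow> 'l \<Rightarrow> ('l, 'n) leg_op" where
  "braid_op p k l = leg2 k l (map_matrix of_F (braid_mat p))"

definition swap_at :: "'l \<Rightarrow> 'l \<Rightarrow> ('l \<Rightarrow> 'n) \<Rightarrow> 'l \<Rightarrow> 'n" where
  "swap_at k l I = I(k := I l, l := I k)"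

lemma swap_at_swap_at [simp]: "swap_at k l (swap_at k l I) = I"
  by (auto simp: swap_at_def)

lemma if_conj_add: "(if P then (if A then x else 0) + (if B \<and> C then y else 0) else 0) =
    (if P \<and> A then x else 0) + (if (P \<and> B) \<and> C then y else (0::'a::monoid_add))"
  by auto

lemma leg2_braid_mat_nth:
  assumes "k \<noteq> l"
  shows "leg2 k l (braid_mat p) $ I $ J = (if J = swap_at k l I then p (I l) (I k) else 0) +
      (if J = I \<and> I l < I k then 1 - qpar\<^sup>2 else 0)"
proof -
  have 1: "J = swap_at k l I \<longleftrightarrow> (\<forall>m. m \<noteq> k \<and> m \<noteq> l \<longrightarrow> I m = J m) \<and> (J k, J l) = (I l, I k)"
    using assms by (auto simp: swap_at_def fun_eq_iff)
  have 2: "J = I \<longleftrightarrow> (\<forall>m. m \<noteq> k \<and> m \<noteq> l \<longrightarrow> I m = J m) \<and> (J k, J l) = (I k, I l)"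
    unfolding prod.inject by (metis ext)
  show ?thesis
    unfolding 1 2 leg2_def braid_mat_def vec_lambda_beta fst_conv snd_conv swap_simp
    by (rule if_conj_add)
qed

lemma braid_op_map: "braid_op p k l = map_matrix of_F (leg2 k l (braid_mat p))"
  by (auto simp: braid_op_def vec_eq_iff leg2_def)

lemma braid_op_nth:
  assumes "k \<noteq> l"
  shows "braid_op p k l $ I $ J = (if J = swap_at k l I then of_F (p (I l) (I k)) else 0) +
      (if J = I \<and> I l < I k then of_F (1 - qpar\<^sup>2) else 0)"
  by (simp add: braid_op_map leg2_braid_mat_nth[OF assms] of_F_add)

lemma central_map_of_F: "central_entries (map_matrix of_F A)"
  by (simp add: central_entries_def of_F_central)

lemma central_braid_op: "central_entries (braid_op p k l)"
  unfolding braid_op_map by (rule central_map_of_F)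

lemma on_legs_braid_op: "on_legs {k, l} (braid_op p k l)"
  unfolding braid_op_def by (rule on_legs_leg2)

lemma sum_two_deltas:
  fixes f :: "'b::finite \<Rightarrow> 'a::semiring_1"
  shows "(\<Sum>K\<in>UNIV. ((if K = A then c else 0) + (if K = B \<and> P then d else 0)) * f K) =
     c * f A + (if P then d * f B else 0)"
proof -
  have "(\<Sum>K\<in>UNIV. ((if K = A then c else 0) + (if K = B \<and> P then d else 0)) * f K) =
    (\<Sum>K\<in>UNIV. (if K = A then c * f A else 0) + (if K = B then if P then d * f B else 0 else 0))"
    by (intro sum.cong) (auto simp: distrib_right)
  then show ?thesis by (simp add: sum.distrib)
qed

lemma braid_op_mult_nth:
  assumes "k \<noteq> l"
  shows "(braid_op p k l ** M) $ I $ J = of_F (p (I l) (I k)) * M $ swap_at k l I $ J +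
     (if I l < I k then of_F (1 - qpar\<^sup>2) * M $ I $ J else 0)"
  unfolding matrix_mult_nth braid_op_nth[OF assms] by (rule sum_two_deltas)

lemma leg2_braid_mat_mult_nth:
  assumes "k \<noteq> l"
  shows "(leg2 k l (braid_mat p) ** M) $ I $ J = p (I l) (I k) * M $ swap_at k l I $ J +
     (if I l < I k then (1 - qpar\<^sup>2) * M $ I $ J else 0)"
  unfolding matrix_mult_nth leg2_braid_mat_nth[OF assms] by (rule sum_two_deltas)

lemma transpose_braid_op:
  assumes "k \<noteq> l"
  shows "transpose (braid_op p k l) = braid_op (\<lambda>a b. p b a) k l"
proof -
  have "braid_op p k l $ J $ I = braid_op (\<lambda>a b. p b a) k l $ I $ J" for I J
  proof -
    have "I = swap_at k l J \<longleftrightarrow> J = swap_at k l I" by auto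
    moreover have "J = swap_at k l I \<Longrightarrow> J k = I l \<and> J l = I k"
      using assms by (auto simp: swap_at_def)
    ultimately show ?thesis unfolding braid_op_nth[OF assms]
      by (cases "J = swap_at k l I") auto
  qed
  then show ?thesis by (simp add: vec_eq_iff transpose_def)
qed

lemma of_F_sum: "of_F (sum g S) = (\<Sum>x\<in>S. of_F (g x))"
  by (induction S rule: infinite_finite_induct) (simp_all add: of_F_add)

lemma map_matrix_of_F_mult: "map_matrix of_F (A ** B) = map_matrix of_F A ** map_matrix of_F B"
  by (simp add: vec_eq_iff matrix_mult_nth of_F_mult of_F_sum)

text \<open>
  The braid relation, evaluated at a triple of entries: \<open>s\<close> and \<open>t\<close> describe how the braid operators
  on the legs 1, 2 and 2, 3 act on a function of three indices. The thirteen possible orderings of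
  the triple turn it into polynomial identities modulo \<open>p x y * p y x = qpar\<^sup>2\<close>.
\<close>

lemma braid_triple:
  fixes f :: "'n::{finite,linorder} \<Rightarrow> 'n \<Rightarrow> 'n \<Rightarrow> 'n ratfun"
  assumes p: "hecke_params p"
    and s_def: "\<And>f x y z. s f x y z = p y x * f y x z + (if y < x then (1 - qpar\<^sup>2) * f x y z else 0)"
    and t_def: "\<And>f x y z. t f x y z = p z y * f x z y + (if z < y then (1 - qpar\<^sup>2) * f x y z else 0)"
  shows "s (t (s f)) x y z = t (s (t f)) x y z"
proof -
  have d: "p a a = 1" for a using p by (simp add: hecke_params_def)
  have m: "p a b * p b a = qpar\<^sup>2" if "a \<noteq> b" for a b using p that by (simp add: hecke_params_def)
  have nz: "p a b \<noteq> 0" for a b using m[of a b] d[of a] by (cases "a = b") auto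
  have r: "p b a = qpar\<^sup>2 / p a b" if "a < b" for a b using m[of b a] that nz[of a b] by (simp add: field_simps)
  consider "x = y" "y = z" "x = z"
    | "x = y" "y < z" "\<not> z < y" "y \<noteq> z" "x < z" "\<not> z < x" "x \<noteq> z"
    | "x < y" "\<not> y < x" "x \<noteq> y" "z < y" "\<not> y < z" "y \<noteq> z" "x = z"
    | "x < y" "\<not> y < x" "x \<noteq> y" "y = z" "x < z" "\<not> z < x" "x \<noteq> z"
    | "x < y" "\<not> y < x" "x \<noteq> y" "y < z" "\<not> z < y" "y \<noteq> z" "x < z" "\<not> z < x" "x \<noteq> z"
    | "x < y" "\<not> y < x" "x \<noteq> y" "z < y" "\<not> y < z" "y \<noteq> z" "x < z" "\<not> z < x" "x \<noteq> z"
    | "y < x" "\<not> x < y" "x \<noteq> y" "y = z" "z < x" "\<not> x < z" "x \<noteq> z"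
    | "y < x" "\<not> x < y" "x \<noteq> y" "y < z" "\<not> z < y" "y \<noteq> z" "x = z"
    | "y < x" "\<not> x < y" "x \<noteq> y" "y < z" "\<not> z < y" "y \<noteq> z" "x < z" "\<not> z < x" "x \<noteq> z"
    | "x = y" "z < y" "\<not> y < z" "y \<noteq> z" "z < x" "\<not> x < z" "x \<noteq> z"
    | "x < y" "\<not> y < x" "x \<noteq> y" "z < y" "\<not> y < z" "y \<noteq> z" "z < x" "\<not> x < z" "x \<noteq> z"
    | "y < x" "\<not> x < y" "x \<noteq> y" "y < z" "\<not> z < y" "y \<noteq> z" "z < x" "\<not> x < z" "x \<noteq> z"
    | "y < x" "\<not> x < y" "x \<noteq> y" "z < y" "\<not> y < z" "y \<noteq> z" "z < x" "\<not> x < z" "x \<noteq> z"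
    by (metis linorder_less_linear order.strict_trans less_irrefl)
  then show ?thesis
    by cases (simp_all add: s_def t_def d r nz field_simps)
qed

lemma braid:
  fixes k l m :: "'l::finite" and p :: "'n \<Rightarrow> 'n \<Rightarrow> 'n::{finite,linorder} ratfun"
  assumes p: "hecke_params p" and klm: "k \<noteq> l" "l \<noteq> m" "k \<noteq> m"
  shows "braid_op p k l ** braid_op p l m ** braid_op p k l = braid_op p l m ** braid_op p k l ** braid_op p l m"
proof -
  let ?A = "leg2 k l (braid_mat p)" and ?B = "leg2 l m (braid_mat p)"
  have "(?A ** (?B ** (?A ** M))) $ I $ J = (?B ** (?A ** (?B ** M))) $ I $ J"
    for M :: "'n ratfun^('l \<Rightarrow> 'n)^('l \<Rightarrow> 'n)" and I J
  proof -
    define g where "g M = (\<lambda>x y z. M $ (I(k := x, l := y, m := z)) $ J)" for M :: "'n ratfun^('l \<Rightarrow> 'n)^('l \<Rightarrow> 'n)"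
    define s where "s f = (\<lambda>x y z. p y x * f y x z + (if y < x then (1 - qpar\<^sup>2) * f x y z else 0))"
      for f :: "'n \<Rightarrow> 'n \<Rightarrow> 'n \<Rightarrow> 'n ratfun"
    define t where "t f = (\<lambda>x y z. p z y * f x z y + (if z < y then (1 - qpar\<^sup>2) * f x y z else 0))"
      for f :: "'n \<Rightarrow> 'n \<Rightarrow> 'n \<Rightarrow> 'n ratfun"
    have 1: "swap_at k l (I(k := x, l := y, m := z)) = I(k := y, l := x, m := z)"
      "swap_at l m (I(k := x, l := y, m := z)) = I(k := x, l := z, m := y)" for x y z
      using klm by (auto simp: swap_at_def fun_eq_iff)
    have A: "g (?A ** M) = s (g M)" and B: "g (?B ** M) = t (g M)" for M
      using klm by (simp_all add: g_def s_def t_def fun_eq_iff leg2_braid_mat_mult_nth 1)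
    have "s (t (s (g M))) x y z = t (s (t (g M))) x y z" for x y z
      by (rule braid_triple[of p s t, OF p]) (simp_all only: s_def t_def)
    then have "g (?A ** (?B ** (?A ** M))) (I k) (I l) (I m) = g (?B ** (?A ** (?B ** M))) (I k) (I l) (I m)"
      by (simp only: A B)
    then show ?thesis by (simp add: g_def)
  qed
  from this[of "mat 1"] have "?A ** ?B ** ?A = ?B ** ?A ** ?B"
    by (simp add: vec_eq_iff matrix_mul_assoc)
  from arg_cong[OF this, of "map_matrix of_F"] show ?thesis
    by (simp only: braid_op_map map_matrix_of_F_mult)
qed

section \<open>Weighted traces\<close>

definition unitop :: "'l::finite \<Rightarrow> 'n \<Rightarrow> 'n \<Rightarrow> 'a::semiring_1^('l \<Rightarrow> 'n::finite)^('l \<Rightarrow> 'n)" where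
  "unitop x a b = leg1 x (munit a b)"

lemma unitop_nth: "unitop x a b $ I $ J = (if I x = a \<and> J = I(x := b) then 1 else 0)"
  by (auto simp: unitop_def leg1_def munit_def fun_eq_iff)

lemma unitop_nth': "unitop x a b $ I $ J = (if J x = b \<and> I = J(x := a) then 1 else 0)"
  by (auto simp: unitop_def leg1_def munit_def fun_eq_iff)

lemma unitop_mult_nth: "(unitop x a b ** M) $ I $ J = (if I x = a then M $ (I(x := b)) $ J else 0)"
proof -
  have "(unitop x a b ** M) $ I $ J = (\<Sum>K\<in>UNIV. if K = I(x := b) then if I x = a then M $ K $ J else 0 else 0)"
    unfolding matrix_mult_nth unitop_nth by (intro sum.cong) auto
  then show ?thesis by simp
qed

lemma mult_unitop_nth: "(M ** unitop x a b) $ I $ J = (if J x = b then M $ I $ (J(x := a)) else 0)"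
proof -
  have "(M ** unitop x a b) $ I $ J = (\<Sum>K\<in>UNIV. if K = J(x := a) then if J x = b then M $ I $ K else 0 else 0)"
    unfolding matrix_mult_nth unitop_nth' by (intro sum.cong) auto
  then show ?thesis by simp
qed

lemma central_unitop: "central_entries (unitop x a b)"
  by (simp add: central_entries_def unitop_nth)

text \<open>
  Trivial action on the leg \<open>x\<close>, expressed as commutation with the (scalar) matrix units on that leg.
  In this form it is inherited by products, and partial traces over \<open>x\<close> are linear over such operators
  by associativity alone.
\<close>

definition free_leg :: "'l::finite \<Rightarrow> 'a::semiring_1^('l \<Rightarrow> 'n::finite)^('l \<Rightarrow> 'n) \<Rightarrow> bool" where
  "free_leg x A \<longleftrightarrow> (\<forall>a b. unitop x a b ** A = A ** unitop x a b)"

lemma free_leg_on_legs: "on_legs S A \<Longrightarrow> x \<notin> S \<Longrightarrow> free_leg x A"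
  unfolding free_leg_def
  by (intro allI on_legs_commute[of "{x}" _ S]) (auto simp: unitop_def on_legs_leg1 central_unitop[unfolded unitop_def])

lemma free_leg_mult: "free_leg x A \<Longrightarrow> free_leg x B \<Longrightarrow> free_leg x (A ** B)"
  unfolding free_leg_def by (metis matrix_mul_assoc)

lemma free_leg_mat1 [simp]: "free_leg x (mat 1)"
  by (simp add: free_leg_def)

definition partial_trace :: "('n \<Rightarrow> 'n ratfun) \<Rightarrow> 'l::finite \<Rightarrow> ('l, 'n::{finite,linorder}) leg_op \<Rightarrow> ('l, 'n) leg_op" where
  "partial_trace w x M = (\<Sum>a\<in>UNIV. \<Sum>b\<in>UNIV. unitop x a b ** smat (of_F (w b)) M ** unitop x b a)"

text \<open>
  The sandwich with matrix units in the definition is the usual partial trace, weighted by \<open>w\<close>, with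
  the identity put back on the leg \<open>x\<close>.
\<close>

lemma partial_trace_nth: "partial_trace w x M $ I $ J =
    (if I x = J x then \<Sum>b\<in>UNIV. of_F (w b) * M $ (I(x := b)) $ (J(x := b)) else 0)"
proof -
  let ?T = "\<Sum>b\<in>UNIV. of_F (w b) * M $ (I(x := b)) $ (J(x := b))"
  have "(\<Sum>b\<in>UNIV. (unitop x a b ** smat (of_F (w b)) M ** unitop x b a) $ I $ J) =
      (if a = I x then if I x = J x then ?T else 0 else 0)" for a
    unfolding mult_unitop_nth unitop_mult_nth
    by (cases "J x = a"; cases "I x = a") (auto simp: smat_def)
  then have "partial_trace w x M $ I $ J = (\<Sum>a\<in>UNIV. if a = I x then if I x = J x then ?T else 0 else 0)"
    unfolding partial_trace_def sum_component by simp
  then show ?thesis by simp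
qed

lemma matrix_mult_sum:
  fixes A B :: "'a::semiring_1^'n::finite^'n"
  shows "A ** sum g S = (\<Sum>x\<in>S. A ** g x)" "sum g S ** B = (\<Sum>x\<in>S. g x ** B)"
  by (simp_all add: vec_eq_iff matrix_mult_nth sum_distrib_left sum_distrib_right)
     (subst sum.swap, simp)+

lemma smat_of_F_mult:
  "A ** smat (of_F c) B = smat (of_F c) (A ** B)" "smat (of_F c) A ** B = smat (of_F c) (A ** B)"
proof -
  have *: "a * (of_F c * b) = of_F c * (a * b)" for a b
    by (metis mult.assoc of_F_central)
  show "A ** smat (of_F c) B = smat (of_F c) (A ** B)" "smat (of_F c) A ** B = smat (of_F c) (A ** B)"
    by (simp_all add: vec_eq_iff matrix_mult_nth smat_def sum_distrib_left * mult.assoc)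
qed

lemma partial_trace_mult:
  assumes "free_leg x A" "free_leg x B"
  shows "partial_trace w x (A ** M ** B) = A ** partial_trace w x M ** B"
proof -
  have "unitop x a b ** (A ** M ** B) ** unitop x b a = A ** (unitop x a b ** M ** unitop x b a) ** B" for a b
  proof -
    have "unitop x a b ** (A ** M ** B) ** unitop x b a = unitop x a b ** A ** M ** (B ** unitop x b a)"
      by (simp only: matrix_mul_assoc)
    also have "\<dots> = A ** unitop x a b ** M ** (unitop x b a ** B)"
      using assms by (simp only: free_leg_def)
    finally show ?thesis by (simp only: matrix_mul_assoc)
  qed
  then show ?thesis
    by (simp add: partial_trace_def matrix_mult_sum smat_of_F_mult)
qed

definition weighted_trace :: "('l \<Rightarrow> 'n \<Rightarrow> 'n ratfun) \<Rightarrow> ('l::finite, 'n::{finite,linorder}) leg_op \<Rightarrow> 'n qalg" where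
  "weighted_trace W M = (\<Sum>I\<in>UNIV. of_F (\<Prod>k\<in>UNIV. W k (I k)) * M $ I $ I)"

text \<open>
  In the double sum over a multi-index \<open>I\<close> and a summation index \<open>b\<close>, exchange \<open>b\<close> with the entry
  of \<open>I\<close> at \<open>x\<close>: the old weight of the leg \<open>x\<close> then sums up freely.
\<close>

lemma weighted_trace_partial_trace: "weighted_trace W (partial_trace w x M) = of_F (\<Sum>a\<in>UNIV. W x a) * weighted_trace (W(x := w)) M"
proof -
  define V where "V I = (\<Prod>k\<in>-{x}. W k (I k))" for I
  have V: "V (I(x := b)) = V I" for I b unfolding V_def by (intro prod.cong) auto
  have W: "(\<Prod>k\<in>UNIV. W k (I k)) = W x (I x) * V I" for I
    unfolding V_def by (subst prod.remove[of UNIV x]) (auto simp: Compl_eq_Diff_UNIV)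
  have W': "(\<Prod>k\<in>UNIV. (W(x := w)) k (I k)) = w (I x) * V I" for I
    unfolding V_def by (subst prod.remove[of UNIV x]) (auto simp: Compl_eq_Diff_UNIV intro!: prod.cong)
  have "weighted_trace W (partial_trace w x M) =
     (\<Sum>(I, b)\<in>UNIV. of_F (W x (I x) * V I * w b) * M $ (I(x := b)) $ (I(x := b)))"
    by (simp add: weighted_trace_def W partial_trace_nth sum_distrib_left sum.cartesian_product of_F_mult mult.assoc flip: UNIV_Times_UNIV)
  also have "\<dots> = (\<Sum>(I, b)\<in>UNIV. of_F (W x b * (w (I x) * V I)) * M $ I $ I)"
    by (rule sum.reindex_bij_witness[of _ "\<lambda>(I, b). (I(x := b), I x)" "\<lambda>(I, b). (I(x := b), I x)"])
       (auto simp: V mult_ac)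
  also have "\<dots> = of_F (\<Sum>a\<in>UNIV. W x a) * weighted_trace (W(x := w)) M"
    unfolding weighted_trace_def W' of_F_sum sum_product
    by (subst sum.swap) (simp add: sum.cartesian_product of_F_mult mult.assoc flip: UNIV_Times_UNIV)
  finally show ?thesis .
qed

lemma weighted_trace_smat: "weighted_trace W (smat (of_F c) M) = of_F c * weighted_trace W M"
proof -
  have "of_F a * (of_F c * b) = of_F c * (of_F a * b)" for a b
    by (metis mult.assoc of_F_central)
  then show ?thesis by (simp add: weighted_trace_def smat_def sum_distrib_left)
qed

text \<open>
  Read from left to right, this creates a factor \<open>M\<close> that involves a new leg \<open>x\<close>, with weight \<open>w\<close> there;
  read from right to left, it removes \<open>M\<close> together with the leg. It will be used for braid operators.
\<close>

lemma weighted_trace_insert: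
  assumes "free_leg x A" "free_leg x B" "partial_trace w x M = mat 1" "(\<Sum>a\<in>UNIV. W x a) = 1"
  shows "weighted_trace W (A ** B) = weighted_trace (W(x := w)) (A ** M ** B)"
  using weighted_trace_partial_trace[of W w x "A ** M ** B"] by (simp add: partial_trace_mult assms)

subsection \<open>The two weights\<close>

text \<open>
  The diagonal entries of the squares of \<open>D\<close> and, below, of \<open>D'\<close>.
\<close>

definition weight_D :: "'n::{finite,linorder} \<Rightarrow> 'n ratfun" where
  "weight_D a = qpar ^ (2 * (pos a - 1))"

definition weight_D' :: "'n::{finite,linorder} \<Rightarrow> 'n ratfun" where
  "weight_D' a = qpar ^ (2 * (CARD('n) - pos a))"

lemma weight_D'_opp: "weight_D' (opp a) = weight_D a" and weight_D_opp: "weight_D (opp a) = weight_D' a"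
  using pos_range[of a] by (auto simp: weight_D'_def weight_D_def pos_opp)

text \<open>
  A telescoping geometric sum.
\<close>

lemma weight_D_sum: "weight_D a + (1 - qpar\<^sup>2) * (\<Sum>b | b < a. weight_D b) = 1"
proof -
  have "bij_betw (\<lambda>b. pos b - 1) {b. b < a} {..<pos a - 1}"
  proof (rule bij_betw_byWitness[where f' = "\<lambda>k. elt (Suc k)"])
    show "\<forall>b\<in>{b. b < a}. elt (Suc (pos b - 1)) = b"
      using pos_range(1) by (metis Suc_diff_1 elt_pos less_le_trans zero_less_one)
    show "\<forall>k\<in>{..<pos a - 1}. pos (elt (Suc k) :: 'a) - 1 = k"
      using pos_range(2)[of a] by (auto simp: pos_elt)
    show "(\<lambda>b. pos b - 1) ` {b. b < a} \<subseteq> {..<pos a - 1}"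
      using pos_range(1) by (auto simp flip: pos_less_iff intro!: diff_less_mono)
    show "(\<lambda>k. elt (Suc k)) ` {..<pos a - 1} \<subseteq> {b. b < a}"
      using pos_range(2)[of a] by (auto simp: pos_elt simp flip: pos_less_iff)
  qed
  then have "(\<Sum>b | b < a. weight_D b) = (\<Sum>k<pos a - 1. (qpar\<^sup>2) ^ k)"
    unfolding weight_D_def power_mult by (rule sum.reindex_bij_betw)
  moreover have "weight_D a = (qpar\<^sup>2) ^ (pos a - 1)" by (simp add: weight_D_def power_mult)
  moreover have "(1 - qpar\<^sup>2) * (\<Sum>k<pos a - 1. (qpar\<^sup>2) ^ k) = 1 - (qpar\<^sup>2) ^ (pos a - 1)"
    by (rule one_diff_power_eq[symmetric])
  ultimately show ?thesis by (metis add.commute diff_add_cancel)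
qed

lemma weight_D'_sum: "weight_D' a + (1 - qpar\<^sup>2) * (\<Sum>b | a < b. weight_D' b) = 1"
proof -
  have "(\<Sum>b | a < b. weight_D' b) = (\<Sum>b | b < opp a. weight_D b)"
    by (rule sum.reindex_bij_witness[of _ opp opp]) (auto simp: opp_less_iff weight_D_opp, metis opp_less_iff opp_opp)
  then show ?thesis using weight_D_sum[of "opp a"] by (simp add: weight_D_opp)
qed

text \<open>
  The weights of \<open>D'\<close> and \<open>D\<close> are those for which closing the left, respectively the right strand of a
  single crossing gives the identity.
\<close>

lemma partial_trace_braid_op_left:
  assumes p: "hecke_params p" and "x \<noteq> k"
  shows "partial_trace weight_D' x (braid_op p x k) = mat 1"
proof -
  have "partial_trace weight_D' x (braid_op p x k) $ I $ J = mat 1 $ I $ J" for I J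
  proof (cases "I x = J x")
    case True
    have 1: "J(x := b) = swap_at x k (I(x := b)) \<longleftrightarrow> b = I k \<and> I = J" for b
    proof
      assume eq: "J(x := b) = swap_at x k (I(x := b))"
      have b: "b = I k" using fun_cong[OF eq, of x] assms(2) by (simp add: swap_at_def)
      have "I m = J m" for m
        using fun_cong[OF eq, of m] b True assms(2) by (cases "m = x"; cases "m = k") (auto simp: swap_at_def)
      with b show "b = I k \<and> I = J" by auto
    qed (use assms(2) in \<open>auto simp: swap_at_def\<close>)
    have 2: "J(x := b) = I(x := b) \<longleftrightarrow> I = J" for b
      using True by (auto simp: fun_eq_iff)
    have "(\<Sum>b\<in>UNIV. of_F (weight_D' b) * braid_op p x k $ (I(x := b)) $ (J(x := b))) =
      of_F (\<Sum>b\<in>UNIV. if I = J then (if b = I k then weight_D' b * p (I k) b else 0) + (if I k < b then (1 - qpar\<^sup>2) * weight_D' b else 0) else 0)"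
      unfolding braid_op_nth[OF assms(2)] 1 2 of_F_sum using assms(2)
      by (intro sum.cong) (auto simp: of_F_add of_F_mult distrib_left mult.commute simp flip: of_F_mult)
    also have "\<dots> = (if I = J then of_F (weight_D' (I k) * p (I k) (I k) + (1 - qpar\<^sup>2) * (\<Sum>b | I k < b. weight_D' b)) else 0)"
      by (simp add: sum.distrib sum_distrib_left sum.If_cases)
    also have "\<dots> = (if I = J then 1 else 0)"
      using p by (simp add: hecke_params_def weight_D'_sum)
    finally show ?thesis using True by (simp add: partial_trace_nth mat_def)
  qed (auto simp: partial_trace_nth mat_def)
  then show ?thesis by (simp add: vec_eq_iff)
qed

lemma partial_trace_braid_op_right:
  assumes p: "hecke_params p" and "x \<noteq> k"
  shows "partial_trace weight_D x (braid_op p k x) = mat 1"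
proof -
  have "partial_trace weight_D x (braid_op p k x) $ I $ J = mat 1 $ I $ J" for I J
  proof (cases "I x = J x")
    case True
    have 1: "J(x := b) = swap_at k x (I(x := b)) \<longleftrightarrow> b = I k \<and> I = J" for b
    proof
      assume eq: "J(x := b) = swap_at k x (I(x := b))"
      have b: "b = I k" using fun_cong[OF eq, of x] assms(2) by (simp add: swap_at_def)
      have "I m = J m" for m
        using fun_cong[OF eq, of m] b True assms(2) by (cases "m = x"; cases "m = k") (auto simp: swap_at_def)
      with b show "b = I k \<and> I = J" by auto
    qed (use assms(2) in \<open>auto simp: swap_at_def\<close>)
    have 2: "J(x := b) = I(x := b) \<longleftrightarrow> I = J" for b
      using True by (auto simp: fun_eq_iff)
    have "(\<Sum>b\<in>UNIV. of_F (weight_D b) * braid_op p k x $ (I(x := b)) $ (J(x := b))) =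
      of_F (\<Sum>b\<in>UNIV. if I = J then (if b = I k then weight_D b * p b (I k) else 0) + (if b < I k then (1 - qpar\<^sup>2) * weight_D b else 0) else 0)"
      unfolding braid_op_nth[OF assms(2)[symmetric]] 1 2 of_F_sum using assms(2)
      by (intro sum.cong) (auto simp: of_F_add of_F_mult distrib_left mult.commute simp flip: of_F_mult)
    also have "\<dots> = (if I = J then of_F (weight_D (I k) * p (I k) (I k) + (1 - qpar\<^sup>2) * (\<Sum>b | b < I k. weight_D b)) else 0)"
      by (simp add: sum.distrib sum_distrib_left sum.If_cases)
    also have "\<dots> = (if I = J then 1 else 0)"
      using p by (simp add: hecke_params_def weight_D_sum)
    finally show ?thesis using True by (simp add: partial_trace_nth mat_def)
  qed (auto simp: partial_trace_nth mat_def)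
  then show ?thesis by (simp add: vec_eq_iff)
qed

section \<open>The relations on arbitrary legs\<close>

text \<open>
  The flip of two legs. The defining relations of the algebra involve \<open>R\<close>; multiplied by the flip, they
  become relations for the braid operator.
\<close>

definition flip2 :: "(2, 'n::{finite,linorder}) leg_op" where
  "flip2 = (\<chi> I J. if J = swap_at 1 2 I then 1 else 0)"

lemma flip2_mult_nth: "(flip2 ** M) $ I $ J = M $ swap_at 1 2 I $ J"
proof -
  have "(flip2 ** M) $ I $ J = (\<Sum>K\<in>UNIV. if K = swap_at 1 2 I then M $ K $ J else 0)"
    unfolding matrix_mult_nth flip2_def vec_lambda_beta by (intro sum.cong) auto
  then show ?thesis by simp
qed

lemma mult_flip2_nth: "(M ** flip2) $ I $ J = M $ I $ swap_at 1 2 J"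
proof -
  have "(M ** flip2) $ I $ J = (\<Sum>K\<in>UNIV. if K = swap_at 1 2 J then M $ I $ K else 0)"
    unfolding matrix_mult_nth flip2_def vec_lambda_beta by (intro sum.cong) auto
  then show ?thesis by simp
qed

lemma flip2_leg1: "flip2 ** leg1 1 A = leg1 2 A ** flip2" "flip2 ** leg1 2 A = leg1 1 A ** flip2"
proof -
  have [simp]: "(2::2) \<noteq> 1" "(1::2) \<noteq> 2" by simp_all
  show "flip2 ** leg1 1 A = leg1 2 A ** flip2" "flip2 ** leg1 2 A = leg1 1 A ** flip2"
    unfolding vec_eq_iff flip2_mult_nth mult_flip2_nth leg1_def vec_lambda_beta forall_2 swap_at_def
    by (auto simp: forall_2)
qed

lemma flip2_R: "flip2 ** leg2 1 2 (map_matrix of_F Rmat) = (braid_op qent 1 2 :: (2, 'n::{finite,linorder}) leg_op)"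
proof -
  have ne: "(2::2) \<noteq> 1" "(1::2) \<noteq> 2" by simp_all
  have R: "braid_mat qent $ (a, b) $ (c, d) = Rmat $ (b, a) $ (c, d)" for a b c d :: 'n
    unfolding Rmat_nth braid_mat_def vec_lambda_beta fst_conv snd_conv prod_eq_iff swap_simp
    by (intro arg_cong2[of _ _ _ _ "(+)"] if_cong) (blast intro: sym)+
  show ?thesis
    unfolding vec_eq_iff flip2_mult_nth braid_op_def leg2_def vec_lambda_beta forall_2
    by (simp add: swap_at_def ne R)
qed

lemma relations_2:
  defines "h \<equiv> braid_op qent 1 2 :: (2, 'n::{finite,linorder}) leg_op"
  shows "h ** (leg1 1 Xmat ** leg1 2 Xmat) = leg1 1 Xmat ** leg1 2 Xmat ** h"
    and "h ** (leg1 2 Ymat ** leg1 1 Ymat) = leg1 2 Ymat ** leg1 1 Ymat ** h"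
    and "leg1 1 Ymat ** h ** leg1 1 Xmat = leg1 2 Xmat ** h ** leg1 2 Ymat"
proof -
  have [simp]: "flip2 ** (leg1 1 A ** M) = leg1 2 A ** (flip2 ** M)"
    "flip2 ** (leg1 2 A ** M) = leg1 1 A ** (flip2 ** M)" for A and M :: "(2, 'n) leg_op"
    by (simp_all add: matrix_mul_assoc flip2_leg1)
  have [simp]: "flip2 ** (leg2 1 2 (map_matrix of_F Rmat) ** M) = braid_op qent 1 2 ** M" for M :: "(2, 'n) leg_op"
    by (simp add: matrix_mul_assoc flip2_R)
  note * = flip2_R h_def matrix_mul_assoc[symmetric]
  show "h ** (leg1 1 Xmat ** leg1 2 Xmat) = leg1 1 Xmat ** leg1 2 Xmat ** h"
    using arg_cong[OF qalg_relations(1)[where 'n='n], of "\<lambda>M. flip2 ** M"] by (simp add: *)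
  show "h ** (leg1 2 Ymat ** leg1 1 Ymat) = leg1 2 Ymat ** leg1 1 Ymat ** h"
    using arg_cong[OF qalg_relations(2)[where 'n='n], of "\<lambda>M. flip2 ** M"] by (simp add: *)
  show "leg1 1 Ymat ** h ** leg1 1 Xmat = leg1 2 Xmat ** h ** leg1 2 Ymat"
    using arg_cong[OF qalg_relations(3)[where 'n='n], of "\<lambda>M. flip2 ** M"] by (simp add: *)
qed

text \<open>
  The third relation is the one that moves a \<open>Y\<close> past an \<open>X\<close>: both change their leg while passing.
\<close>

lemma relations:
  fixes k l :: "'l::finite"
  assumes "k \<noteq> l"
  defines "h \<equiv> braid_op qent k l :: ('l, 'n::{finite,linorder}) leg_op"
  shows "h ** (leg1 k Xmat ** leg1 l Xmat) = leg1 k Xmat ** leg1 l Xmat ** h"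
    and "h ** (leg1 l Ymat ** leg1 k Ymat) = leg1 l Ymat ** leg1 k Ymat ** h"
    and "leg1 k Ymat ** h ** leg1 k Xmat = leg1 l Xmat ** h ** leg1 l Ymat"
proof -
  define f :: "2 \<Rightarrow> 'l" where "f j = (if j = 1 then k else l)" for j
  have f: "inj f"
    unfolding inj_def forall_2 using assms(1) by (simp add: f_def)
  have "f 1 = k" "f 2 = l" by (simp_all add: f_def)
  then have e: "embed_legs f (leg1 1 A) = leg1 k A" "embed_legs f (leg1 2 A) = leg1 l A" "embed_legs f (braid_op qent 1 2) = h"
    for A :: "'n qalg^'n::{finite,linorder}^'n::{finite,linorder}"
    unfolding h_def braid_op_def embed_legs_leg1[OF f] embed_legs_leg2[OF f] by simp_all
  show "h ** (leg1 k Xmat ** leg1 l Xmat) = leg1 k Xmat ** leg1 l Xmat ** h"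
    "h ** (leg1 l Ymat ** leg1 k Ymat) = leg1 l Ymat ** leg1 k Ymat ** h"
    "leg1 k Ymat ** h ** leg1 k Xmat = leg1 l Xmat ** h ** leg1 l Ymat"
    using relations_2[where 'n='n, THEN arg_cong, of "embed_legs f"] by (simp_all only: embed_legs_mult[OF f] e)
qed

section \<open>Products along lists of legs\<close>

lemma braid_op_leg1_commute: "m \<noteq> k \<Longrightarrow> m \<noteq> l \<Longrightarrow> braid_op p k l ** leg1 m A = leg1 m A ** braid_op p k l"
  by (rule on_legs_commute[OF on_legs_braid_op on_legs_leg1]) (auto simp: central_braid_op)

lemma braid_op_braid_op_commute: "{k, l} \<inter> {m, n} = {} \<Longrightarrow> braid_op p k l ** braid_op p' m n = braid_op p' m n ** braid_op p k l"
  by (rule on_legs_commute[OF on_legs_braid_op on_legs_braid_op]) (auto simp: central_braid_op)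

primrec X_prod :: "'l::finite list \<Rightarrow> ('l, 'n::{finite,linorder}) leg_op" where
  "X_prod [] = mat 1"
| "X_prod (x # xs) = leg1 x Xmat ** X_prod xs"

text \<open>
  Along a list of legs, the factors \<open>X\<close> are multiplied in the order of the list and the factors \<open>Y\<close> in
  the opposite order. With these orders both products commute with the braid operators of
  neighbouring legs.
\<close>

primrec Y_prod :: "'l::finite list \<Rightarrow> ('l, 'n::{finite,linorder}) leg_op" where
  "Y_prod [] = mat 1"
| "Y_prod (x # xs) = Y_prod xs ** leg1 x Ymat"

text \<open>
  One strand crossing all the others.
\<close>

fun braid_word :: "('n \<Rightarrow> 'n \<Rightarrow> 'n ratfun) \<Rightarrow> 'l::finite list \<Rightarrow> ('l, 'n::{finite,linorder}) leg_op" where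
  "braid_word p (x # y # xs) = braid_op p x y ** braid_word p (y # xs)"
| "braid_word p _ = mat 1"

lemma X_prod_append: "X_prod (xs @ ys) = X_prod xs ** X_prod ys"
  by (induction xs) (simp_all add: matrix_mul_assoc)

lemma Y_prod_append: "Y_prod (xs @ ys) = Y_prod ys ** Y_prod xs"
  by (induction xs) (simp_all add: matrix_mul_assoc)

lemma braid_word_append: "braid_word p (xs @ a # ys) = braid_word p (xs @ [a]) ** braid_word p (a # ys)"
proof (induction xs)
  case (Cons x xs)
  then show ?case by (cases xs) (simp_all add: matrix_mul_assoc)
qed simp

lemma X_prod_commute:
  assumes "\<And>x. x \<in> set xs \<Longrightarrow> M ** leg1 x Xmat = leg1 x Xmat ** M"
  shows "M ** X_prod xs = X_prod xs ** M"
  using assms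
proof (induction xs)
  case (Cons x xs)
  have "M ** X_prod (x # xs) = leg1 x Xmat ** (M ** X_prod xs)"
    using Cons.prems[of x] by (simp add: matrix_mul_assoc)
  also have "M ** X_prod xs = X_prod xs ** M" using Cons by simp
  finally show ?case by (simp add: matrix_mul_assoc)
qed simp

lemma Y_prod_commute:
  assumes "\<And>x. x \<in> set xs \<Longrightarrow> M ** leg1 x Ymat = leg1 x Ymat ** M"
  shows "M ** Y_prod xs = Y_prod xs ** M"
  using assms
proof (induction xs)
  case (Cons x xs)
  have "M ** Y_prod (x # xs) = (M ** Y_prod xs) ** leg1 x Ymat"
    by (simp add: matrix_mul_assoc)
  also have "M ** Y_prod xs = Y_prod xs ** M" using Cons by simp
  also have "Y_prod xs ** M ** leg1 x Ymat = Y_prod xs ** leg1 x Ymat ** M"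
    using Cons.prems[of x] by (simp flip: matrix_mul_assoc)
  finally show ?case by simp
qed simp

text \<open>
  The braid word is a product of braid operators of neighbouring legs.
\<close>

lemma braid_word_commute:
  assumes "\<And>as a b bs. xs = as @ a # b # bs \<Longrightarrow> braid_op p a b ** M = M ** braid_op p a b"
  shows "braid_word p xs ** M = M ** braid_word p xs"
  using assms
proof (induction p xs rule: braid_word.induct)
  case (1 p x y xs)
  have "braid_word p (y # xs) ** M = M ** braid_word p (y # xs)"
    by (rule 1) (use 1(2)[of "x # _"] in auto)
  moreover have "braid_op p x y ** M = M ** braid_op p x y" using 1(2)[of "[]"] by simp
  ultimately have "braid_op p x y ** (braid_word p (y # xs) ** M) = braid_op p x y ** M ** braid_word p (y # xs)"
    "braid_op p x y ** M = M ** braid_op p x y" by (simp_all only: matrix_mul_assoc)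
  then show ?case by (simp only: braid_word.simps matrix_mul_assoc)
qed simp_all

lemma braid_word_leg1_commute: "m \<notin> set xs \<Longrightarrow> braid_word p xs ** leg1 m A = leg1 m A ** braid_word p xs"
  by (rule braid_word_commute) (auto intro: braid_op_leg1_commute)

lemma braid_word_braid_op_commute: "k \<notin> set xs \<Longrightarrow> l \<notin> set xs \<Longrightarrow> braid_word p xs ** braid_op p' k l = braid_op p' k l ** braid_word p xs"
  by (rule braid_word_commute) (auto intro!: braid_op_braid_op_commute)

lemma free_leg_braid_word: "x \<notin> set xs \<Longrightarrow> free_leg x (braid_word p xs)"
  unfolding free_leg_def unitop_def by (simp add: braid_word_leg1_commute)

lemma free_leg_leg1: "x \<noteq> m \<Longrightarrow> free_leg x (leg1 m A)"
  by (rule free_leg_on_legs[OF on_legs_leg1]) simp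

lemma free_leg_X_prod: "x \<notin> set xs \<Longrightarrow> free_leg x (X_prod xs)"
  by (induction xs) (auto intro: free_leg_mult free_leg_leg1)

lemma free_leg_Y_prod: "x \<notin> set xs \<Longrightarrow> free_leg x (Y_prod xs)"
  by (induction xs) (auto intro: free_leg_mult free_leg_leg1)

lemma braid_op_X_prod_commute:
  assumes "distinct (as @ a # b # bs)"
  shows "braid_op qent a b ** X_prod (as @ a # b # bs) = X_prod (as @ a # b # bs) ** braid_op qent a b"
proof -
  have 1: "braid_op qent a b ** X_prod as = X_prod as ** braid_op qent a b" "braid_op qent a b ** X_prod bs = X_prod bs ** braid_op qent a b"
    using assms by (auto intro!: X_prod_commute braid_op_leg1_commute)
  let ?X = "leg1 a Xmat ** leg1 b Xmat"
  have 2: "braid_op qent a b ** ?X = ?X ** braid_op qent a b"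
    by (rule relations) (use assms in auto)
  have "braid_op qent a b ** X_prod (as @ a # b # bs) = (braid_op qent a b ** X_prod as) ** ?X ** X_prod bs"
    by (simp add: X_prod_append matrix_mul_assoc)
  also have "\<dots> = X_prod as ** (braid_op qent a b ** ?X) ** X_prod bs"
    by (simp only: 1 matrix_mul_assoc)
  also have "\<dots> = X_prod as ** ?X ** (braid_op qent a b ** X_prod bs)"
    by (subst 2) (simp only: matrix_mul_assoc)
  also have "\<dots> = X_prod (as @ a # b # bs) ** braid_op qent a b"
    by (simp add: 1 X_prod_append matrix_mul_assoc)
  finally show ?thesis .
qed

lemma braid_op_Y_prod_commute:
  assumes "distinct (as @ a # b # bs)"
  shows "braid_op qent a b ** Y_prod (as @ a # b # bs) = Y_prod (as @ a # b # bs) ** braid_op qent a b"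
proof -
  have 1: "braid_op qent a b ** Y_prod as = Y_prod as ** braid_op qent a b" "braid_op qent a b ** Y_prod bs = Y_prod bs ** braid_op qent a b"
    using assms by (auto intro!: Y_prod_commute braid_op_leg1_commute)
  let ?Y = "leg1 b Ymat ** leg1 a Ymat"
  have 2: "braid_op qent a b ** ?Y = ?Y ** braid_op qent a b"
    by (rule relations) (use assms in auto)
  have "braid_op qent a b ** Y_prod (as @ a # b # bs) = (braid_op qent a b ** Y_prod bs) ** ?Y ** Y_prod as"
    by (simp add: Y_prod_append matrix_mul_assoc)
  also have "\<dots> = Y_prod bs ** (braid_op qent a b ** ?Y) ** Y_prod as"
    by (simp only: 1 matrix_mul_assoc)
  also have "\<dots> = Y_prod bs ** ?Y ** (braid_op qent a b ** Y_prod as)"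
    by (subst 2) (simp only: matrix_mul_assoc)
  also have "\<dots> = Y_prod (as @ a # b # bs) ** braid_op qent a b"
    by (simp add: 1 Y_prod_append matrix_mul_assoc)
  finally show ?thesis .
qed

lemma braid_word_X_prod_commute: "distinct xs \<Longrightarrow> braid_word qent xs ** X_prod xs = X_prod xs ** braid_word qent xs"
  by (rule braid_word_commute) (auto intro: braid_op_X_prod_commute)

lemma braid_word_Y_prod_commute: "distinct xs \<Longrightarrow> braid_word qent xs ** Y_prod xs = Y_prod xs ** braid_word qent xs"
  by (rule braid_word_commute) (auto intro: braid_op_Y_prod_commute)

text \<open>
  Iterates the exchange relation: a single \<open>Y\<close> travels from the first to the last leg, while each of
  the factors \<open>X\<close> moves one leg to the right.
\<close>

lemma Y_braid_word_X_prod: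
  fixes xs :: "'l::finite list"
  assumes "distinct (xs @ [y])"
  shows "leg1 (hd (xs @ [y])) Ymat ** braid_word qent (xs @ [y]) ** X_prod xs =
    (X_prod (tl (xs @ [y])) ** braid_word qent (xs @ [y]) ** leg1 y Ymat :: ('l, 'n::{finite,linorder}) leg_op)"
  using assms
proof (induction xs)
  case (Cons a xs)
  obtain b r where r: "xs @ [y] = b # r" by (cases "xs @ [y]") auto
  have d: "distinct (b # r)" "a \<noteq> b" "a \<notin> set r" "b \<notin> set r" using Cons.prems r by auto
  let ?h = "braid_op qent a b :: ('l, 'n) leg_op" and ?C = "braid_word qent (b # r) :: ('l, 'n) leg_op"
  have IH: "leg1 b Ymat ** ?C ** X_prod xs = X_prod r ** ?C ** leg1 y Ymat" using Cons r by simp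
  have 1: "?C ** leg1 a Xmat = leg1 a Xmat ** ?C" by (rule braid_word_leg1_commute) (use d in auto)
  have 2: "leg1 a Ymat ** ?h ** leg1 a Xmat = leg1 b Xmat ** ?h ** leg1 b Ymat"
    by (rule relations) (rule d)
  have 3: "?h ** X_prod r = X_prod r ** ?h" by (intro X_prod_commute braid_op_leg1_commute) (use d in auto)
  have "leg1 a Ymat ** (?h ** ?C) ** (leg1 a Xmat ** X_prod xs) =
      leg1 a Ymat ** ?h ** (?C ** leg1 a Xmat) ** X_prod xs" by (simp only: matrix_mul_assoc)
  also have "\<dots> = leg1 a Ymat ** ?h ** leg1 a Xmat ** ?C ** X_prod xs" by (simp only: 1 matrix_mul_assoc)
  also have "\<dots> = leg1 b Xmat ** ?h ** (leg1 b Ymat ** ?C ** X_prod xs)" by (simp only: 2 matrix_mul_assoc)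
  also have "\<dots> = leg1 b Xmat ** (?h ** X_prod r) ** ?C ** leg1 y Ymat" by (simp only: IH matrix_mul_assoc)
  also have "\<dots> = leg1 b Xmat ** X_prod r ** (?h ** ?C) ** leg1 y Ymat" by (simp only: 3 matrix_mul_assoc)
  finally have "leg1 a Ymat ** (?h ** ?C) ** (leg1 a Xmat ** X_prod xs) =
      leg1 b Xmat ** X_prod r ** (?h ** ?C) ** leg1 y Ymat" .
  then show ?case unfolding append_Cons r list.sel X_prod.simps braid_word.simps .
qed simp

text \<open>
  The braid word shifts braid operators by one leg; this is the braid relation in the middle of
  the word.
\<close>

lemma braid_op_braid_word_shift:
  assumes p: "hecke_params p" and d: "distinct (as @ a # b # c # bs)"
  shows "braid_op p b c ** braid_word p (as @ a # b # c # bs) = braid_word p (as @ a # b # c # bs) ** braid_op p a b"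
proof -
  let ?A = "braid_word p (as @ [a])" and ?B = "braid_word p (c # bs)"
  have C: "braid_word p (as @ a # b # c # bs) = ?A ** braid_op p a b ** braid_op p b c ** ?B"
    by (simp add: braid_word_append[of p as a "b # c # bs"] matrix_mul_assoc)
  have 1: "?A ** braid_op p b c = braid_op p b c ** ?A" "?B ** braid_op p a b = braid_op p a b ** ?B"
    using d by (auto intro!: braid_word_braid_op_commute)
  have "braid_op p b c ** (?A ** braid_op p a b ** braid_op p b c ** ?B) = (braid_op p b c ** ?A) ** braid_op p a b ** braid_op p b c ** ?B"
    by (simp only: matrix_mul_assoc)
  also have "\<dots> = ?A ** (braid_op p b c ** braid_op p a b ** braid_op p b c) ** ?B"
    by (simp only: 1[symmetric] matrix_mul_assoc)
  also have "braid_op p b c ** braid_op p a b ** braid_op p b c = braid_op p a b ** braid_op p b c ** braid_op p a b"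
    by (rule braid[OF p, symmetric]) (use d in auto)
  also have "?A ** (braid_op p a b ** braid_op p b c ** braid_op p a b) ** ?B =
     ?A ** braid_op p a b ** braid_op p b c ** (braid_op p a b ** ?B)"
    by (simp only: matrix_mul_assoc)
  also have "\<dots> = ?A ** braid_op p a b ** braid_op p b c ** ?B ** braid_op p a b"
    by (simp only: 1[symmetric] matrix_mul_assoc)
  finally show ?thesis by (simp only: C)
qed

section \<open>Antisymmetric tensors\<close>

text \<open>
  The product of \<open>- p b a\<close> over the inversions of a list. On the list of values of a permutation it is
  \<open>(-q)\<^sub>\<sigma>\<^sub>,\<^sub>c\<close> for \<open>p = qent\<close>, and \<open>(-q)\<^sub>\<sigma>\<^sub>,\<^sub>r\<close> for the parameters with exchanged indices.
\<close>

primrec inversion_weight :: "('n \<Rightarrow> 'n \<Rightarrow> 'n ratfun) \<Rightarrow> 'n::{finite,linorder} list \<Rightarrow> 'n ratfun" where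
  "inversion_weight p [] = 1"
| "inversion_weight p (a # as) = (\<Prod>b\<leftarrow>filter (\<lambda>b. b < a) as. - p b a) * inversion_weight p as"

lemma inversion_weight_swap:
  assumes "a < b"
  shows "inversion_weight p (as @ b # a # bs) = - p a b * inversion_weight p (as @ a # b # bs)"
proof (induction as)
  case Nil
  have "\<not> b < a" using assms by simp
  then show ?case using assms by (simp add: mult_ac)
qed (simp add: mult_ac)

text \<open>
  For each set of values, the product of the column vector \<open>u\<close> and the row vector \<open>v\<close> formed from the
  arrangements of that set on the legs \<open>zs\<close>. It is a multiple of the projection onto the
  \<open>q\<close>-antisymmetric tensors, on which every braid operator of neighbouring legs is \<open>- qpar\<^sup>2\<close>.
\<close>

definition antisymmetrizer :: "('n \<Rightarrow> 'n \<Rightarrow> 'n ratfun) \<Rightarrow> 'l list \<Rightarrow> ('l::finite, 'n::{finite,linorder}) leg_op" where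
  "antisymmetrizer p zs = (\<chi> I J. if (\<forall>m. m \<notin> set zs \<longrightarrow> I m = J m) \<and> distinct (map I zs) \<and> distinct (map J zs) \<and>
       set (map I zs) = set (map J zs)
     then of_F (inversion_weight p (map I zs) * inversion_weight (\<lambda>a b. p b a) (map J zs)) else 0)"

lemma central_antisymmetrizer: "central_entries (antisymmetrizer p zs)"
  by (simp add: central_entries_def antisymmetrizer_def of_F_central)

lemma on_legs_antisymmetrizer: "on_legs (set zs) (antisymmetrizer p zs)"
  unfolding on_legs_def
proof (intro conjI allI impI)
  fix I J I' J' :: "'a \<Rightarrow> 'b"
  assume "\<forall>m\<in>set zs. I m = I' m \<and> J m = J' m" "\<forall>m. m \<notin> set zs \<longrightarrow> I m = J m \<and> I' m = J' m"
  then have "map I zs = map I' zs" "map J zs = map J' zs"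
    "(\<forall>m. m \<notin> set zs \<longrightarrow> I m = J m) = (\<forall>m. m \<notin> set zs \<longrightarrow> I' m = J' m)" by auto
  then show "antisymmetrizer p zs $ I $ J = antisymmetrizer p zs $ I' $ J'" unfolding antisymmetrizer_def vec_lambda_beta by (simp only:)
qed (auto simp: antisymmetrizer_def split: if_splits)

lemma transpose_antisymmetrizer: "transpose (antisymmetrizer p zs) = antisymmetrizer (\<lambda>a b. p b a) zs"
proof -
  have "antisymmetrizer p zs $ J $ I = antisymmetrizer (\<lambda>a b. p b a) zs $ I $ J" for I J
    unfolding antisymmetrizer_def vec_lambda_beta by (rule if_cong) (auto simp: mult.commute)
  then show ?thesis by (simp add: vec_eq_iff transpose_def)
qed

definition antisym_cols where
  "antisym_cols p zs M \<longleftrightarrow>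
     (\<forall>as a b bs. zs = as @ a # b # bs \<longrightarrow> braid_op p a b ** M = smat (of_F (- (qpar\<^sup>2))) M)"

lemma map_swap_at:
  assumes "distinct (as @ a # b # bs)"
  shows "map (swap_at a b I) (as @ a # b # bs) = map I as @ I b # I a # map I bs"
  using assms by (auto simp: swap_at_def)

text \<open>
  Exchanging two neighbouring values in increasing order multiplies the inversion weight by one
  factor \<open>- p a b\<close>; the two terms of the braid operator then combine to the eigenvalue \<open>- qpar\<^sup>2\<close>.
\<close>

lemma antisym_antisymmetrizer:
  fixes p :: "'n \<Rightarrow> 'n \<Rightarrow> 'n::{finite,linorder} ratfun"
  assumes p: "hecke_params p" and d: "distinct zs"
  shows "antisym_cols p zs (antisymmetrizer p zs)"
  unfolding antisym_cols_def
proof (intro allI impI)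
  fix as a b bs assume zs: "zs = as @ a # b # bs"
  then have ab: "a \<noteq> b" using d by auto
  have "(braid_op p a b ** antisymmetrizer p zs) $ I $ J = smat (of_F (- (qpar\<^sup>2))) (antisymmetrizer p zs) $ I $ J" for I J
  proof -
    let ?S = "swap_at a b I"
    let ?c = "\<lambda>I. (\<forall>m. m \<notin> set zs \<longrightarrow> I m = J m) \<and> distinct (map I zs) \<and> distinct (map J zs) \<and>
       set (map I zs) = set (map J zs)"
    have P: "antisymmetrizer p zs $ I $ J = (if ?c I then of_F (inversion_weight p (map I zs) * inversion_weight (\<lambda>a b. p b a) (map J zs)) else 0)" for I
      by (simp add: antisymmetrizer_def)
    have mS: "map ?S zs = map I as @ I b # I a # map I bs" unfolding zs
      by (rule map_swap_at) (use d zs in simp)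
    have mI: "map I zs = map I as @ I a # I b # map I bs" by (simp add: zs)
    have mm: "mset (map ?S zs) = mset (map I zs)" unfolding mS mI by simp
    have "?S m = I m" if "m \<notin> set zs" for m using that by (auto simp: swap_at_def zs)
    then have c: "?c ?S = ?c I"
      using mset_eq_imp_distinct_iff[OF mm] mset_eq_setD[OF mm] by metis
    show ?thesis
    proof (cases "?c I")
      case False
      with c have "antisymmetrizer p zs $ I $ J = 0" "antisymmetrizer p zs $ ?S $ J = 0" by (simp_all only: P if_False)
      then show ?thesis unfolding braid_op_mult_nth[OF ab] smat_def by simp
    next
      case True
      then have "I a \<noteq> I b" unfolding mI by auto
      have pp: "p (I b) (I a) * p (I a) (I b) = qpar\<^sup>2"
        using p \<open>I a \<noteq> I b\<close> by (metis hecke_params_def)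
      let ?v = "inversion_weight (\<lambda>a b. p b a) (map J zs)"
      have P1: "antisymmetrizer p zs $ I $ J = of_F (inversion_weight p (map I zs) * ?v)" "antisymmetrizer p zs $ ?S $ J = of_F (inversion_weight p (map ?S zs) * ?v)"
        unfolding P by (rule if_P, rule True, rule if_P, rule iffD2[OF c True])
      have "p (I b) (I a) * inversion_weight p (map ?S zs) + (if I b < I a then (1 - qpar\<^sup>2) * inversion_weight p (map I zs) else 0) =
          - (qpar\<^sup>2) * inversion_weight p (map I zs)"
      proof (cases "I b < I a")
        case True
        then have "inversion_weight p (map I zs) = - p (I b) (I a) * inversion_weight p (map ?S zs)"
          unfolding mS mI by (rule inversion_weight_swap)
        with True show ?thesis by (simp add: algebra_simps)
      next
        case False
        with \<open>I a \<noteq> I b\<close> have "inversion_weight p (map ?S zs) = - p (I a) (I b) * inversion_weight p (map I zs)"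
          unfolding mS mI by (intro inversion_weight_swap) simp
        with False pp show ?thesis by (simp add: mult.assoc[symmetric])
      qed
      from arg_cong[OF this, of "\<lambda>c. of_F (c * ?v)"] show ?thesis
        unfolding braid_op_mult_nth[OF ab] smat_def vec_lambda_beta P1
        by (auto simp: distrib_right mult.assoc of_F_add simp flip: of_F_mult)
    qed
  qed
  then show "braid_op p a b ** antisymmetrizer p zs = smat (of_F (- (qpar\<^sup>2))) (antisymmetrizer p zs)"
    by (simp add: vec_eq_iff)
qed

subsection \<open>Antisymmetric functions of a list are determined by their values on sorted lists\<close>

text \<open>
  \<open>W\<close> stands for the values of an antisymmetric tensor at the arrangements \<open>l\<close> of entries on \<open>n\<close> legs.
  Insertion sort exchanges one neighbouring pair at a time and collects one factor \<open>- p b a\<close> for each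
  inversion.
\<close>

locale antisym_fun =
  fixes p :: "'n \<Rightarrow> 'n \<Rightarrow> 'n::{finite,linorder} ratfun" and n :: nat and W :: "'n list \<Rightarrow> 'n qalg"
  assumes rep: "\<And>as a bs. length (as @ a # a # bs) = n \<Longrightarrow> W (as @ a # a # bs) = 0"
    and swap: "\<And>as a b bs. a < b \<Longrightarrow> length (as @ b # a # bs) = n \<Longrightarrow>
      W (as @ b # a # bs) = of_F (- p a b) * W (as @ a # b # bs)"
begin

lemma insort_swap:
  "length (as @ x # l) = n \<Longrightarrow> sorted l \<Longrightarrow>
    W (as @ x # l) = of_F (\<Prod>b\<leftarrow>filter (\<lambda>b. b < x) l. - p b x) * W (as @ insort x l)"
proof (induction l arbitrary: as)
  case (Cons b l)
  show ?case
  proof (cases "x \<le> b")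
    case True
    then have "filter (\<lambda>b. b < x) (b # l) = []" using Cons.prems(2) by (force simp: filter_empty_conv)
    then show ?thesis using True by simp
  next
    case False
    then have "W (as @ x # b # l) = of_F (- p b x) * W (as @ b # x # l)"
      using Cons.prems by (intro swap) auto
    also have "W (as @ b # x # l) = W ((as @ [b]) @ x # l)" by simp
    also have "\<dots> = of_F (\<Prod>b\<leftarrow>filter (\<lambda>b. b < x) l. - p b x) * W ((as @ [b]) @ List.insort x l)"
      using Cons.prems by (intro Cons.IH) auto
    finally have "W (as @ x # b # l) = of_F (- p b x * (\<Prod>b\<leftarrow>filter (\<lambda>b. b < x) l. - p b x)) *
        W ((as @ [b]) @ List.insort x l)"
      by (simp only: of_F_mult mult.assoc)
    moreover have "(\<Prod>b\<leftarrow>filter (\<lambda>b. b < x) (b # l). - p b x) =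
        - p b x * (\<Prod>b\<leftarrow>filter (\<lambda>b. b < x) l. - p b x)" using False by (simp add: not_le)
    moreover have "as @ List.insort x (b # l) = (as @ [b]) @ List.insort x l" using False by simp
    ultimately show ?thesis by (simp only:)
  qed
qed simp

lemma sort_append_eq:
  "length (as @ l) = n \<Longrightarrow> W (as @ l) = of_F (inversion_weight p l) * W (as @ sort l)"
proof (induction l arbitrary: as)
  case (Cons x l)
  have "W (as @ x # l) = of_F (inversion_weight p l) * W (as @ x # sort l)"
    using Cons.IH[of "as @ [x]"] Cons.prems by simp
  also have "W (as @ x # sort l) =
      of_F (\<Prod>b\<leftarrow>filter (\<lambda>b. b < x) (sort l). - p b x) * W (as @ List.insort x (sort l))"
    using Cons.prems by (intro insort_swap) auto
  also have "(\<Prod>b\<leftarrow>filter (\<lambda>b. b < x) (sort l). - p b x) = (\<Prod>b\<leftarrow>filter (\<lambda>b. b < x) l. - p b x)"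
  proof -
    have "mset (map (\<lambda>b. - p b x) (filter (\<lambda>b. b < x) (List.sort l))) =
        mset (map (\<lambda>b. - p b x) (filter (\<lambda>b. b < x) l))" by simp
    then show ?thesis by (metis prod_mset_prod_list)
  qed
  finally show ?case by (simp add: of_F_mult mult.assoc[symmetric] mult.commute[of "inversion_weight p l"] flip: of_F_mult)
qed simp

lemma sort_eq: "length l = n \<Longrightarrow> W l = of_F (inversion_weight p l) * W (sort l)"
  using sort_append_eq[of "[]" l] by simp

lemma zero_if_not_distinct:
  assumes "length l = n" "\<not> distinct l"
  shows "W l = 0"
proof -
  have "\<not> distinct (List.sort l)" using assms by simp
  then obtain xs ys zs y where s: "List.sort l = xs @ [y] @ ys @ [y] @ zs"
    using not_distinct_decomp by blast
  have "sorted (xs @ [y] @ ys @ [y] @ zs)" using sorted_sort[of l] s by simp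
  then have "\<forall>a\<in>set ys. y \<le> a \<and> a \<le> y" by (auto simp: sorted_append)
  then have "\<forall>a\<in>set ys. a = y" by force
  then have "ys @ [y] = y # ys"
    by (induction ys) auto
  then have "List.sort l = xs @ y # y # (ys @ zs)" using s by simp
  moreover have "length (List.sort l) = n" using assms by simp
  ultimately have "W (List.sort l) = 0" using rep by metis
  then show ?thesis using sort_eq[OF assms(1)] by simp
qed

end

text \<open>
  Different Laurent monomials are different. This makes the \<open>q\<close>-factorials invertible, by which the
  antisymmetrizer differs from a projection.
\<close>

lemma qpar_power_neq_1:
  assumes n: "0 < n"
  shows "(qpar :: 'n::{finite,linorder} ratfun) ^ n \<noteq> 1"
proof
  assume eq: "(qpar :: 'n ratfun) ^ n = 1"
  let ?e = "\<lambda>m. Poly_Mapping.single (Abs_indet None :: 'n indet) (int m)"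
  have "(qpar :: 'n ratfun) ^ m = of_laurent (Poly_Mapping.single (?e m) 1)" for m
  proof (induction m)
    case (Suc m)
    have "?e (Suc m) = ?e 1 + ?e m" by (simp add: single_add[symmetric])
    then have "Poly_Mapping.single (?e (Suc m)) 1 =
        Poly_Mapping.single (?e 1) 1 * Poly_Mapping.single (?e m) (1 :: complex)"
      by (simp add: mult_single)
    then show ?case using Suc by (simp add: qpar_def indet_def of_laurent_mult)
  qed simp
  from this[of n] eq have "of_laurent (Poly_Mapping.single (?e n) 1) = (1 :: 'n ratfun)" by simp
  moreover have "of_laurent (Poly_Mapping.single (?e n) 1) =
      of_laurent (Poly_Mapping.single (?e n) 1 - 1) + (of_laurent 1 :: 'n ratfun)"
    by (simp flip: of_laurent_add del: of_laurent_one)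
  ultimately have "of_laurent (Poly_Mapping.single (?e n) 1 - 1) = (0 :: 'n ratfun)"
    by (simp only: of_laurent_one) simp
  then have "Poly_Mapping.single (?e n) 1 - 1 = (0 :: 'n laurent)" by simp
  then have "Poly_Mapping.lookup (Poly_Mapping.single (?e n) 1 :: 'n laurent) (?e n) =
      Poly_Mapping.lookup 1 (?e n)" by simp
  then have "?e n = 0" by (auto simp: lookup_one when_def split: if_splits)
  from arg_cong[OF this, of "\<lambda>e. Poly_Mapping.lookup e (Abs_indet None)"] n show False by simp
qed

lemma qint_nonzero:
  assumes n: "0 < n"
  shows "qint n \<noteq> (0 :: 'n::{finite,linorder} ratfun)"
proof
  assume "qint n = (0 :: 'n ratfun)"
  then have "(\<Sum>k<n. (qpar\<^sup>2 :: 'n ratfun) ^ k) = 0" by (simp add: qint_def power_mult)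
  then have "(qpar\<^sup>2 :: 'n ratfun) ^ n = 1" using one_diff_power_eq[of "qpar\<^sup>2 :: 'n ratfun" n] by simp
  then show False using qpar_power_neq_1[of "2 * n", where 'n = 'n] n by (simp add: power_mult)
qed

lemma qfact_nonzero: "qfact n \<noteq> 0"
  by (simp add: qfact_def qint_nonzero)

lemma qpar_sq_plus_1: "1 + qpar\<^sup>2 \<noteq> 0"
  using qint_nonzero[of 2] by (simp add: qint_def numeral_2_eq_2)

subsection \<open>Changing the entries of a multi-index on a list of legs\<close>

text \<open>
  The multi-index that has the entries \<open>l\<close> on the legs \<open>zs\<close> and agrees with \<open>I\<close> elsewhere.
\<close>

definition set_entries :: "('l \<Rightarrow> 'n) \<Rightarrow> 'l list \<Rightarrow> 'n list \<Rightarrow> 'l \<Rightarrow> 'n" where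
  "set_entries I zs l = (\<lambda>k. case map_of (zip zs l) k of None \<Rightarrow> I k | Some v \<Rightarrow> v)"

lemma set_entries_off: "m \<notin> set zs \<Longrightarrow> set_entries I zs l m = I m"
  unfolding set_entries_def by (metis (no_types) map_of_eq_None_iff option.simps(4) set_zip_leftD image_iff prod.collapse)

lemma map_set_entries: "distinct zs \<Longrightarrow> length l = length zs \<Longrightarrow> map (set_entries I zs l) zs = l"
  by (rule nth_equalityI) (auto simp: set_entries_def map_of_zip_nth)

lemma set_entries_unique:
  assumes "distinct zs" "map K zs = l" "\<And>m. m \<notin> set zs \<Longrightarrow> K m = I m"
  shows "set_entries I zs l = K"
proof
  fix m
  have "map (set_entries I zs l) zs = map K zs" using assms map_set_entries[of zs l I] by auto
  then show "set_entries I zs l m = K m" using assms(3)[of m] set_entries_off[of m zs I l] by (cases "m \<in> set zs") auto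
qed

lemma swap_at_set_entries:
  assumes "distinct (as @ a # b # bs)" "length as' = length as" "length bs' = length bs"
  shows "swap_at a b (set_entries I (as @ a # b # bs) (as' @ x # y # bs')) = set_entries I (as @ a # b # bs) (as' @ y # x # bs')"
    and "set_entries I (as @ a # b # bs) (as' @ x # y # bs') a = x" "set_entries I (as @ a # b # bs) (as' @ x # y # bs') b = y"
proof -
  let ?U = "set_entries I (as @ a # b # bs) (as' @ x # y # bs')"
  have "map ?U (as @ a # b # bs) = as' @ x # y # bs'"
    by (rule map_set_entries) (use assms in auto)
  then have m: "map ?U as = as'" "?U a = x" "?U b = y" "map ?U bs = bs'"
    using assms by auto
  then show "?U a = x" "?U b = y" by blast+
  show "swap_at a b ?U = set_entries I (as @ a # b # bs) (as' @ y # x # bs')"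
  proof (rule set_entries_unique[symmetric])
    show "map (swap_at a b ?U) (as @ a # b # bs) = as' @ y # x # bs'"
      by (subst map_swap_at) (use assms m in auto)
    show "swap_at a b ?U k = I k" if "k \<notin> set (as @ a # b # bs)" for k
      using that by (auto simp: swap_at_def set_entries_off)
  qed (rule assms)
qed

lemma of_F_uminus: "of_F (- c) = - of_F c"
  using of_F_add[of c "- c"] by (simp add: minus_unique)

text \<open>
  The eigenvalue equation of the braid operator at two neighbouring legs, evaluated at equal entries
  and at entries in increasing order. Equal entries give a multiple \<open>1 + qpar\<^sup>2\<close> of the value,
  which is invertible.
\<close>

lemma antisym_fun_set_entries:
  fixes p :: "'n \<Rightarrow> 'n \<Rightarrow> 'n::{finite,linorder} ratfun"
  assumes p: "hecke_params p" and d: "distinct zs" and M: "antisym_cols p zs M"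
  shows "antisym_fun p (length zs) (\<lambda>l. M $ set_entries I zs l $ J)"
proof -
  have h: "of_F (p y x) * M $ set_entries I zs (as @ y # x # bs) $ J +
     (if y < x then of_F (1 - qpar\<^sup>2) * M $ set_entries I zs (as @ x # y # bs) $ J else 0) =
     of_F (- (qpar\<^sup>2)) * M $ set_entries I zs (as @ x # y # bs) $ J"
    if l: "length (as @ x # y # bs) = length zs" for as x y bs
  proof -
    have "\<exists>as' r. zs = as' @ r \<and> length as' = length as \<and> length r = Suc (Suc (length bs))"
      using l by (intro exI[of _ "take (length as) zs"] exI[of _ "drop (length as) zs"]) simp
    then obtain as' r where zs': "zs = as' @ r" and r: "length as' = length as" "length r = Suc (Suc (length bs))"
      by blast
    from r(2) obtain a b bs' where "r = a # b # bs'" by (auto simp: length_Suc_conv)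
    with zs' r have zs: "zs = as' @ a # b # bs'" and len: "length as = length as'" "length bs = length bs'"
      by auto
    have d': "distinct (as' @ a # b # bs')" using d zs by simp
    have ab: "a \<noteq> b" using d' by auto
    note swap_at = swap_at_set_entries[OF d' len, folded zs]
    have "braid_op p a b ** M = smat (of_F (- (qpar\<^sup>2))) M"
      using M zs unfolding antisym_cols_def by blast
    then have "(braid_op p a b ** M) $ set_entries I zs (as @ x # y # bs) $ J =
       smat (of_F (- (qpar\<^sup>2))) M $ set_entries I zs (as @ x # y # bs) $ J" by simp
    then show ?thesis unfolding braid_op_mult_nth[OF ab] smat_def vec_lambda_beta swap_at .
  qed
  have diag: "p a a = 1" for a using p by (simp add: hecke_params_def)
  have pp: "a \<noteq> b \<Longrightarrow> p a b * p b a = qpar\<^sup>2" for a b using p by (simp add: hecke_params_def)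
  show ?thesis
  proof
    fix as bs and a :: 'n assume "length (as @ a # a # bs) = length zs"
    from h[OF this] have "of_F (1 + qpar\<^sup>2) * M $ set_entries I zs (as @ a # a # bs) $ J = 0"
      by (simp add: diag of_F_add of_F_uminus distrib_right add_eq_0_iff2)
    then have "of_F (inverse (1 + qpar\<^sup>2)) * (of_F (1 + qpar\<^sup>2) * M $ set_entries I zs (as @ a # a # bs) $ J) = 0"
      by simp
    then show "M $ set_entries I zs (as @ a # a # bs) $ J = 0"
      by (simp add: mult.assoc[symmetric] of_F_mult[symmetric] qpar_sq_plus_1)
  next
    fix as bs and a b :: 'n assume ab: "a < b" and l: "length (as @ b # a # bs) = length zs"
    from l have "length (as @ a # b # bs) = length zs" by simp
    moreover have "\<not> b < a" using ab by simp
    ultimately have "of_F (p b a) * M $ set_entries I zs (as @ b # a # bs) $ J =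
        of_F (- (qpar\<^sup>2)) * M $ set_entries I zs (as @ a # b # bs) $ J"
      using h[of as a b bs] by (simp only: if_False add_0_right)
    then have "of_F (p a b / qpar\<^sup>2) * (of_F (p b a) * M $ set_entries I zs (as @ b # a # bs) $ J) =
        of_F (p a b / qpar\<^sup>2) * (of_F (- (qpar\<^sup>2)) * M $ set_entries I zs (as @ a # b # bs) $ J)" by simp
    then show "M $ set_entries I zs (as @ b # a # bs) $ J = of_F (- p a b) * M $ set_entries I zs (as @ a # b # bs) $ J"
      using pp[of a b] ab by (simp add: mult.assoc[symmetric] of_F_mult[symmetric])
  qed
qed

subsection \<open>Counting inversions\<close>

lemma inversion_weight_flip_mult:
  assumes p: "hecke_params p"
  shows "distinct (a # as) \<Longrightarrow>
    (\<Prod>b\<leftarrow>filter (\<lambda>b. b < a) as. - p b a) * (\<Prod>b\<leftarrow>filter (\<lambda>b. b < a) as. - p a b) =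
     (qpar\<^sup>2) ^ card {b \<in> set as. b < a}"
proof (induction as)
  case (Cons c as)
  have *: "{b \<in> set (c # as). b < a} = (if c < a then insert c {b \<in> set as. b < a} else {b \<in> set as. b < a})"
    by auto
  have "c < a \<Longrightarrow> p c a * p a c = qpar\<^sup>2" using p by (auto simp: hecke_params_def)
  then show ?case using Cons unfolding * by (auto simp: mult_ac)
qed simp

text \<open>
  The numbers of smaller elements run through \<open>0, \<dots>, card S - 1\<close>.
\<close>

lemma sum_rank: "finite S \<Longrightarrow> (\<Sum>x\<in>S. (t::'a::semiring_1) ^ card {b \<in> S. b < x}) = (\<Sum>k<card S. t ^ k)"
  for S :: "'b::linorder set"
proof (induction S rule: finite_linorder_max_induct)
  case (insert m S)
  have 1: "{b \<in> insert m S. b < x} = {b \<in> S. b < x}" if "x \<in> S" for x using insert.hyps that by auto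
  have 2: "{b \<in> insert m S. b < m} = S" using insert.hyps by auto
  have "m \<notin> S" using insert.hyps by auto
  then show ?case using insert 1 2 by (simp add: add.commute)
qed simp

text \<open>
  The generating function of inversions is the \<open>q\<close>-factorial: in the product of the two weights, each
  inversion contributes \<open>p b a * p a b = qpar\<^sup>2\<close>.
\<close>

lemma sum_permutations_inversion_weight:
  assumes p: "hecke_params p"
  shows "finite S \<Longrightarrow> (\<Sum>l\<in>permutations_of_set S. inversion_weight p l * inversion_weight (\<lambda>a b. p b a) l) = qfact (card S)"
proof (induction "card S" arbitrary: S)
  case 0
  then show ?case by (simp add: qfact_def)
next
  case (Suc n)
  then have ne: "S \<noteq> {}" by auto
  let ?f = "\<lambda>l. inversion_weight p l * inversion_weight (\<lambda>a b. p b a) l"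
  have "(\<Sum>l\<in>permutations_of_set S. ?f l) =
      (\<Sum>x\<in>S. \<Sum>l\<in>(#) x ` permutations_of_set (S - {x}). ?f l)"
    unfolding permutations_of_set_nonempty[OF ne]
    by (rule sum.UNION_disjoint) (use Suc.prems in auto)
  also have "\<dots> = (\<Sum>x\<in>S. (qpar\<^sup>2) ^ card {b \<in> S. b < x} * qfact n)"
  proof (rule sum.cong[OF refl])
    fix x assume x: "x \<in> S"
    have "?f (x # l) = (qpar\<^sup>2) ^ card {b \<in> S. b < x} * ?f l" if "l \<in> permutations_of_set (S - {x})" for l
    proof -
      have l: "set l = S - {x}" "distinct (x # l)"
        using that by (auto simp: permutations_of_set_def)
      have "{b \<in> set l. b < x} = {b \<in> S. b < x}" using l by auto
      then have "(\<Prod>b\<leftarrow>filter (\<lambda>b. b < x) l. - p b x) * (\<Prod>b\<leftarrow>filter (\<lambda>b. b < x) l. - p x b) =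
         (qpar\<^sup>2) ^ card {b \<in> S. b < x}" using inversion_weight_flip_mult[OF p l(2)] by simp
      moreover have "?f (x # l) = (\<Prod>b\<leftarrow>filter (\<lambda>b. b < x) l. - p b x) * (\<Prod>b\<leftarrow>filter (\<lambda>b. b < x) l. - p x b) * ?f l"
        by (simp add: mult_ac)
      ultimately show ?thesis by simp
    qed
    moreover have "(\<Sum>l\<in>permutations_of_set (S - {x}). ?f l) = qfact n"
    proof -
      have n: "n = card (S - {x})" using Suc(2) Suc.prems x by simp
      show ?thesis unfolding n by (rule Suc(1)[OF n]) (use Suc.prems in simp)
    qed
    moreover have "(\<Sum>l\<in>(#) x ` permutations_of_set (S - {x}). ?f l) =
        (\<Sum>l\<in>permutations_of_set (S - {x}). ?f (x # l))"
      by (subst sum.reindex) (simp_all only: inj_on_Cons1 o_def)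
    ultimately show "(\<Sum>l\<in>(#) x ` permutations_of_set (S - {x}). ?f l) = (qpar\<^sup>2) ^ card {b \<in> S. b < x} * qfact n"
      by (simp only: sum_distrib_left[symmetric] cong: sum.cong)
  qed
  also have "\<dots> = qint (Suc n) * qfact n"
    using sum_rank[OF Suc.prems, of "qpar\<^sup>2 :: 'a ratfun"] Suc(2)
    by (simp add: sum_distrib_right[symmetric] qint_def power_mult)
  also have "\<dots> = qfact (Suc n)" by (simp add: qfact_def mult.commute)
  finally show ?case using Suc(2) by simp
qed

subsection \<open>The antisymmetrizer\<close>

lemma bij_betw_permutations_set_entries:
  assumes "distinct zs" "finite S" "card S = length zs"
  shows "bij_betw (set_entries I zs) (permutations_of_set S)
    {K. (\<forall>m. m \<notin> set zs \<longrightarrow> I m = K m) \<and> distinct (map K zs) \<and> set (map K zs) = S}"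
proof (rule bij_betwI[where g = "\<lambda>K. map K zs"])
  show "set_entries I zs \<in> permutations_of_set S \<rightarrow>
      {K. (\<forall>m. m \<notin> set zs \<longrightarrow> I m = K m) \<and> distinct (map K zs) \<and> set (map K zs) = S}"
  proof
    fix l assume "l \<in> permutations_of_set S"
    then have l: "set l = S" "distinct l" "length l = length zs"
      using assms distinct_card[of l] by (auto simp: permutations_of_set_def)
    then have "map (set_entries I zs l) zs = l" using assms by (intro map_set_entries)
    then have "set (map (set_entries I zs l) zs) = S" "distinct (map (set_entries I zs l) zs)" using l by (simp_all only:)
    then show "set_entries I zs l \<in> {K. (\<forall>m. m \<notin> set zs \<longrightarrow> I m = K m) \<and> distinct (map K zs) \<and> set (map K zs) = S}"
      by (simp add: set_entries_off del: set_map)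
  qed
  show "map (set_entries I zs l) zs = l" if "l \<in> permutations_of_set S" for l
    using that assms distinct_card[of l] by (intro map_set_entries) (auto simp: permutations_of_set_def)
  show "set_entries I zs (map K zs) = K"
    if "K \<in> {K. (\<forall>m. m \<notin> set zs \<longrightarrow> I m = K m) \<and> distinct (map K zs) \<and> set (map K zs) = S}" for K
    using that assms by (intro set_entries_unique) auto
qed (auto simp: permutations_of_set_def)

text \<open>
  The columns of \<open>M\<close> are antisymmetric, hence determined by their values at sorted arrangements; the
  sum over the arrangements of a set that the antisymmetrizer performs therefore is the generating
  function of inversions times the value itself. The entries of \<open>M\<close> may be noncommuting, which allows
  \<open>M\<close> to contain factors \<open>X\<close> and \<open>Y\<close>.
\<close>

lemma antisymmetrizer_absorb_left:
  fixes p :: "'n \<Rightarrow> 'n \<Rightarrow> 'n::{finite,linorder} ratfun"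
  assumes p: "hecke_params p" and d: "distinct zs" and M: "antisym_cols p zs M"
  shows "antisymmetrizer p zs ** M = smat (of_F (qfact (length zs))) M"
proof -
  have "(antisymmetrizer p zs ** M) $ I $ J = smat (of_F (qfact (length zs))) M $ I $ J" for I J
  proof -
    interpret antisym_fun p "length zs" "\<lambda>l. M $ set_entries I zs l $ J" by (rule antisym_fun_set_entries[OF p d M])
    have I: "set_entries I zs (map I zs) = I" by (rule set_entries_unique[OF d]) auto
    show ?thesis
    proof (cases "distinct (map I zs)")
      case False
      then have "M $ I $ J = 0" using zero_if_not_distinct[of "map I zs"] I by simp
      moreover have "(antisymmetrizer p zs ** M) $ I $ J = 0" using False by (simp add: matrix_mult_nth antisymmetrizer_def)
      ultimately show ?thesis by (simp add: smat_def)
    next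
      case True
      let ?l = "map I zs" and ?u' = "inversion_weight (\<lambda>a b. p b a)"
      let ?S = "set ?l"
      have card: "card ?S = length zs" using distinct_card[OF True] by simp
      let ?K = "{K. (\<forall>m. m \<notin> set zs \<longrightarrow> I m = K m) \<and> distinct (map K zs) \<and> set (map K zs) = ?S}"
      have MI: "M $ I $ J = of_F (inversion_weight p ?l) * M $ set_entries I zs (List.sort ?l) $ J"
        using sort_eq[of ?l] I by simp
      have eq: "of_F (inversion_weight p ?l * ?u' l) * M $ set_entries I zs l $ J = of_F (inversion_weight p l * ?u' l) * M $ I $ J"
        if "l \<in> permutations_of_set ?S" for l
      proof -
        have l: "set l = ?S" "distinct l" using that by (simp_all add: permutations_of_set_def)
        then have len: "length l = length zs" using card distinct_card[of l] by simp
        have "List.sort l = List.sort ?l" using l True by (metis sorted_list_of_set_sort_remdups distinct_remdups_id)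
        then have Ml: "M $ set_entries I zs l $ J = of_F (inversion_weight p l) * M $ set_entries I zs (List.sort ?l) $ J"
          using sort_eq[OF len] by simp
        have "inversion_weight p ?l * ?u' l * inversion_weight p l = inversion_weight p l * ?u' l * inversion_weight p ?l" by (simp only: mult_ac)
        then show ?thesis unfolding MI Ml by (simp only: mult.assoc[symmetric] of_F_mult[symmetric])
      qed
      have "(antisymmetrizer p zs ** M) $ I $ J = (\<Sum>K\<in>?K. antisymmetrizer p zs $ I $ K * M $ K $ J)"
        unfolding matrix_mult_nth by (rule sum.mono_neutral_right) (auto simp: antisymmetrizer_def)
      also have "\<dots> = (\<Sum>K\<in>?K. of_F (inversion_weight p ?l * ?u' (map K zs)) * M $ K $ J)"
        by (intro sum.cong refl) (use True in \<open>auto simp: antisymmetrizer_def\<close>)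
      also have "\<dots> = (\<Sum>l\<in>permutations_of_set ?S. of_F (inversion_weight p ?l * ?u' (map (set_entries I zs l) zs)) * M $ set_entries I zs l $ J)"
        by (rule sum.reindex_bij_betw[OF bij_betw_permutations_set_entries[OF d _ card], symmetric]) simp
      also have "\<dots> = (\<Sum>l\<in>permutations_of_set ?S. of_F (inversion_weight p l * ?u' l) * M $ I $ J)"
      proof (intro sum.cong refl)
        fix l assume l: "l \<in> permutations_of_set ?S"
        then have "map (set_entries I zs l) zs = l"
          using card distinct_card[of l] by (intro map_set_entries[OF d]) (simp add: permutations_of_set_def)
        with eq[OF l] show "of_F (inversion_weight p ?l * ?u' (map (set_entries I zs l) zs)) * M $ set_entries I zs l $ J =
            of_F (inversion_weight p l * ?u' l) * M $ I $ J" by simp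
      qed
      also have "\<dots> = of_F (\<Sum>l\<in>permutations_of_set ?S. inversion_weight p l * ?u' l) * M $ I $ J"
        by (simp add: of_F_sum sum_distrib_right)
      also have "(\<Sum>l\<in>permutations_of_set ?S. inversion_weight p l * ?u' l) = qfact (length zs)"
        using sum_permutations_inversion_weight[OF p, of ?S] card by simp
      finally show ?thesis by (simp add: smat_def)
    qed
  qed
  then show ?thesis by (simp add: vec_eq_iff)
qed

definition antisym_rows where
  "antisym_rows p zs M \<longleftrightarrow>
     (\<forall>as a b bs. zs = as @ a # b # bs \<longrightarrow> M ** braid_op p a b = smat (of_F (- (qpar\<^sup>2))) M)"

lemma transpose_mult_central:
  assumes "central_entries B"
  shows "transpose (A ** B) = transpose B ** transpose A"
  using assms by (simp add: vec_eq_iff transpose_def matrix_mult_nth central_entries_def)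

lemma transpose_smat: "transpose (smat c A) = smat c (transpose A)"
  by (simp add: vec_eq_iff transpose_def smat_def)

lemma antisym_cols_transpose:
  assumes d: "distinct zs"
  shows "antisym_cols (\<lambda>a b. p b a) zs (transpose M) \<longleftrightarrow> antisym_rows p zs M"
proof -
  have "braid_op (\<lambda>a b. p b a) a b ** transpose M = smat c (transpose M) \<longleftrightarrow> M ** braid_op p a b = smat c M"
    if "zs = as @ a # b # bs" for as a b bs c
  proof -
    have "a \<noteq> b" using that d by auto
    then have "braid_op (\<lambda>a b. p b a) a b ** transpose M = transpose (M ** braid_op p a b)"
      by (simp add: transpose_mult_central[OF central_braid_op] transpose_braid_op)
    then show ?thesis by (metis transpose_smat transpose_transpose)
  qed
  then show ?thesis unfolding antisym_cols_def antisym_rows_def by metis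
qed

lemma antisymmetrizer_absorb_right:
  assumes p: "hecke_params p" and d: "distinct zs" and M: "antisym_rows p zs M"
  shows "M ** antisymmetrizer p zs = smat (of_F (qfact (length zs))) M"
proof -
  have "antisymmetrizer (\<lambda>a b. p b a) zs ** transpose M = smat (of_F (qfact (length zs))) (transpose M)"
    by (rule antisymmetrizer_absorb_left[OF hecke_params_flip[OF p] d]) (simp add: antisym_cols_transpose d M)
  then have "transpose (M ** antisymmetrizer p zs) = transpose (smat (of_F (qfact (length zs))) M)"
    by (simp add: transpose_mult_central[OF central_antisymmetrizer] transpose_antisymmetrizer transpose_smat)
  then show ?thesis by (metis transpose_transpose)
qed

lemma antisym_rows_antisymmetrizer:
  assumes p: "hecke_params p" and d: "distinct zs"
  shows "antisym_rows p zs (antisymmetrizer p zs)"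
  using antisym_antisymmetrizer[OF hecke_params_flip[OF p] d]
  by (simp add: transpose_antisymmetrizer flip: antisym_cols_transpose[OF d])

lemma smat_cancel:
  assumes "c \<noteq> 0" "smat (of_F c) A = smat (of_F c) B"
  shows "A = B"
proof -
  have "smat (of_F (inverse c)) (smat (of_F c) M) = M" for M :: "'a qalg^'b^'c"
    using assms(1) by (simp add: vec_eq_iff smat_def mult.assoc[symmetric] of_F_mult[symmetric])
  with assms(2) show ?thesis by metis
qed

text \<open>
  Both sides are obtained from the product of \<open>M\<close> with the antisymmetrizers on both sides by dividing
  by the same \<open>q\<close>-factorial.
\<close>

lemma antisymmetrizer_intertwine:
  assumes p: "hecke_params p" and d: "distinct zs" "distinct ys" and len: "length zs = length ys"
    and c: "antisym_cols p zs (M ** antisymmetrizer p ys)" and r: "antisym_rows p ys (antisymmetrizer p zs ** M)"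
  shows "antisymmetrizer p zs ** M = M ** antisymmetrizer p ys"
proof -
  have "smat (of_F (qfact (length ys))) (antisymmetrizer p zs ** M) = antisymmetrizer p zs ** M ** antisymmetrizer p ys"
    by (rule antisymmetrizer_absorb_right[OF p d(2) r, symmetric])
  also have "\<dots> = antisymmetrizer p zs ** (M ** antisymmetrizer p ys)" by (simp only: matrix_mul_assoc)
  also have "\<dots> = smat (of_F (qfact (length ys))) (M ** antisymmetrizer p ys)"
    using antisymmetrizer_absorb_left[OF p d(1) c] len by simp
  finally show ?thesis by (rule smat_cancel[OF qfact_nonzero])
qed

lemma antisymmetrizer_commute:
  assumes p: "hecke_params p" and d: "distinct zs"
    and h: "\<And>as a b bs. zs = as @ a # b # bs \<Longrightarrow> braid_op p a b ** M = M ** braid_op p a b"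
  shows "antisymmetrizer p zs ** M = M ** antisymmetrizer p zs"
proof (rule antisymmetrizer_intertwine[OF p d d refl])
  show "antisym_cols p zs (M ** antisymmetrizer p zs)"
    unfolding antisym_cols_def
  proof (intro allI impI)
    fix as a b bs assume zs: "zs = as @ a # b # bs"
    have "braid_op p a b ** (M ** antisymmetrizer p zs) = M ** (braid_op p a b ** antisymmetrizer p zs)"
      by (simp add: matrix_mul_assoc h[OF zs])
    also have "braid_op p a b ** antisymmetrizer p zs = smat (of_F (- (qpar\<^sup>2))) (antisymmetrizer p zs)"
      using antisym_antisymmetrizer[OF p d] zs unfolding antisym_cols_def by blast
    finally show "braid_op p a b ** (M ** antisymmetrizer p zs) = smat (of_F (- (qpar\<^sup>2))) (M ** antisymmetrizer p zs)"
      by (simp add: smat_of_F_mult)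
  qed
  show "antisym_rows p zs (antisymmetrizer p zs ** M)"
    unfolding antisym_rows_def
  proof (intro allI impI)
    fix as a b bs assume zs: "zs = as @ a # b # bs"
    have "antisymmetrizer p zs ** M ** braid_op p a b = antisymmetrizer p zs ** braid_op p a b ** M"
      by (simp add: h[OF zs] flip: matrix_mul_assoc)
    also have "antisymmetrizer p zs ** braid_op p a b = smat (of_F (- (qpar\<^sup>2))) (antisymmetrizer p zs)"
      using antisym_rows_antisymmetrizer[OF p d] zs unfolding antisym_rows_def by blast
    finally show "antisymmetrizer p zs ** M ** braid_op p a b = smat (of_F (- (qpar\<^sup>2))) (antisymmetrizer p zs ** M)"
      by (simp add: smat_of_F_mult)
  qed
qed

lemma antisymmetrizer_braid_word_shift:
  assumes p: "hecke_params p" and d: "distinct (x # ks @ [y])"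
  shows "antisymmetrizer p (ks @ [y]) ** braid_word p (x # ks @ [y]) = braid_word p (x # ks @ [y]) ** antisymmetrizer p (x # ks)"
proof (rule antisymmetrizer_intertwine[OF p])
  show d1: "distinct (x # ks)" and d2: "distinct (ks @ [y])" using d by auto
  have split: "\<exists>as' z. x # ks @ [y] = as' @ z # a # b # bs \<and> x # ks = as' @ z # a # butlast (b # bs)"
    if "ks @ [y] = as @ a # b # bs" for as a b bs
  proof -
    obtain as' z where 1: "x # as = as' @ [z]" by (metis append_butlast_last_id list.distinct(1))
    have 2: "ks = as @ a # butlast (b # bs)" using arg_cong[OF that, of butlast] by (simp add: butlast_append)
    have "x # ks @ [y] = (x # as) @ a # b # bs" "x # ks = (x # as) @ a # butlast (b # bs)"
      using that 2 by simp_all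
    then have "x # ks @ [y] = as' @ z # a # b # bs" "x # ks = as' @ z # a # butlast (b # bs)"
      unfolding 1 by simp_all
    then show ?thesis by blast
  qed
  have split': "\<exists>c cs. x # ks @ [y] = as @ a # b # c # cs \<and> ks @ [y] = tl (as @ [a]) @ b # c # cs"
    if "x # ks = as @ a # b # bs" for as a b bs
  proof -
    obtain c cs where "bs @ [y] = c # cs" by (cases "bs @ [y]") auto
    then show ?thesis using that by (cases as) auto
  qed
  show "antisym_cols p (ks @ [y]) (braid_word p (x # ks @ [y]) ** antisymmetrizer p (x # ks))"
    unfolding antisym_cols_def
  proof (intro allI impI)
    fix as a b bs assume "ks @ [y] = as @ a # b # bs"
    then obtain as' z where 1: "x # ks @ [y] = as' @ z # a # b # bs" and 2: "x # ks = as' @ z # a # butlast (b # bs)"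
      using split by blast
    have 3: "braid_op p z a ** antisymmetrizer p (x # ks) = smat (of_F (- (qpar\<^sup>2))) (antisymmetrizer p (x # ks))"
      using antisym_antisymmetrizer[OF p d1] 2 unfolding antisym_cols_def by blast
    have 4: "braid_op p a b ** braid_word p (x # ks @ [y]) = braid_word p (x # ks @ [y]) ** braid_op p z a"
      using braid_op_braid_word_shift[OF p, of as' z a b bs] d unfolding 1[symmetric] by blast
    have "braid_op p a b ** (braid_word p (x # ks @ [y]) ** antisymmetrizer p (x # ks)) = braid_word p (x # ks @ [y]) ** braid_op p z a ** antisymmetrizer p (x # ks)"
      by (simp only: matrix_mul_assoc 4)
    also have "\<dots> = braid_word p (x # ks @ [y]) ** (braid_op p z a ** antisymmetrizer p (x # ks))"
      by (simp only: matrix_mul_assoc)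
    finally show "braid_op p a b ** (braid_word p (x # ks @ [y]) ** antisymmetrizer p (x # ks)) =
        smat (of_F (- (qpar\<^sup>2))) (braid_word p (x # ks @ [y]) ** antisymmetrizer p (x # ks))"
      by (simp only: 3 smat_of_F_mult)
  qed
  show "antisym_rows p (x # ks) (antisymmetrizer p (ks @ [y]) ** braid_word p (x # ks @ [y]))"
    unfolding antisym_rows_def
  proof (intro allI impI)
    fix as a b bs assume "x # ks = as @ a # b # bs"
    then obtain c cs where 1: "x # ks @ [y] = as @ a # b # c # cs" and 2: "ks @ [y] = tl (as @ [a]) @ b # c # cs"
      using split' by blast
    have 3: "antisymmetrizer p (ks @ [y]) ** braid_op p b c = smat (of_F (- (qpar\<^sup>2))) (antisymmetrizer p (ks @ [y]))"
      using antisym_rows_antisymmetrizer[OF p d2] 2 unfolding antisym_rows_def by blast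
    have 4: "braid_op p b c ** braid_word p (x # ks @ [y]) = braid_word p (x # ks @ [y]) ** braid_op p a b"
      using braid_op_braid_word_shift[OF p, of as a b c cs] d unfolding 1[symmetric] by blast
    have "antisymmetrizer p (ks @ [y]) ** braid_word p (x # ks @ [y]) ** braid_op p a b = antisymmetrizer p (ks @ [y]) ** (braid_op p b c ** braid_word p (x # ks @ [y]))"
      by (simp only: matrix_mul_assoc 4)
    also have "\<dots> = antisymmetrizer p (ks @ [y]) ** braid_op p b c ** braid_word p (x # ks @ [y])"
      by (simp only: matrix_mul_assoc)
    finally show "antisymmetrizer p (ks @ [y]) ** braid_word p (x # ks @ [y]) ** braid_op p a b =
        smat (of_F (- (qpar\<^sup>2))) (antisymmetrizer p (ks @ [y]) ** braid_word p (x # ks @ [y]))"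
      by (simp only: 3 smat_of_F_mult)
  qed
qed simp

lemma smat_1 [simp]: "smat 1 M = M"
  by (simp add: vec_eq_iff smat_def)

lemma smat_smat: "smat (of_F c) (smat (of_F d) M) = smat (of_F (c * d)) M"
  by (simp add: vec_eq_iff smat_def of_F_mult mult.assoc)

lemma braid_word_antisym_cols:
  assumes M: "antisym_cols p zs M" and zs: "zs = as @ bs"
  shows "braid_word p bs ** M = smat (of_F ((- (qpar\<^sup>2)) ^ (length bs - 1))) M"
  using zs
proof (induction bs arbitrary: as)
  case IH: (Cons x bs)
  show ?case
  proof (cases bs)
    case (Cons y r)
    have "braid_op p x y ** M = smat (of_F (- (qpar\<^sup>2))) M"
      using M IH.prems Cons unfolding antisym_cols_def by blast
    moreover have "braid_word p bs ** M = smat (of_F ((- (qpar\<^sup>2)) ^ length r)) M"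
      using IH.IH[of "as @ [x]"] IH.prems Cons by simp
    ultimately have "braid_op p x y ** (braid_word p bs ** M) = smat (of_F ((- (qpar\<^sup>2)) ^ length r * - (qpar\<^sup>2))) M"
      by (simp only: smat_of_F_mult smat_smat)
    then show ?thesis unfolding Cons by (simp add: matrix_mul_assoc mult.commute)
  qed simp
qed simp

lemma braid_word_antisym_rows:
  assumes M: "antisym_rows p zs M" and zs: "zs = as @ bs"
  shows "M ** braid_word p bs = smat (of_F ((- (qpar\<^sup>2)) ^ (length bs - 1))) M"
  using zs
proof (induction bs arbitrary: as)
  case IH: (Cons x bs)
  show ?case
  proof (cases bs)
    case (Cons y r)
    have "M ** braid_op p x y = smat (of_F (- (qpar\<^sup>2))) M"
      using M IH.prems Cons unfolding antisym_rows_def by blast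
    moreover have "M ** braid_word p bs = smat (of_F ((- (qpar\<^sup>2)) ^ length r)) M"
      using IH.IH[of "as @ [x]"] IH.prems Cons by simp
    ultimately have "M ** braid_op p x y ** braid_word p bs = smat (of_F (- (qpar\<^sup>2) * (- (qpar\<^sup>2)) ^ length r)) M"
      by (simp only: smat_of_F_mult smat_smat)
    then show ?thesis unfolding Cons by (simp add: matrix_mul_assoc)
  qed simp
qed simp

section \<open>Moving the factors Y around the trace\<close>

text \<open>
  The legs outside of both lists carry a point mass. Its total weight is 1, so a leg on which an
  operator is free contributes nothing to the trace.
\<close>

definition mixed_weight :: "'n \<Rightarrow> 'l list \<Rightarrow> 'l list \<Rightarrow> 'l \<Rightarrow> 'n::{finite,linorder} \<Rightarrow> 'n ratfun" where
  "mixed_weight a0 ps rs = (\<lambda>k. if k \<in> set ps then weight_D' else if k \<in> set rs then weight_D else (\<lambda>a. if a = a0 then 1 else 0))"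

text \<open>
  An intermediate state of the exchange: the factors \<open>Y\<close> on the legs \<open>ps\<close> have already been moved to the
  front, where the weight is that of \<open>D'\<close>, and those on \<open>rs\<close> have not, and have the weight of \<open>D\<close>.
\<close>

definition mixed_trace :: "'n \<Rightarrow> 'l::finite list \<Rightarrow> 'l list \<Rightarrow> 'n::{finite,linorder} qalg" where
  "mixed_trace a0 ps rs = weighted_trace (mixed_weight a0 ps rs) (Y_prod ps ** antisymmetrizer qent (ps @ rs) ** X_prod (ps @ rs) ** Y_prod rs)"

lemma free_leg_antisymmetrizer: "x \<notin> set zs \<Longrightarrow> free_leg x (antisymmetrizer p zs)"
  by (rule free_leg_on_legs[OF on_legs_antisymmetrizer])

lemma of_F_cancel:
  assumes "c \<noteq> 0" "of_F c * a = of_F c * b"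
  shows "a = b"
proof -
  have "of_F (inverse c) * (of_F c * x) = x" for x
    using assms(1) by (simp add: mult.assoc[symmetric] of_F_mult[symmetric])
  with assms(2) show ?thesis by metis
qed

text \<open>
  The heart of the proof. A braid word is split off the antisymmetrizer at the cost of a scalar and
  prolonged to a new leg \<open>x\<close>, which carries the weight of \<open>D'\<close>. Then the \<open>Y\<close> on the leg \<open>y\<close> can travel
  along the word to \<open>x\<close>, with all factors \<open>X\<close> shifted by one leg. Now \<open>y\<close> is only touched by the last crossing
  of the word, which is removed with the weight of \<open>D\<close>; the antisymmetrizer, shifted along as well,
  reabsorbs the rest of the word, at the cost of the same scalar.
\<close>

lemma mixed_trace_step:
  fixes x y :: "'l::finite"
  assumes d: "distinct (x # ps @ rs @ [y])"
  shows "mixed_trace a0 ps (rs @ [y]) = mixed_trace a0 (x # ps) rs"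
proof -
  let ?h = "braid_op qent :: 'l \<Rightarrow> 'l \<Rightarrow> ('l, 'a) leg_op" and ?P = "antisymmetrizer qent :: 'l list \<Rightarrow> ('l, 'a) leg_op"
    and ?C = "braid_word qent :: 'l list \<Rightarrow> ('l, 'a) leg_op"
  define ks where "ks = ps @ rs"
  have q: "hecke_params (qent :: 'a \<Rightarrow> 'a \<Rightarrow> 'a ratfun)" by (rule hecke_params_qent)
  have d0: "distinct (x # ks @ [y])" and d1: "distinct (ks @ [y])" and d2: "distinct (x # ks)"
    using d by (auto simp: ks_def)
  have xy: "x \<noteq> y" "x \<notin> set ks" "y \<notin> set ks" "x \<notin> set ps" "x \<notin> set rs" "y \<notin> set ps" "y \<notin> set rs"
    using d by (auto simp: ks_def)
  \<comment> \<open>The scalar by which a braid word on length ks + 1 legs acts on antisymmetric tensors.\<close>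
  define c :: "'a ratfun" where "c = (- (qpar\<^sup>2)) ^ length ks"
  have c0: "c \<noteq> 0" by (simp add: c_def)
  let ?W = "mixed_weight a0 ps (rs @ [y])" and ?W' = "mixed_weight a0 (x # ps) rs"
  let ?k = "hd (ks @ [y])" and ?l = "last (x # ks)"
  have k: "x \<noteq> ?k" using xy by (cases ks) auto
  have l: "y \<noteq> ?l" using xy by (auto simp: last_in_set)
  have Ck: "?C (x # ks @ [y]) = ?h x ?k ** ?C (ks @ [y])" by (cases ks) auto
  have Cl: "?C (x # ks @ [y]) = ?C (x # ks) ** ?h ?l y"
  proof -
    obtain as l where e: "x # ks = as @ [l]" by (metis append_butlast_last_id list.distinct(1))
    then have e': "x # ks @ [y] = as @ l # [y]" by (metis append.assoc append_Cons append_Nil)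
    have "?C (as @ l # [y]) = ?C (as @ [l]) ** ?h l y" using braid_word_append[of qent as l "[y]"] by simp
    moreover have "?l = l" unfolding e by simp
    ultimately show ?thesis by (simp only: e' e)
  qed
  have PC: "?P (ks @ [y]) ** X_prod (ks @ [y]) ** ?C (ks @ [y]) = smat (of_F c) (?P (ks @ [y]) ** X_prod (ks @ [y]))"
  proof -
    have "?P (ks @ [y]) ** X_prod (ks @ [y]) ** ?C (ks @ [y]) = ?P (ks @ [y]) ** (X_prod (ks @ [y]) ** ?C (ks @ [y]))"
      by (simp only: matrix_mul_assoc)
    also have "\<dots> = ?P (ks @ [y]) ** ?C (ks @ [y]) ** X_prod (ks @ [y])"
      by (simp only: braid_word_X_prod_commute[OF d1, symmetric] matrix_mul_assoc)
    also have "?P (ks @ [y]) ** ?C (ks @ [y]) = smat (of_F c) (?P (ks @ [y]))"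
      using braid_word_antisym_rows[OF antisym_rows_antisymmetrizer[OF q d1], of "[]" "ks @ [y]"] by (simp add: c_def)
    finally show ?thesis by (simp only: smat_of_F_mult)
  qed
  have CP: "?C (x # ks) ** ?P (x # ks) = smat (of_F c) (?P (x # ks))"
    using braid_word_antisym_cols[OF antisym_antisymmetrizer[OF q d2], of "[]" "x # ks"] by (simp add: c_def)
  have "of_F c * mixed_trace a0 ps (rs @ [y]) =
      weighted_trace ?W (Y_prod ps ** smat (of_F c) (?P (ks @ [y]) ** X_prod (ks @ [y])) ** (leg1 y Ymat ** Y_prod rs))"
    by (simp add: mixed_trace_def Y_prod_append ks_def smat_of_F_mult weighted_trace_smat matrix_mul_assoc)
  also have "\<dots> = weighted_trace ?W ((Y_prod ps ** ?P (ks @ [y]) ** X_prod (ks @ [y])) ** (?C (ks @ [y]) ** leg1 y Ymat ** Y_prod rs))"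
    by (simp only: PC[symmetric] matrix_mul_assoc)
  \<comment> \<open>The crossing of the new leg x completes the braid word.\<close>
  also have "\<dots> = weighted_trace (?W(x := weight_D')) ((Y_prod ps ** ?P (ks @ [y]) ** X_prod (ks @ [y])) ** ?h x ?k **
      (?C (ks @ [y]) ** leg1 y Ymat ** Y_prod rs))"
  proof (rule weighted_trace_insert)
    show "free_leg x (Y_prod ps ** ?P (ks @ [y]) ** X_prod (ks @ [y]))"
      using xy by (intro free_leg_mult free_leg_Y_prod free_leg_antisymmetrizer free_leg_X_prod) auto
    show "free_leg x (?C (ks @ [y]) ** leg1 y Ymat ** Y_prod rs)"
      using xy by (intro free_leg_mult free_leg_Y_prod free_leg_braid_word free_leg_leg1) auto
    show "partial_trace weight_D' x (?h x ?k) = mat 1" by (rule partial_trace_braid_op_left[OF q k])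
    show "(\<Sum>a\<in>UNIV. ?W x a) = 1" using xy by (simp add: mixed_weight_def)
  qed
  also have "(Y_prod ps ** ?P (ks @ [y]) ** X_prod (ks @ [y])) ** ?h x ?k ** (?C (ks @ [y]) ** leg1 y Ymat ** Y_prod rs) =
      Y_prod ps ** ?P (ks @ [y]) ** (X_prod (ks @ [y]) ** ?C (x # ks @ [y]) ** leg1 y Ymat) ** Y_prod rs"
    by (simp only: Ck matrix_mul_assoc)
  also have "X_prod (ks @ [y]) ** ?C (x # ks @ [y]) ** leg1 y Ymat = leg1 x Ymat ** ?C (x # ks @ [y]) ** X_prod (x # ks)"
    using Y_braid_word_X_prod[of "x # ks" y, symmetric] d0 by simp
  also have "Y_prod ps ** ?P (ks @ [y]) ** (leg1 x Ymat ** ?C (x # ks @ [y]) ** X_prod (x # ks)) ** Y_prod rs =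
      Y_prod ps ** (?P (ks @ [y]) ** leg1 x Ymat) ** ?C (x # ks @ [y]) ** X_prod (x # ks) ** Y_prod rs"
    by (simp only: matrix_mul_assoc)
  also have "?P (ks @ [y]) ** leg1 x Ymat = leg1 x Ymat ** ?P (ks @ [y])"
    by (rule on_legs_commute[OF on_legs_antisymmetrizer on_legs_leg1 _ central_antisymmetrizer]) (use xy in auto)
  also have "Y_prod ps ** (leg1 x Ymat ** ?P (ks @ [y])) ** ?C (x # ks @ [y]) ** X_prod (x # ks) ** Y_prod rs =
      Y_prod (x # ps) ** (?P (ks @ [y]) ** ?C (x # ks @ [y])) ** X_prod (x # ks) ** Y_prod rs"
    by (simp only: Y_prod.simps matrix_mul_assoc)
  also have "?P (ks @ [y]) ** ?C (x # ks @ [y]) = ?C (x # ks @ [y]) ** ?P (x # ks)"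
    by (rule antisymmetrizer_braid_word_shift[OF q d0])
  also have "Y_prod (x # ps) ** (?C (x # ks @ [y]) ** ?P (x # ks)) ** X_prod (x # ks) ** Y_prod rs =
      (Y_prod (x # ps) ** ?C (x # ks)) ** ?h ?l y ** (?P (x # ks) ** X_prod (x # ks) ** Y_prod rs)"
    by (simp only: Cl matrix_mul_assoc)
  \<comment> \<open>From here on, the weights are those of the next state, except on y.\<close>
  also have "?W(x := weight_D') = ?W'(y := weight_D)"
    using xy by (auto simp: mixed_weight_def fun_eq_iff)
  also have "weighted_trace (?W'(y := weight_D)) ((Y_prod (x # ps) ** ?C (x # ks)) ** ?h ?l y ** (?P (x # ks) ** X_prod (x # ks) ** Y_prod rs)) =
      weighted_trace ?W' ((Y_prod (x # ps) ** ?C (x # ks)) ** (?P (x # ks) ** X_prod (x # ks) ** Y_prod rs))"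
  proof (rule weighted_trace_insert[symmetric])
    show "free_leg y (Y_prod (x # ps) ** ?C (x # ks))"
      using xy by (intro free_leg_mult free_leg_Y_prod free_leg_braid_word) auto
    show "free_leg y (?P (x # ks) ** X_prod (x # ks) ** Y_prod rs)"
      using xy by (intro free_leg_mult free_leg_Y_prod free_leg_antisymmetrizer free_leg_X_prod) auto
    show "partial_trace weight_D y (?h ?l y) = mat 1" by (rule partial_trace_braid_op_right[OF q l])
    show "(\<Sum>a\<in>UNIV. ?W' y a) = 1" using xy by (simp add: mixed_weight_def)
  qed
  also have "(Y_prod (x # ps) ** ?C (x # ks)) ** (?P (x # ks) ** X_prod (x # ks) ** Y_prod rs) =
      Y_prod (x # ps) ** (?C (x # ks) ** ?P (x # ks)) ** X_prod (x # ks) ** Y_prod rs"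
    by (simp only: matrix_mul_assoc)
  also have "weighted_trace ?W' (Y_prod (x # ps) ** (?C (x # ks) ** ?P (x # ks)) ** X_prod (x # ks) ** Y_prod rs) =
      of_F c * mixed_trace a0 (x # ps) rs"
    by (simp only: CP smat_of_F_mult weighted_trace_smat mixed_trace_def ks_def[symmetric] append_Cons)
  finally show ?thesis by (rule of_F_cancel[OF c0])
qed

lemma mixed_trace_move:
  assumes "length ys = length rs" "distinct (ys @ ps @ rs)"
  shows "mixed_trace a0 ps rs = mixed_trace a0 (ys @ ps) []"
  using assms
proof (induction rs arbitrary: ps ys rule: rev_induct)
  case (snoc y rs)
  then obtain ys' x where ys: "ys = ys' @ [x]" by (cases ys rule: rev_cases) auto
  have "mixed_trace a0 ps (rs @ [y]) = mixed_trace a0 (x # ps) rs"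
    by (rule mixed_trace_step) (use snoc.prems ys in auto)
  also have "\<dots> = mixed_trace a0 (ys' @ x # ps) []"
    by (rule snoc.IH) (use snoc.prems ys in auto)
  finally show ?case by (simp add: ys)
qed simp

subsection \<open>Independence of the legs\<close>

lemma embed_legs_mat1:
  fixes f :: "'k::finite \<Rightarrow> 'l::finite"
  assumes "inj f"
  shows "embed_legs f (mat 1) = (mat 1 :: 'a::semiring_1^('l \<Rightarrow> 'n::finite)^('l \<Rightarrow> 'n))"
proof -
  have "(\<forall>m. m \<notin> range f \<longrightarrow> I m = J m) \<and> I \<circ> f = J \<circ> f \<longleftrightarrow> I = J" for I J :: "'l \<Rightarrow> 'n"
    unfolding fun_eq_iff comp_apply by (metis rangeE)
  then show ?thesis
    unfolding vec_eq_iff embed_legs_def mat_def vec_lambda_beta by (intro allI if_conj)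
qed

lemma embed_legs_X_prod: "inj f \<Longrightarrow> embed_legs f (X_prod xs) = X_prod (map f xs)"
  by (induction xs) (simp_all add: embed_legs_mat1 embed_legs_mult embed_legs_leg1)

lemma embed_legs_Y_prod: "inj f \<Longrightarrow> embed_legs f (Y_prod xs) = Y_prod (map f xs)"
  by (induction xs) (simp_all add: embed_legs_mat1 embed_legs_mult embed_legs_leg1)

lemma embed_legs_antisymmetrizer:
  fixes f :: "'k::finite \<Rightarrow> 'l::finite"
  assumes f: "inj f"
  shows "embed_legs f (antisymmetrizer p zs) = antisymmetrizer p (map f zs)"
proof -
  have "{m. m \<in> set zs} = set zs" by auto
  then have *: "(\<forall>m. m \<notin> range f \<longrightarrow> I m = J m) \<and> (\<forall>m. m \<notin> set zs \<longrightarrow> (I \<circ> f) m = (J \<circ> f) m) \<longleftrightarrow>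
     (\<forall>m. m \<notin> set (map f zs) \<longrightarrow> I m = J m)" for I J :: "'l \<Rightarrow> 'a"
    using off_range_iff[OF f, of I J "\<lambda>m. m \<notin> set zs"] by simp
  show ?thesis
    unfolding vec_eq_iff embed_legs_def antisymmetrizer_def vec_lambda_beta map_map[symmetric]
    by (intro allI if_conj) (use * in \<open>simp only: map_map conj_assoc[symmetric]\<close>)
qed

lemma weighted_trace_embed_legs:
  fixes f :: "'k::finite \<Rightarrow> 'l::finite"
  assumes f: "inj f" and W: "\<And>m. m \<notin> range f \<Longrightarrow> W m = (\<lambda>a. if a = a0 then 1 else 0)"
  shows "weighted_trace W (embed_legs f M) = weighted_trace (W \<circ> f) M"
proof -
  let ?R = "{I. \<forall>m. m \<notin> range f \<longrightarrow> a0 = I m}"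
  have W0: "(\<Prod>k\<in>UNIV. W k (I k)) = (if I \<in> ?R then \<Prod>k\<in>UNIV. W (f k) (I (f k)) else 0)" for I
  proof (cases "I \<in> ?R")
    case True
    then have "(\<Prod>k\<in>UNIV. W k (I k)) = (\<Prod>k\<in>range f. W k (I k))"
      by (intro prod.mono_neutral_right) (auto simp: W)
    with True show ?thesis using f by (simp add: prod.reindex)
  next
    case False
    then obtain m where "m \<notin> range f" "a0 \<noteq> I m" by auto
    then have "W m (I m) = 0" by (simp add: W)
    then have "(\<Prod>k\<in>UNIV. W k (I k)) = 0" by (intro prod_zero) auto
    with False show ?thesis by (simp only: if_False)
  qed
  have "weighted_trace W (embed_legs f M) = (\<Sum>I\<in>?R. of_F (\<Prod>k\<in>UNIV. W (f k) ((I \<circ> f) k)) * M $ (I \<circ> f) $ (I \<circ> f))"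
    unfolding weighted_trace_def W0 by (rule sum.mono_neutral_cong_right) (auto simp: embed_legs_def)
  also have "\<dots> = (\<Sum>I\<in>UNIV. of_F (\<Prod>k\<in>UNIV. W (f k) (I k)) * M $ I $ I)"
    by (rule sum.reindex_bij_betw[OF bij_betw_comp_inj[OF f]])
  finally show ?thesis by (simp add: weighted_trace_def)
qed

lemma mixed_trace_embed_legs:
  fixes f :: "'k::finite \<Rightarrow> 'l::finite"
  assumes f: "inj f"
  shows "mixed_trace a0 (map f ps) (map f rs) = mixed_trace a0 ps rs"
proof -
  have "mixed_trace a0 (map f ps) (map f rs) = weighted_trace (mixed_weight a0 (map f ps) (map f rs))
      (embed_legs f (Y_prod ps ** antisymmetrizer qent (ps @ rs) ** X_prod (ps @ rs) ** Y_prod rs))"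
    by (simp add: mixed_trace_def embed_legs_mult[OF f] embed_legs_Y_prod[OF f] embed_legs_antisymmetrizer[OF f] embed_legs_X_prod[OF f])
  also have "\<dots> = weighted_trace (mixed_weight a0 (map f ps) (map f rs) \<circ> f) (Y_prod ps ** antisymmetrizer qent (ps @ rs) ** X_prod (ps @ rs) ** Y_prod rs)"
    by (rule weighted_trace_embed_legs[OF f]) (auto simp: mixed_weight_def)
  also have "mixed_weight a0 (map f ps) (map f rs) \<circ> f = mixed_weight a0 ps rs"
    using f by (simp add: mixed_weight_def fun_eq_iff inj_image_mem_iff)
  finally show ?thesis by (simp add: mixed_trace_def)
qed

text \<open>
  The exchange needs new legs. All of them are available after doubling the set of legs and
  placing \<open>xs\<close> and \<open>ys\<close> in different copies.
\<close>

lemma mixed_trace_exchange: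
  fixes xs ys :: "'k::finite list"
  assumes "distinct xs" "distinct ys" "length xs = length ys"
  shows "mixed_trace a0 [] xs = mixed_trace a0 ys []"
proof -
  have "mixed_trace a0 [] xs = mixed_trace a0 [] (map (Inl :: 'k \<Rightarrow> 'k + 'k) xs)"
    using mixed_trace_embed_legs[of "Inl :: 'k \<Rightarrow> 'k + 'k" a0 "[]" xs] by simp
  also have "\<dots> = mixed_trace a0 (map (Inr :: 'k \<Rightarrow> 'k + 'k) ys @ []) []"
    by (rule mixed_trace_move) (use assms in \<open>auto simp: distinct_map inj_on_def\<close>)
  also have "\<dots> = mixed_trace a0 ys []"
    using mixed_trace_embed_legs[of "Inr :: 'k \<Rightarrow> 'k + 'k" a0 ys "[]"] by simp
  finally show ?thesis .
qed

section \<open>The full twist\<close>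

lemma antisym_cols_append: "antisym_cols p (as @ bs) M \<Longrightarrow> antisym_cols p as M"
  unfolding antisym_cols_def by (metis append.assoc append_Cons)

lemma braid_word_append_X_prod_commute: "set xs \<inter> set ys = {} \<Longrightarrow> braid_word p xs ** X_prod ys = X_prod ys ** braid_word p xs"
  by (intro X_prod_commute braid_word_leg1_commute) auto

lemma braid_word_append_Y_prod_commute: "set xs \<inter> set ys = {} \<Longrightarrow> braid_word p xs ** Y_prod ys = Y_prod ys ** braid_word p xs"
  by (intro Y_prod_commute braid_word_leg1_commute) auto

text \<open>
  The braid word in each factor acts on an antisymmetric \<open>M\<close> by a scalar, except for its beginning, which
  has to cross the factors \<open>X\<close> that are already there. Crossing them replaces the leading \<open>Y\<close> by one on
  the next leg, so that one more pair of \<open>X\<close> and \<open>Y\<close> joins the ordered products.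
\<close>

lemma matpow_twist:
  fixes M :: "('l::finite, 'n::{finite,linorder}) leg_op"
  assumes d: "distinct zs" and M: "antisym_cols qent zs M" and m: "m \<le> length zs"
  defines "c \<equiv> (- (qpar\<^sup>2)) ^ (length zs - 1)"
  shows "matpow (leg1 (hd zs) (Xmat ** Ymat) ** braid_word qent zs) m ** M =
    smat (of_F (c ^ m)) (X_prod (take m zs) ** Y_prod (take m zs) ** M)"
  using m
proof (induction m)
  case (Suc m)
  let ?C = "braid_word qent :: 'l list \<Rightarrow> ('l, 'n) leg_op"
  let ?A = "leg1 (hd zs) (Xmat ** Ymat) ** ?C zs"
  define as where "as = take m zs"
  obtain y bs where zs: "zs = as @ y # bs" and len: "length as = m"
    using Suc.prems id_take_nth_drop[of m zs] by (auto simp: as_def)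
  have take: "take (Suc m) zs = as @ [y]" using zs len by simp
  have d1: "distinct (as @ [y])" and dis: "set (y # bs) \<inter> set as = {}" using d zs by auto
  have hd: "hd zs = hd (as @ [y])" unfolding zs by (cases as) auto
  have ht: "leg1 (hd (as @ [y])) Xmat ** X_prod (tl (as @ [y])) = (X_prod (as @ [y]) :: ('l, 'n) leg_op)" by (cases as) auto
  have c1: "?C (y # bs) ** M = smat (of_F ((- (qpar\<^sup>2)) ^ length bs)) M"
    using braid_word_antisym_cols[OF M zs] by simp
  have c2: "?C (as @ [y]) ** M = smat (of_F ((- (qpar\<^sup>2)) ^ length as)) M"
  proof -
    have "antisym_cols qent (as @ [y]) M" by (rule antisym_cols_append[of _ _ bs]) (use M zs in simp)
    then show ?thesis using braid_word_antisym_cols[of qent "as @ [y]" M "[]" "as @ [y]"] by simp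
  qed
  have "?A ** (X_prod as ** Y_prod as ** M) =
      leg1 (hd zs) Xmat ** leg1 (hd zs) Ymat ** ?C (as @ [y]) ** (?C (y # bs) ** X_prod as) ** Y_prod as ** M"
    unfolding leg1_mult zs braid_word_append[of qent as y bs] by (simp only: matrix_mul_assoc)
  also have "\<dots> = leg1 (hd zs) Xmat ** leg1 (hd zs) Ymat ** ?C (as @ [y]) ** X_prod as ** (?C (y # bs) ** Y_prod as) ** M"
    by (simp only: braid_word_append_X_prod_commute[OF dis] matrix_mul_assoc)
  also have "\<dots> = leg1 (hd zs) Xmat ** (leg1 (hd zs) Ymat ** ?C (as @ [y]) ** X_prod as) ** Y_prod as ** (?C (y # bs) ** M)"
    by (simp only: braid_word_append_Y_prod_commute[OF dis] matrix_mul_assoc)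
  also have "leg1 (hd zs) Ymat ** ?C (as @ [y]) ** X_prod as = X_prod (tl (as @ [y])) ** ?C (as @ [y]) ** leg1 y Ymat"
    unfolding hd by (rule Y_braid_word_X_prod[OF d1])
  also have "leg1 (hd zs) Xmat ** (X_prod (tl (as @ [y])) ** ?C (as @ [y]) ** leg1 y Ymat) ** Y_prod as ** (?C (y # bs) ** M) =
      (leg1 (hd zs) Xmat ** X_prod (tl (as @ [y]))) ** ?C (as @ [y]) ** (leg1 y Ymat ** Y_prod as) ** (?C (y # bs) ** M)"
    by (simp only: matrix_mul_assoc)
  also have "leg1 y Ymat ** Y_prod as = (Y_prod (as @ [y]) :: ('l, 'n) leg_op)" by (simp add: Y_prod_append)
  also have "leg1 (hd zs) Xmat ** X_prod (tl (as @ [y])) = (X_prod (as @ [y]) :: ('l, 'n) leg_op)" unfolding hd by (rule ht)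
  also have "X_prod (as @ [y]) ** ?C (as @ [y]) ** Y_prod (as @ [y]) ** (?C (y # bs) ** M) =
      X_prod (as @ [y]) ** (?C (as @ [y]) ** Y_prod (as @ [y])) ** (?C (y # bs) ** M)"
    by (simp only: matrix_mul_assoc)
  also have "\<dots> = smat (of_F ((- (qpar\<^sup>2)) ^ length bs)) (X_prod (as @ [y]) ** Y_prod (as @ [y]) ** (?C (as @ [y]) ** M))"
    by (simp only: braid_word_Y_prod_commute[OF d1] c1 smat_of_F_mult matrix_mul_assoc)
  also have "\<dots> = smat (of_F c) (X_prod (as @ [y]) ** Y_prod (as @ [y]) ** M)"
    unfolding c2 smat_of_F_mult smat_smat by (simp add: c_def zs power_add mult.commute)
  finally have step: "?A ** (X_prod as ** Y_prod as ** M) = smat (of_F c) (X_prod (as @ [y]) ** Y_prod (as @ [y]) ** M)" .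
  have "matpow ?A (Suc m) ** M = ?A ** (matpow ?A m ** M)" by (simp add: matrix_mul_assoc)
  also have "matpow ?A m ** M = smat (of_F (c ^ m)) (X_prod as ** Y_prod as ** M)"
    using Suc by (simp add: as_def)
  also have "?A ** smat (of_F (c ^ m)) (X_prod as ** Y_prod as ** M) = smat (of_F (c ^ m)) (smat (of_F c) (X_prod (as @ [y]) ** Y_prod (as @ [y]) ** M))"
    by (simp only: smat_of_F_mult step)
  finally show ?case by (simp add: take smat_smat mult.commute)
qed simp

definition legs_upto :: "nat \<Rightarrow> 'n::{finite,linorder} list" where
  "legs_upto i = map elt [1..<Suc i]"

definition legs_from :: "nat \<Rightarrow> 'n::{finite,linorder} list" where
  "legs_from i = map elt [Suc i..<Suc CARD('n)]"

lemma elt_less: "1 \<le> a \<Longrightarrow> a < b \<Longrightarrow> b \<le> CARD('n) \<Longrightarrow> elt a < (elt b :: 'n::{finite,linorder})"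
  by (simp add: pos_less_iff[symmetric] pos_elt)

lemma legs_append: "i \<le> CARD('n) \<Longrightarrow> legs_upto i @ legs_from i = (legs_upto CARD('n) :: 'n::{finite,linorder} list)"
proof -
  assume "i \<le> CARD('n)"
  then have "[1..<Suc i] @ [Suc i..<Suc CARD('n)] = [1..<Suc CARD('n)]"
    by (metis One_nat_def Suc_le_mono le0 le_add_diff_inverse upt_add_eq_append)
  then show ?thesis unfolding legs_upto_def legs_from_def by (metis map_append)
qed

lemma sorted_legs: "sorted_wrt (<) (legs_upto CARD('n) :: 'n::{finite,linorder} list)"
  unfolding legs_upto_def sorted_wrt_map
  by (rule sorted_wrt_mono_rel[of _ "(<)"]) (auto intro!: elt_less simp del: upt_Suc)

lemma distinct_legs: "distinct (legs_upto CARD('n) :: 'n::{finite,linorder} list)"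
  using sorted_legs strict_sorted_iff by blast

lemma set_legs: "set (legs_upto CARD('n)) = (UNIV :: 'n::{finite,linorder} set)"
proof -
  have "i \<in> elt ` {1..<Suc CARD('n)}" for i :: 'n
    using pos_range[of i] elt_pos[of i] by (metis atLeastLessThan_iff image_eqI less_Suc_eq_le)
  then show ?thesis unfolding legs_upto_def by (auto simp del: upt_Suc)
qed

lemma length_legs_upto [simp]: "length (legs_upto i) = i"
  by (simp add: legs_upto_def)

lemma length_legs_from [simp]: "length (legs_from i :: 'n::{finite,linorder} list) = CARD('n) - i"
  by (simp add: legs_from_def del: upt_Suc)

lemma chain_eq:
  assumes "1 \<le> i"
  shows "chain i = leg1 (elt 1) (Xmat ** Ymat) ** (braid_word qent (legs_upto i) :: ('n::{finite,linorder}, 'n) leg_op)"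
  using assms
proof (induction i rule: dec_induct)
  case base
  then show ?case by (simp add: chain_def legs_upto_def)
next
  case (step i)
  have h: "hatleg i = (braid_op qent (elt i) (elt (Suc i)) :: ('n, 'n) leg_op)"
    by (simp add: hatleg_def braid_op_def Rhat_eq)
  have "chain (Suc i) = chain i ** (hatleg i :: ('n, 'n) leg_op)" using step by (simp add: chain_def)
  moreover have "braid_word qent (legs_upto (Suc i)) = braid_word qent (legs_upto i) ** (hatleg i :: ('n, 'n) leg_op)"
  proof -
    have "legs_upto i = map elt [1..<i] @ [elt i :: 'n]"
      "legs_upto (Suc i) = map elt [1..<i] @ elt i # [elt (Suc i) :: 'n]"
      using step by (simp_all add: legs_upto_def)
    then show ?thesis using braid_word_append[of qent "map elt [1..<i]" "elt i" "[elt (Suc i) :: 'n]"] by (simp add: h)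
  qed
  ultimately show ?case unfolding step.IH by (simp only: matrix_mul_assoc)
qed

section \<open>The vectors u and v\<close>

lemma inversion_weight_map_sorted:
  "sorted_wrt (<) zs \<Longrightarrow> inversion_weight p (map \<sigma> zs) =
     (\<Prod>(i, j)\<in>{(i, j). i \<in> set zs \<and> j \<in> set zs \<and> i < j \<and> \<sigma> j < \<sigma> i}. - p (\<sigma> j) (\<sigma> i))"
  for \<sigma> :: "'k::{finite,linorder} \<Rightarrow> 'n::{finite,linorder}"
proof (induction zs)
  case (Cons a zs)
  let ?S = "\<lambda>zs. {(i, j). i \<in> set zs \<and> j \<in> set zs \<and> i < j \<and> \<sigma> j < \<sigma> i}"
  let ?T = "{j \<in> set zs. \<sigma> j < \<sigma> a}"
  have d: "distinct zs" using Cons.prems strict_sorted_iff[of zs] by simp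
  have "a < j" if "j \<in> set zs" for j using Cons.prems that by simp
  then have S: "?S (a # zs) = Pair a ` ?T \<union> ?S zs" by (auto dest: order.asym)
  have "a \<notin> set zs" using Cons.prems by auto
  then have dis: "Pair a ` ?T \<inter> ?S zs = {}" by auto
  have "(\<Prod>b\<leftarrow>filter (\<lambda>b. b < \<sigma> a) (map \<sigma> zs). - p b (\<sigma> a)) =
      (\<Prod>j\<leftarrow>filter (\<lambda>j. \<sigma> j < \<sigma> a) zs. - p (\<sigma> j) (\<sigma> a))"
    by (simp add: filter_map o_def)
  also have "\<dots> = (\<Prod>j\<in>?T. - p (\<sigma> j) (\<sigma> a))"
    using prod.distinct_set_conv_list[of "filter (\<lambda>j. \<sigma> j < \<sigma> a) zs" "\<lambda>j. - p (\<sigma> j) (\<sigma> a)"] d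
    by simp
  also have "\<dots> = (\<Prod>(i, j)\<in>Pair a ` ?T. - p (\<sigma> j) (\<sigma> i))"
    by (simp add: prod.reindex inj_on_def)
  finally show ?case using Cons unfolding S
    by (subst prod.union_disjoint[OF _ _ dis]) (auto intro: finite_subset[of _ UNIV])
qed simp

lemma inversion_weight_legs:
  fixes \<sigma> :: "'n::{finite,linorder} \<Rightarrow> 'n"
  shows "inversion_weight qent (map \<sigma> (legs_upto CARD('n))) = mq_c \<sigma>"
    and "inversion_weight (\<lambda>a b. qent b a) (map \<sigma> (legs_upto CARD('n))) = mq_r \<sigma>"
  unfolding inversion_weight_map_sorted[OF sorted_legs] set_legs mq_c_def mq_r_def by simp_all

text \<open>
  With the antisymmetrizer of all legs, the matrix coefficient of the vectors \<open>v\<close> and \<open>u\<close> becomes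
  a trace.
\<close>

lemma antisymmetrizer_legs:
  "antisymmetrizer qent (legs_upto CARD('n)) $ I $ J =
     (if I permutes UNIV \<and> J permutes UNIV then of_F (mq_c I * mq_r J) else (0 :: 'n::{finite,linorder} qalg))"
proof -
  have 1: "distinct (map I (legs_upto CARD('n))) \<longleftrightarrow> I permutes UNIV" for I :: "'n \<Rightarrow> 'n"
    unfolding distinct_map set_legs permutes_univ bij_iff[symmetric]
    using distinct_legs finite_UNIV_inj_surj[of I] by (auto simp: bij_def)
  have 2: "I permutes UNIV \<Longrightarrow> set (map I (legs_upto CARD('n))) = UNIV" for I :: "'n \<Rightarrow> 'n"
    by (simp add: set_legs permutes_surj)
  show ?thesis
    unfolding antisymmetrizer_def vec_lambda_beta inversion_weight_legs 1 by (auto simp: 2 set_legs permutes_surj)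
qed

lemma vec_sum_axis: "(\<Sum>\<sigma> | \<sigma> permutes UNIV. axis \<sigma> (f \<sigma>)) $ I =
   (if I permutes UNIV then f I else (0 :: 'n::{finite,linorder} qalg))"
proof -
  have "(\<Sum>\<sigma> | \<sigma> permutes UNIV. axis \<sigma> (f \<sigma>)) $ I = (\<Sum>\<sigma> | \<sigma> permutes UNIV. if \<sigma> = I then f \<sigma> else 0)"
    unfolding sum_component by (intro sum.cong) (auto simp: axis_def)
  then show ?thesis by (simp add: sum.delta' sum.delta)
qed

lemma scalar_product_uv:
  "scalar_product v_vec (M *v u_vec) = trace (M ** antisymmetrizer qent (legs_upto CARD('n)))"
  for M :: "('n, 'n::{finite,linorder}) leg_op"
proof -
  have v: "v_vec $ I = (if I permutes UNIV then of_F (mq_r I) else (0 :: 'n qalg))" for I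
    unfolding v_vec_def by (rule vec_sum_axis)
  have u: "u_vec $ I = (if I permutes UNIV then of_F (mq_c I) else (0 :: 'n qalg))" for I
    unfolding u_vec_def by (rule vec_sum_axis)
  have "v_vec $ I * (M $ I $ J * u_vec $ J) = M $ I $ J * antisymmetrizer qent (legs_upto CARD('n)) $ J $ I" for I J
  proof -
    have "of_F r * (m * of_F c) = m * of_F (c * r)" for r c and m :: "'n qalg"
    proof -
      have "of_F r * (m * of_F c) = (of_F r * m) * of_F c" by (simp only: mult.assoc)
      also have "\<dots> = m * of_F (r * c)" by (simp only: of_F_central[of r m] mult.assoc of_F_mult)
      finally show ?thesis by (simp only: mult.commute)
    qed
    then show ?thesis unfolding u v antisymmetrizer_legs by simp
  qed
  then show ?thesis
    by (simp add: scalar_product_def matrix_vector_mult_def trace_def matrix_mult_nth sum_distrib_left)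
qed

section \<open>Contracting the complementary legs\<close>

lemma on_legs_mult:
  fixes A B :: "'a::semiring_1^('l::finite \<Rightarrow> 'n::finite)^('l \<Rightarrow> 'n)"
  assumes A: "on_legs S A" and B: "on_legs S B"
  shows "on_legs S (A ** B)"
  unfolding on_legs_def
proof (intro conjI allI impI)
  fix I J m assume *: "(A ** B) $ I $ J \<noteq> 0" and m: "m \<notin> S"
  show "I m = J m"
  proof (rule ccontr)
    assume "I m \<noteq> J m"
    then have "A $ I $ K * B $ K $ J = 0" for K
      using on_legs_zero[OF A m, of I K] on_legs_zero[OF B m, of K J] by (cases "I m = K m") auto
    with * show False by (simp add: matrix_mult_nth)
  qed
next
  fix I J I' J' :: "'l \<Rightarrow> 'n"
  assume 1: "\<forall>m\<in>S. I m = I' m \<and> J m = J' m" and 2: "\<forall>m. m \<notin> S \<longrightarrow> I m = J m \<and> I' m = J' m"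
  let ?R = "\<lambda>I. {K. \<forall>m. m \<notin> S \<longrightarrow> I m = K m}"
  let ?g = "\<lambda>I K m. if m \<in> S then K m else I m"
  have R: "(A ** B) $ I $ J = (\<Sum>K\<in>?R I. A $ I $ K * B $ K $ J)" for I J
    unfolding matrix_mult_nth
  proof (rule sum.mono_neutral_right)
    show "\<forall>K\<in>UNIV - ?R I. A $ I $ K * B $ K $ J = 0"
    proof
      fix K assume "K \<in> UNIV - ?R I"
      then obtain m where "m \<notin> S" "I m \<noteq> K m" by auto
      then have "A $ I $ K = 0" by (rule on_legs_zero[OF A])
      then show "A $ I $ K * B $ K $ J = 0" by simp
    qed
  qed auto
  have "(\<Sum>K\<in>?R I. A $ I $ K * B $ K $ J) = (\<Sum>K\<in>?R I'. A $ I' $ K * B $ K $ J')"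
  proof (rule sum.reindex_bij_witness[where i = "?g I" and j = "?g I'"])
    fix K assume K: "K \<in> ?R I"
    have "A $ I' $ ?g I' K = A $ I $ K" using 1 2 K by (intro on_legs_cong[OF A]) auto
    moreover have "B $ ?g I' K $ J' = B $ K $ J" using 1 2 K by (intro on_legs_cong[OF B]) auto
    ultimately show "A $ I' $ ?g I' K * B $ ?g I' K $ J' = A $ I $ K * B $ K $ J" by simp
  qed auto
  then show "(A ** B) $ I $ J = (A ** B) $ I' $ J'" by (simp only: R)
qed

lemma on_legs_mat1: "on_legs S (mat 1 :: 'a::semiring_1^('l::finite \<Rightarrow> 'n::finite)^('l \<Rightarrow> 'n))"
  unfolding on_legs_def
proof (intro conjI allI impI)
  fix I J I' J' :: "'l \<Rightarrow> 'n"
  assume 1: "\<forall>m\<in>S. I m = I' m \<and> J m = J' m" and 2: "\<forall>m. m \<notin> S \<longrightarrow> I m = J m \<and> I' m = J' m"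
  have "I = J \<longleftrightarrow> I' = J'"
  proof
    assume "I = J"
    then show "I' = J'" using 1 2 by (intro ext) metis
  next
    assume "I' = J'"
    then show "I = J" using 1 2 by (intro ext) metis
  qed
  then show "mat 1 $ I $ J = (mat 1 $ I' $ J' :: 'a)" by (simp add: mat_def)
qed (auto simp: mat_def split: if_splits)

lemma on_legs_mono:
  fixes A :: "'a::zero^('l::finite \<Rightarrow> 'n::finite)^('l \<Rightarrow> 'n)"
  assumes A: "on_legs S A" and "S \<subseteq> T"
  shows "on_legs T A"
  unfolding on_legs_def
proof (intro conjI allI impI)
  fix I J m assume "A $ I $ J \<noteq> 0" "m \<notin> T"
  then show "I m = J m" using on_legs_zero[OF A, of m I J] assms(2) by blast
next
  fix I J I' J' :: "'l \<Rightarrow> 'n"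
  assume 1: "\<forall>m\<in>T. I m = I' m \<and> J m = J' m" and 2: "\<forall>m. m \<notin> T \<longrightarrow> I m = J m \<and> I' m = J' m"
  show "A $ I $ J = A $ I' $ J'"
  proof (cases "\<forall>m. m \<notin> S \<longrightarrow> I m = J m")
    case True
    with 1 2 have "\<And>m. m \<notin> S \<Longrightarrow> I' m = J' m" by metis
    with True show ?thesis using 1 assms(2) by (intro on_legs_cong[OF A]) blast+
  next
    case False
    then obtain m where m: "m \<notin> S" "I m \<noteq> J m" by auto
    with 1 2 have "I' m \<noteq> J' m" by metis
    with m show ?thesis using on_legs_zero[OF A] by metis
  qed
qed

lemma on_legs_X_prod: "set xs \<subseteq> S \<Longrightarrow> on_legs S (X_prod xs)"
  by (induction xs) (auto intro!: on_legs_mult on_legs_mat1 intro: on_legs_mono[OF on_legs_leg1])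

lemma on_legs_Y_prod: "set xs \<subseteq> S \<Longrightarrow> on_legs S (Y_prod xs)"
  by (induction xs) (auto intro!: on_legs_mult on_legs_mat1 intro: on_legs_mono[OF on_legs_leg1])

lemma inversion_weight_append: "inversion_weight p (xs @ ys) = inversion_weight p xs * inversion_weight p ys * (\<Prod>a\<leftarrow>xs. \<Prod>b\<leftarrow>filter (\<lambda>b. b < a) ys. - p b a)"
  by (induction xs) (simp_all add: mult_ac)

text \<open>
  Between the two parts of the lists, each inversion contributes \<open>p b a * p a b = qpar\<^sup>2\<close>, whatever the
  arrangements are; so the two parts separate up to a power of \<open>qpar\<^sup>2\<close> that only depends on the sets of
  values.
\<close>

lemma inversion_weight_append_pair:
  assumes p: "hecke_params p" and d: "distinct xs" "distinct xs'" "distinct l" "set xs = set xs'" "set xs \<inter> set l = {}"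
  shows "inversion_weight p (xs @ l) * inversion_weight (\<lambda>a b. p b a) (xs' @ l) =
    inversion_weight p xs * inversion_weight (\<lambda>a b. p b a) xs' * (inversion_weight p l * inversion_weight (\<lambda>a b. p b a) l) *
      (\<Prod>a\<in>set xs. (qpar\<^sup>2) ^ card {b \<in> set l. b < a})"
proof -
  let ?f = "\<lambda>a. \<Prod>b\<leftarrow>filter (\<lambda>b. b < a) l. - p b a" and ?g = "\<lambda>a. \<Prod>b\<leftarrow>filter (\<lambda>b. b < a) l. - p a b"
  have "(\<Prod>a\<leftarrow>xs. ?f a) * (\<Prod>a\<leftarrow>xs'. ?g a) = (\<Prod>a\<in>set xs. ?f a) * (\<Prod>a\<in>set xs. ?g a)"
    unfolding prod.distinct_set_conv_list[OF d(1), symmetric] d(4) prod.distinct_set_conv_list[OF d(2), symmetric] ..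
  also have "\<dots> = (\<Prod>a\<in>set xs. ?f a * ?g a)" by (rule prod.distrib[symmetric])
  also have "\<dots> = (\<Prod>a\<in>set xs. (qpar\<^sup>2) ^ card {b \<in> set l. b < a})"
    by (intro prod.cong refl inversion_weight_flip_mult[OF p]) (use d in auto)
  finally have *: "(\<Prod>a\<leftarrow>xs. ?f a) * (\<Prod>a\<leftarrow>xs'. ?g a) = (\<Prod>a\<in>set xs. (qpar\<^sup>2) ^ card {b \<in> set l. b < a})" .
  show ?thesis unfolding inversion_weight_append *[symmetric] by (simp only: mult_ac)
qed

lemma weight_D_card: "weight_D a = (qpar\<^sup>2) ^ card {b. b < a}"
proof -
  have "{j. j \<le> a} = insert a {b. b < a}" by auto
  then have "pos a - 1 = card {b. b < a}" by (simp add: pos_def)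
  then show ?thesis by (simp add: weight_D_def power_mult)
qed

lemma prod_rank: "finite S \<Longrightarrow> (\<Prod>x\<in>S. f (card {b \<in> S. b < x})) = (\<Prod>k<card S. f k)"
  for S :: "'b::linorder set" and f :: "nat \<Rightarrow> 'a::comm_monoid_mult"
proof (induction S rule: finite_linorder_max_induct)
  case (insert m S)
  have 1: "{b \<in> insert m S. b < x} = {b \<in> S. b < x}" if "x \<in> S" for x using insert.hyps that by auto
  have 2: "{b \<in> insert m S. b < m} = S" using insert.hyps by auto
  have "m \<notin> S" using insert.hyps by auto
  then show ?case using insert 1 2 by (simp add: mult.commute)
qed simp

text \<open>
  The exponent of \<open>weight_D a\<close> counts the indices below \<open>a\<close>. Those outside of \<open>T\<close> are the inversions between
  \<open>T\<close> and its complement, and those in \<open>T\<close> contribute a constant.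
\<close>

lemma prod_weight_D: "(\<Prod>a\<in>T. weight_D a) = (\<Prod>a\<in>T. (qpar\<^sup>2) ^ card {b \<in> - T. b < a}) * (\<Prod>k<card T. (qpar\<^sup>2) ^ k)"
  for T :: "'n::{finite,linorder} set"
proof -
  have "weight_D a = (qpar\<^sup>2) ^ card {b \<in> - T. b < a} * (qpar\<^sup>2) ^ card {b \<in> T. b < a}" for a
  proof -
    have "{b. b < a} = {b \<in> - T. b < a} \<union> {b \<in> T. b < a}" by auto
    then have "card {b. b < a} = card {b \<in> - T. b < a} + card {b \<in> T. b < a}"
      by (simp add: card_Un_disjoint disjoint_iff)
    then show ?thesis by (simp add: weight_D_card power_add)
  qed
  then show ?thesis
    by (simp add: prod.distrib prod_rank[of T "\<lambda>k. (qpar\<^sup>2) ^ k", symmetric])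
qed

text \<open>
  Summing over the entries on the complementary legs. By
  \<open>inversion_weight_append_pair\<close> their arrangements give a \<open>q\<close>-factorial, and the inversions between the two
  groups of legs give, up to a constant, the weight of \<open>D\<close> on the first \<open>i\<close> legs.
\<close>

lemma trace_antisymmetrizer_legs:
  fixes G :: "('n::{finite,linorder}, 'n) leg_op"
  assumes i: "i \<le> CARD('n)" and G: "on_legs (set (legs_upto i)) G"
  shows "of_F (\<Prod>k<i. (qpar\<^sup>2) ^ k) * trace (G ** antisymmetrizer qent (legs_upto CARD('n))) =
    of_F (qfact (CARD('n) - i)) * weighted_trace (mixed_weight a0 [] (legs_upto i)) (antisymmetrizer qent (legs_upto i) ** G)"
proof -
  define xs rest full :: "'n list" where "xs = legs_upto i" and "rest = legs_from i" and "full = legs_upto CARD('n)"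
  let ?u = "inversion_weight qent :: 'n list \<Rightarrow> 'n ratfun" and ?v = "inversion_weight (\<lambda>a b. qent b a) :: 'n list \<Rightarrow> 'n ratfun"
  have q: "hecke_params (qent :: 'n \<Rightarrow> 'n \<Rightarrow> 'n ratfun)" by (rule hecke_params_qent)
  have full: "full = xs @ rest" unfolding xs_def rest_def full_def by (rule legs_append[OF i, symmetric])
  have dfull: "distinct full" and sfull: "set full = UNIV"
    unfolding full_def by (rule distinct_legs, rule set_legs)
  have d: "distinct xs" "distinct rest" "set xs \<inter> set rest = {}" using dfull full by auto
  have off: "m \<notin> set xs \<longleftrightarrow> m \<in> set rest" for m using d sfull full by auto
  have len: "length xs = i" "length rest = CARD('n) - i" by (simp_all add: xs_def rest_def)
  \<comment> \<open>D: the index pairs that contribute to the weighted trace; S: those that contribute to the full trace.\<close>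
  define D :: "(('n \<Rightarrow> 'n) \<times> ('n \<Rightarrow> 'n)) set" where "D = {(A, B). (\<forall>m. m \<notin> set xs \<longrightarrow> A m = a0 \<and> B m = a0) \<and> distinct (map A xs) \<and>
      distinct (map B xs) \<and> set (map A xs) = set (map B xs)}"
  define T where "T = Sigma D (\<lambda>(A, B). permutations_of_set (- set (map A xs)))"
  define S :: "(('n \<Rightarrow> 'n) \<times> ('n \<Rightarrow> 'n)) set" where "S = {(I, J). distinct (map I full) \<and> distinct (map J full) \<and> (\<forall>m. m \<notin> set xs \<longrightarrow> I m = J m)}"
  have surj: "set (map I full) = UNIV" if "distinct (map I full)" for I :: "'n \<Rightarrow> 'n"
  proof -
    have "card (set (map I full)) = length (map I full)" by (rule distinct_card[OF that])
    then show ?thesis unfolding full_def by (intro card_subset_eq) auto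
  qed
  define fi where "fi = (\<lambda>((A, B), l). (set_entries A rest l, set_entries B rest l :: 'n \<Rightarrow> 'n))"
  define fj where "fj = (\<lambda>(I, J). ((set_entries (\<lambda>_. a0) xs (map I xs), set_entries (\<lambda>_. a0) xs (map J xs)), map I rest))"
  have fi: "fi ((A, B), l) = (set_entries A rest l, set_entries B rest l)" for A B l by (simp add: fi_def)
  have fj: "fj (I, J) = ((set_entries (\<lambda>_. a0) xs (map I xs), set_entries (\<lambda>_. a0) xs (map J xs)), map I rest)" for I J
    by (simp add: fj_def)
  have card_compl: "card (- X) = CARD('n) - card X" for X :: "'n set"
    by (simp add: Compl_eq_Diff_UNIV card_Diff_subset)
  have "trace (G ** antisymmetrizer qent full) = (\<Sum>(I, J)\<in>UNIV. of_F (?u (map I full) * ?v (map J full)) * G $ J $ I *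
      (if (I, J) \<in> S then 1 else 0))"
  proof -
    have "G $ J $ I * antisymmetrizer qent full $ I $ J = of_F (?u (map I full) * ?v (map J full)) * G $ J $ I *
      (if (I, J) \<in> S then 1 else 0)" for I J
    proof (cases "(I, J) \<in> S")
      case True
      then have "distinct (map I full)" "distinct (map J full)" by (auto simp: S_def)
      with surj[of I] surj[of J] have "antisymmetrizer qent full $ I $ J = of_F (?u (map I full) * ?v (map J full))"
        unfolding antisymmetrizer_def vec_lambda_beta by (simp only: sfull UNIV_I simp_thms if_True)
      with True show ?thesis by (simp add: of_F_central)
    next
      case False
      then consider "\<not> distinct (map I full)" | "\<not> distinct (map J full)" | m where "m \<notin> set xs" "J m \<noteq> I m"
        unfolding S_def by force
      then have "G $ J $ I = 0 \<or> antisymmetrizer qent full $ I $ J = 0"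
      proof cases
        case 3
        then show ?thesis using on_legs_zero[OF G[folded xs_def], of m J I] by simp
      qed (simp_all add: antisymmetrizer_def)
      with False show ?thesis by auto
    qed
    then show ?thesis
      unfolding trace_def matrix_mult_nth by (subst sum.swap) (simp add: sum.cartesian_product)
  qed
  also have "\<dots> = (\<Sum>(I, J)\<in>S. of_F (?u (map I full) * ?v (map J full)) * G $ J $ I)"
    by (rule sum.mono_neutral_cong_right) auto
  also have "\<dots> = (\<Sum>((A, B), l)\<in>T. of_F (?u (map A xs @ l) * ?v (map B xs @ l)) * G $ B $ A)"
  proof (rule sum.reindex_bij_witness[where i = fi and j = fj])
    fix IJ assume "IJ \<in> S"
    then obtain I J where IJ: "IJ = (I, J)" and dI: "distinct (map I full)" and dJ: "distinct (map J full)"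
      and eq: "\<And>m. m \<notin> set xs \<Longrightarrow> I m = J m"
      unfolding S_def by auto
    define A B where "A = set_entries (\<lambda>_. a0) xs (map I xs)" and "B = set_entries (\<lambda>_. a0) xs (map J xs)"
    have A: "map A xs = map I xs" "\<And>m. m \<in> set xs \<Longrightarrow> A m = I m" "\<And>m. m \<notin> set xs \<Longrightarrow> A m = a0"
      using map_set_entries[OF d(1), of "map I xs"] by (auto simp: A_def set_entries_off)
    have B: "map B xs = map J xs" "\<And>m. m \<in> set xs \<Longrightarrow> B m = J m" "\<And>m. m \<notin> set xs \<Longrightarrow> B m = a0"
      using map_set_entries[OF d(1), of "map J xs"] by (auto simp: B_def set_entries_off)
    have r: "map J rest = map I rest" using eq off by auto
    have I: "set_entries A rest (map I rest) = I" by (rule set_entries_unique[OF d(2) refl]) (use A(2) off in metis)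
    have J: "set_entries B rest (map I rest) = J" by (rule set_entries_unique[OF d(2) r]) (use B(2) off in metis)
    have cI: "set (map I rest) = - set (map I xs)" and cJ: "set (map I rest) = - set (map J xs)"
      using dI dJ surj[OF dI] surj[OF dJ] r unfolding full by auto
    have di: "distinct (map I rest)" "distinct (map I xs)" "distinct (map J xs)" using dI dJ full by auto
    have cc: "set (map I xs) = set (map J xs)" using cI cJ by (metis double_compl)
    have fIJ: "fj IJ = ((A, B), map I rest)" unfolding IJ fj A_def B_def ..
    show "fi (fj IJ) = IJ" unfolding fIJ fi I J by (rule IJ[symmetric])
    have "(A, B) \<in> D" unfolding D_def using A(3) B(3) di cc by (simp only: mem_Collect_eq prod.case A(1) B(1)) blast
    moreover have "map I rest \<in> permutations_of_set (- set (map A xs))"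
      unfolding permutations_of_set_def A(1) using cI di by blast
    ultimately show "fj IJ \<in> T" unfolding fIJ T_def by blast
    have "G $ B $ A = G $ J $ I"
      by (rule on_legs_cong[OF G[folded xs_def]]) (use A B eq in auto)
    then show "(\<lambda>((A, B), l). of_F (?u (map A xs @ l) * ?v (map B xs @ l)) * G $ B $ A) (fj IJ) =
        (\<lambda>(I, J). of_F (?u (map I full) * ?v (map J full)) * G $ J $ I) IJ"
      unfolding fIJ unfolding IJ prod.case A(1) B(1) full map_append r by (rule arg_cong)
  next
    fix ABl assume "ABl \<in> T"
    then obtain A B l where ABl: "ABl = ((A, B), l)" and AB: "(A, B) \<in> D"
      and l: "l \<in> permutations_of_set (- set (map A xs))"
      unfolding T_def by auto
    have D: "\<And>m. m \<notin> set xs \<Longrightarrow> A m = a0 \<and> B m = a0" "distinct (map A xs)" "distinct (map B xs)"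
      "set (map A xs) = set (map B xs)" using AB unfolding D_def by auto
    have sl: "set l = - set (map A xs)" "distinct l" using l by (simp_all add: permutations_of_set_def)
    have "length l = CARD('n) - i"
      using distinct_card[OF sl(2)] distinct_card[OF D(2)] unfolding sl(1) card_compl by (simp add: len del: set_map)
    then have ll: "length l = length rest" by (simp add: len)
    define I J where "I = set_entries A rest l" and "J = set_entries B rest l"
    have I: "map I rest = l" "\<And>m. m \<in> set xs \<Longrightarrow> I m = A m"
      unfolding I_def by (rule map_set_entries[OF d(2) ll], rule set_entries_off, use off in metis)
    have J: "map J rest = l" "\<And>m. m \<in> set xs \<Longrightarrow> J m = B m"
      unfolding J_def by (rule map_set_entries[OF d(2) ll], rule set_entries_off, use off in metis)
    have mI: "map I xs = map A xs" "map J xs = map B xs" using I J by auto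
    have A: "set_entries (\<lambda>_. a0) xs (map A xs) = A" by (rule set_entries_unique[OF d(1)]) (use D in auto)
    have B: "set_entries (\<lambda>_. a0) xs (map B xs) = B" by (rule set_entries_unique[OF d(1)]) (use D in auto)
    have fABl: "fi ABl = (I, J)" unfolding ABl fi I_def J_def ..
    show "fj (fi ABl) = ABl" unfolding fABl fj mI A B I(1) by (rule ABl[symmetric])
    have "distinct (map I full)" "distinct (map J full)"
      unfolding full map_append mI I(1) J(1) using D(2,3) sl by (simp_all only: distinct_append D(4)) auto
    moreover have "I m = J m" if "m \<notin> set xs" for m
      using I(1) J(1) that off by (metis map_eq_conv)
    ultimately show "fi ABl \<in> S" unfolding fABl S_def by simp
  qed
  also have "\<dots> = (\<Sum>(A, B)\<in>D. \<Sum>l\<in>permutations_of_set (- set (map A xs)).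
      of_F (?u (map A xs @ l) * ?v (map B xs @ l)) * G $ B $ A)"
    unfolding T_def by (subst sum.Sigma[symmetric]) (auto simp: case_prod_unfold)
  finally have tr: "trace (G ** antisymmetrizer qent full) = \<dots>" .
  let ?e = "\<Prod>k<i. (qpar\<^sup>2) ^ k :: 'n ratfun"
  have inner: "of_F ?e * (\<Sum>l\<in>permutations_of_set (- set (map A xs)). of_F (?u (map A xs @ l) * ?v (map B xs @ l)) * G $ B $ A) =
      of_F (qfact (CARD('n) - i)) * (of_F ((\<Prod>a\<in>set (map A xs). weight_D a) * (?u (map A xs) * ?v (map B xs))) * G $ B $ A)"
    if "(A, B) \<in> D" for A B
  proof -
    have D: "distinct (map A xs)" "distinct (map B xs)" "set (map A xs) = set (map B xs)" using that unfolding D_def by auto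
    let ?T = "set (map A xs)"
    have cT: "card ?T = i" using distinct_card[OF D(1)] len by simp
    then have cT': "card (- ?T) = CARD('n) - i" by (simp only: card_compl)
    let ?X = "\<Prod>a\<in>?T. (qpar\<^sup>2) ^ card {b \<in> - ?T. b < a} :: 'n ratfun"
    have "?u (map A xs @ l) * ?v (map B xs @ l) = ?u (map A xs) * ?v (map B xs) * ?X * (?u l * ?v l)"
      if "l \<in> permutations_of_set (- ?T)" for l
    proof -
      have l: "set l = - ?T" "distinct l" using that by (simp_all only: permutations_of_set_def mem_Collect_eq)
      show ?thesis
        using inversion_weight_append_pair[OF q D(1,2) l(2) D(3)] unfolding l(1) by (simp only: Compl_disjoint mult_ac)
    qed
    then have "(\<Sum>l\<in>permutations_of_set (- ?T). ?u (map A xs @ l) * ?v (map B xs @ l)) =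
        ?u (map A xs) * ?v (map B xs) * ?X * qfact (CARD('n) - i)"
      using sum_permutations_inversion_weight[OF q, of "- ?T"] by (simp add: sum_distrib_left[symmetric] cT' del: set_map cong: sum.cong)
    then have "?e * (\<Sum>l\<in>permutations_of_set (- ?T). ?u (map A xs @ l) * ?v (map B xs @ l)) =
        qfact (CARD('n) - i) * ((\<Prod>a\<in>?T. weight_D a) * (?u (map A xs) * ?v (map B xs)))"
      unfolding prod_weight_D cT by (simp only: mult_ac)
    from arg_cong[OF this, of "\<lambda>c. of_F c * G $ B $ A"] show ?thesis
      by (simp only: of_F_mult of_F_sum sum_distrib_right sum_distrib_left mult.assoc)
  qed
  have "weighted_trace (mixed_weight a0 [] xs) (antisymmetrizer qent xs ** G) = (\<Sum>(A, B)\<in>UNIV.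
      of_F (\<Prod>k\<in>UNIV. mixed_weight a0 [] xs k (A k)) * (antisymmetrizer qent xs $ A $ B * G $ B $ A))"
    unfolding weighted_trace_def matrix_mult_nth by (simp add: sum_distrib_left sum.cartesian_product)
  also have "\<dots> = (\<Sum>(A, B)\<in>D. of_F ((\<Prod>a\<in>set (map A xs). weight_D a) * (?u (map A xs) * ?v (map B xs))) * G $ B $ A)"
  proof (rule sum.mono_neutral_cong_right)
    show "\<forall>AB\<in>UNIV - D. (case AB of (A, B) \<Rightarrow>
      of_F (\<Prod>k\<in>UNIV. mixed_weight a0 [] xs k (A k)) * (antisymmetrizer qent xs $ A $ B * G $ B $ A)) = 0"
    proof safe
      fix A B assume AB: "(A, B) \<notin> D"
      show "of_F (\<Prod>k\<in>UNIV. mixed_weight a0 [] xs k (A k)) * (antisymmetrizer qent xs $ A $ B * G $ B $ A) = 0"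
      proof (cases "\<forall>m. m \<notin> set xs \<longrightarrow> A m = a0")
        case True
        then have "antisymmetrizer qent xs $ A $ B = 0" using AB unfolding D_def antisymmetrizer_def by auto
        then show ?thesis by simp
      next
        case False
        then obtain m where "m \<notin> set xs" "A m \<noteq> a0" by auto
        then have "mixed_weight a0 [] xs m (A m) = 0" by (simp add: mixed_weight_def)
        then have "(\<Prod>k\<in>UNIV. mixed_weight a0 [] xs k (A k)) = 0" by (intro prod_zero) auto
        then show ?thesis by (simp only: of_F_zero mult_zero_left)
      qed
    qed
    fix AB assume "AB \<in> D"
    then obtain A B where AB: "AB = (A, B)" and D: "(A, B) \<in> D" by (cases AB) auto
    then have D': "\<And>m. m \<notin> set xs \<Longrightarrow> A m = a0 \<and> B m = a0" "distinct (map A xs)" "distinct (map B xs)"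
      "set (map A xs) = set (map B xs)" unfolding D_def by auto
    have "(\<Prod>k\<in>UNIV. mixed_weight a0 [] xs k (A k)) = (\<Prod>k\<in>set xs. weight_D (A k))"
      by (rule prod.mono_neutral_cong_right) (use D' in \<open>auto simp: mixed_weight_def\<close>)
    also have "\<dots> = (\<Prod>a\<in>set (map A xs). weight_D a)"
      using D'(2) by (simp add: distinct_map prod.reindex)
    finally have W: "(\<Prod>k\<in>UNIV. mixed_weight a0 [] xs k (A k)) = (\<Prod>a\<in>set (map A xs). weight_D a)" .
    have "antisymmetrizer qent xs $ A $ B = of_F (?u (map A xs) * ?v (map B xs))"
      using D' unfolding antisymmetrizer_def by simp
    then show "(case AB of (A, B) \<Rightarrow> of_F (\<Prod>k\<in>UNIV. mixed_weight a0 [] xs k (A k)) * (antisymmetrizer qent xs $ A $ B * G $ B $ A)) =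
        (case AB of (A, B) \<Rightarrow> of_F ((\<Prod>a\<in>set (map A xs). weight_D a) * (?u (map A xs) * ?v (map B xs))) * G $ B $ A)"
      unfolding AB prod.case W by (simp only: of_F_mult mult.assoc)
  qed auto
  finally have weighted_trace: "weighted_trace (mixed_weight a0 [] xs) (antisymmetrizer qent xs ** G) = \<dots>" .
  show ?thesis
    unfolding xs_def[symmetric] full_def[symmetric] tr weighted_trace sum_distrib_left
    by (intro sum.cong refl) (use inner in \<open>auto simp: sum_distrib_left\<close>)
qed

section \<open>The action of the anti-automorphism\<close>

lemmas prime_antihom = is_prime_op_antihom[OF prime_op]
lemmas prime_simps = antihomD[OF prime_antihom] is_prime_op_simps[OF prime_op]

text \<open>
  Scalars of \<open>F\<close> are in general moved by the operation; those built from \<open>qpar\<close> alone are not, and all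
  scalar factors that occur are of this kind.
\<close>

definition prime_fixed :: "'n::{finite,linorder} ratfun \<Rightarrow> bool" where
  "prime_fixed c \<longleftrightarrow> prime_op (of_F c) = of_F c"

lemma prime_fixed_qpar: "prime_fixed qpar"
  by (simp add: prime_fixed_def prime_simps)

lemma prime_fixed_0: "prime_fixed 0" and prime_fixed_1: "prime_fixed 1"
  by (simp_all add: prime_fixed_def prime_simps)

lemma prime_fixed_add: "prime_fixed a \<Longrightarrow> prime_fixed b \<Longrightarrow> prime_fixed (a + b)"
  by (simp add: prime_fixed_def prime_simps of_F_add)

lemma prime_fixed_mult: "prime_fixed a \<Longrightarrow> prime_fixed b \<Longrightarrow> prime_fixed (a * b)"
  by (simp only: prime_fixed_def of_F_mult prime_simps(2)) (rule of_F_central)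

lemma prime_fixed_minus: "prime_fixed a \<Longrightarrow> prime_fixed (- a)"
  by (simp add: prime_fixed_def prime_simps of_F_uminus)

lemma prime_fixed_inverse:
  assumes "prime_fixed a"
  shows "prime_fixed (inverse a)"
proof (cases "a = 0")
  case False
  then have 1: "of_F a * of_F (inverse a) = 1" "of_F (inverse a) * of_F a = 1"
    by (simp_all flip: of_F_mult)
  from arg_cong[OF 1(1), of prime_op] have 2: "prime_op (of_F (inverse a)) * of_F a = 1"
    using assms by (simp add: prime_simps prime_fixed_def)
  have "prime_op (of_F (inverse a)) = prime_op (of_F (inverse a)) * (of_F a * of_F (inverse a))"
    by (simp add: 1)
  also have "\<dots> = of_F (inverse a)" by (simp add: 2 flip: mult.assoc)
  finally show ?thesis by (simp add: prime_fixed_def)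
qed (simp add: prime_fixed_0)

lemma prime_fixed_divide: "prime_fixed a \<Longrightarrow> prime_fixed b \<Longrightarrow> prime_fixed (a / b)"
  by (simp add: divide_inverse prime_fixed_mult prime_fixed_inverse)

lemma prime_fixed_power: "prime_fixed a \<Longrightarrow> prime_fixed (a ^ n)"
  by (induction n) (simp_all add: prime_fixed_1 prime_fixed_mult)

lemma prime_fixed_prod: "(\<And>x. x \<in> S \<Longrightarrow> prime_fixed (f x)) \<Longrightarrow> prime_fixed (prod f S)"
  by (induction S rule: infinite_finite_induct) (simp_all add: prime_fixed_1 prime_fixed_mult)

lemma prime_fixed_sum: "(\<And>x. x \<in> S \<Longrightarrow> prime_fixed (f x)) \<Longrightarrow> prime_fixed (sum f S)"
  by (induction S rule: infinite_finite_induct) (simp_all add: prime_fixed_0 prime_fixed_add)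

lemmas prime_fixed_intros = prime_fixed_qpar prime_fixed_0 prime_fixed_1 prime_fixed_mult prime_fixed_minus
  prime_fixed_inverse prime_fixed_divide prime_fixed_power prime_fixed_prod prime_fixed_sum

lemma prime_fixed_qfact: "prime_fixed (qfact n)"
  unfolding qfact_def qint_def by (intro prime_fixed_intros)

lemma prime_op_scalar: "prime_fixed c \<Longrightarrow> prime_op (of_F c * a) = of_F c * prime_op a"
  by (simp only: prime_simps(2) prime_fixed_def) (rule of_F_central[symmetric])

definition opp_index :: "('l \<Rightarrow> 'n::{finite,linorder}) \<Rightarrow> 'l \<Rightarrow> 'n" where
  "opp_index I = (\<lambda>k. opp (I k))"

lemma opp_index_opp_index [simp]: "opp_index (opp_index I) = I"
  by (simp add: opp_index_def)

lemma bij_opp_index: "bij opp_index"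
  by (rule o_bij[of opp_index]) (auto simp: fun_eq_iff)

lemma reix_opp_leg1: "leg1 k (reix opp A) = reix opp_index (leg1 k A)"
  by (auto simp: vec_eq_iff leg1_def reix_def opp_index_def)

lemma Tmat_prime_X: "Tmat prime_op Xmat = reix opp Xmat" and Tmat_prime_Y: "Tmat prime_op Ymat = reix opp Ymat"
  by (simp_all add: vec_eq_iff Tmat_def reix_def prime_simps)

lemma Tmat_prime_mat1: "Tmat prime_op (mat 1) = mat 1"
  by (simp add: vec_eq_iff Tmat_def mat_def prime_simps)

lemma reix_mat1: "bij p \<Longrightarrow> reix p (mat 1) = mat 1"
  by (simp add: vec_eq_iff reix_def mat_def bij_def inj_eq)

lemma Tmat_prime_X_prod: "Tmat prime_op (X_prod xs) = reix opp_index (X_prod (rev xs))"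
  by (induction xs)
    (simp_all add: Tmat_prime_mat1 reix_mat1 bij_opp_index Tmat_mult[OF prime_antihom] Tmat_leg1[OF prime_antihom]
      Tmat_prime_X reix_opp_leg1 X_prod_append reix_mult)

lemma Tmat_prime_Y_prod: "Tmat prime_op (Y_prod xs) = reix opp_index (Y_prod (rev xs))"
  by (induction xs)
    (simp_all add: Tmat_prime_mat1 reix_mat1 bij_opp_index Tmat_mult[OF prime_antihom] Tmat_leg1[OF prime_antihom]
      Tmat_prime_Y reix_opp_leg1 Y_prod_append reix_mult)

text \<open>
  Passing to opposite values and reversing the list preserves inversions, but reverses each inverted
  pair.
\<close>

lemma prime_inversion_weight:
  fixes p :: "'n \<Rightarrow> 'n \<Rightarrow> 'n::{finite,linorder} ratfun"
  assumes p: "\<And>a b. prime_op (of_F (p a b)) = of_F (p (opp a) (opp b))"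
  shows "prime_op (of_F (inversion_weight p l)) = of_F (inversion_weight (\<lambda>a b. p b a) (rev (map opp l)))"
proof (induction l)
  case (Cons a l)
  have 1: "prime_op (of_F (\<Prod>b\<leftarrow>filter (\<lambda>b. b < a) l. - p b a)) =
      of_F (\<Prod>b\<leftarrow>filter (\<lambda>b. b < a) l. - p (opp b) (opp a))" for l
  proof (induction l)
    case (Cons b l)
    have "prime_op (of_F (- p b a)) = of_F (- p (opp b) (opp a))" by (simp add: of_F_uminus prime_simps p)
    then have "prime_op (of_F (- p b a * c)) = of_F (- p (opp b) (opp a)) * prime_op (of_F c)" for c
      by (simp only: of_F_mult prime_simps(2)) (rule of_F_central[symmetric])
    then show ?case using Cons by (simp only: filter.simps list.map prod_list.Cons of_F_mult split: if_split) simp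
  qed (simp add: prime_simps)
  have 2: "(\<Prod>b\<leftarrow>filter (\<lambda>b. b < a) l. - p (opp b) (opp a)) =
      (\<Prod>c\<leftarrow>rev (map opp l). \<Prod>b\<leftarrow>filter (\<lambda>b. b < c) [opp a]. - p c b)" for l
    by (induction l) (simp_all add: opp_less_iff mult.commute)
  have "inversion_weight (\<lambda>a b. p b a) (rev (map opp (a # l))) =
      inversion_weight (\<lambda>a b. p b a) (rev (map opp l)) * (\<Prod>b\<leftarrow>filter (\<lambda>b. b < a) l. - p (opp b) (opp a))"
    unfolding 2 by (simp add: inversion_weight_append)
  then show ?case using Cons by (simp add: prime_simps of_F_mult 1 del: map_map)
qed (simp add: prime_simps)

lemma Tmat_prime_antisymmetrizer:
  fixes xs :: "'l::finite list"
  shows "Tmat prime_op (antisymmetrizer qent xs :: ('l, 'n::{finite,linorder}) leg_op) = reix opp_index (antisymmetrizer qent (rev xs))"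
proof -
  let ?u = "inversion_weight qent :: 'n list \<Rightarrow> 'n ratfun" and ?v = "inversion_weight (\<lambda>a b. qent b a) :: 'n list \<Rightarrow> 'n ratfun"
  have u: "prime_op (of_F (?u l)) = of_F (?v (rev (map opp l)))" for l
    by (rule prime_inversion_weight) (rule prime_simps)
  have v: "prime_op (of_F (?v l)) = of_F (?u (rev (map opp l)))" for l
    by (rule prime_inversion_weight) (rule prime_simps)
  have m: "map (opp_index I) (rev xs) = rev (map opp (map I xs))" for I :: "'l \<Rightarrow> 'n"
    by (simp add: opp_index_def rev_map)
  have d: "distinct (map (opp_index I) (rev xs)) = distinct (map I xs)" for I :: "'l \<Rightarrow> 'n"
    unfolding m by (simp add: distinct_map inj_on_def)
  have inj: "inj (opp :: 'n \<Rightarrow> 'n)" by (simp add: inj_def)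
  have s: "set (map (opp_index I) (rev xs)) = set (map (opp_index J) (rev xs)) \<longleftrightarrow> set (map J xs) = set (map I xs)"
    for I J :: "'l \<Rightarrow> 'n"
    unfolding m set_rev set_map[of opp] inj_image_eq_iff[OF inj] by blast
  have o: "(\<forall>m. m \<notin> set (rev xs) \<longrightarrow> opp_index I m = opp_index J m) \<longleftrightarrow> (\<forall>m. m \<notin> set xs \<longrightarrow> J m = I m)"
    for I J :: "'l \<Rightarrow> 'n" by (auto simp: opp_index_def)
  have "Tmat prime_op (antisymmetrizer qent xs) $ I $ J = reix opp_index (antisymmetrizer qent (rev xs)) $ I $ J" for I J :: "'l \<Rightarrow> 'n"
  proof -
    have "prime_op (of_F (?u (map J xs) * ?v (map I xs))) =
        of_F (?u (map (opp_index I) (rev xs)) * ?v (map (opp_index J) (rev xs)))"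
      unfolding m by (simp only: of_F_mult prime_simps(2) u v)
    then show ?thesis
      unfolding Tmat_def reix_def antisymmetrizer_def vec_lambda_beta s o d if_distrib[of prime_op] prime_simps(4)
      by (intro if_cong) blast+
  qed
  then show ?thesis by (simp add: vec_eq_iff)
qed

text \<open>
  The operation reverses products and replaces all indices by the opposite ones: the factors \<open>Y\<close> come to the
  front, the lists of legs are reversed, and the weight of \<open>D\<close> becomes that of \<open>D'\<close>.
\<close>

lemma prime_mixed_trace:
  fixes xs :: "'l::finite list" and a0 :: "'n::{finite,linorder}"
  assumes d: "distinct xs"
  shows "prime_op (mixed_trace a0 [] xs) = mixed_trace (opp a0) (rev xs) []"
proof -
  let ?W = "mixed_weight a0 [] xs" and ?W' = "mixed_weight (opp a0) (rev xs) []"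
  let ?M = "antisymmetrizer qent xs ** X_prod xs ** Y_prod xs :: ('l, 'n) leg_op"
    and ?N = "Y_prod (rev xs) ** (X_prod (rev xs) ** antisymmetrizer qent (rev xs)) :: ('l, 'n) leg_op"
  have W: "prime_fixed (?W k a)" for k a
    unfolding mixed_weight_def weight_D'_def weight_D_def by (auto intro: prime_fixed_intros)
  have WW: "?W k (opp a) = ?W' k a" for k a
    by (auto simp: mixed_weight_def weight_D_opp)
  have M: "prime_op (?M $ I $ I) = ?N $ opp_index I $ opp_index I" for I
  proof -
    have "Tmat prime_op ?M = reix opp_index ?N"
      by (simp add: Tmat_mult[OF prime_antihom] Tmat_prime_antisymmetrizer Tmat_prime_X_prod Tmat_prime_Y_prod reix_mult[OF bij_opp_index])
    then have "Tmat prime_op ?M $ I $ I = reix opp_index ?N $ I $ I" by simp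
    then show ?thesis by (simp add: Tmat_def reix_def)
  qed
  have d': "distinct (rev xs)" using d by simp
  have N: "X_prod (rev xs) ** antisymmetrizer qent (rev xs) = antisymmetrizer qent (rev xs) ** (X_prod (rev xs) :: ('l, 'n) leg_op)"
  proof (rule antisymmetrizer_commute[OF hecke_params_qent d', symmetric])
    fix as a b bs assume zs: "rev xs = as @ a # b # bs"
    show "braid_op qent a b ** X_prod (rev xs) = X_prod (rev xs) ** (braid_op qent a b :: ('l, 'n) leg_op)"
      using d' unfolding zs by (rule braid_op_X_prod_commute)
  qed
  have "prime_op (mixed_trace a0 [] xs) = (\<Sum>I\<in>UNIV. prime_op (of_F (\<Prod>k\<in>UNIV. ?W k (I k)) * ?M $ I $ I))"
    by (simp add: mixed_trace_def weighted_trace_def antihomD(7)[OF prime_antihom])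
  also have "\<dots> = (\<Sum>I\<in>UNIV. of_F (\<Prod>k\<in>UNIV. ?W k (I k)) * ?N $ opp_index I $ opp_index I)"
    by (intro sum.cong refl) (simp add: prime_op_scalar prime_fixed_prod W M)
  also have "\<dots> = (\<Sum>I\<in>UNIV. of_F (\<Prod>k\<in>UNIV. ?W k (opp_index I k)) * ?N $ I $ I)"
    by (rule sum.reindex_bij_witness[of _ opp_index opp_index]) auto
  also have "\<dots> = (\<Sum>I\<in>UNIV. of_F (\<Prod>k\<in>UNIV. ?W' k (I k)) * ?N $ I $ I)"
    by (simp add: opp_index_def WW)
  also have "\<dots> = mixed_trace (opp a0) (rev xs) []"
    by (simp add: mixed_trace_def weighted_trace_def N matrix_mul_assoc)
  finally show ?thesis .
qed

section \<open>Power sums\<close>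

type_synonym 'n qmat = "(('n qalg, 'n) vec, 'n) vec"

lemma matpow_Suc_right: "matpow A (Suc k) = matpow A k ** A"
  by (induction k) (simp_all add: matrix_mul_assoc)

lemma matpow_shift: "B ** matpow (A ** B) k = matpow (B ** A) k ** B"
proof (induction k)
  case (Suc k)
  have "B ** matpow (A ** B) (Suc k) = (B ** A) ** (B ** matpow (A ** B) k)" by (simp add: matrix_mul_assoc)
  then show ?case unfolding Suc by (simp add: matrix_mul_assoc)
qed simp

text \<open>
  The matrix \<open>X (Y X) \<dots> (Y X)\<close> satisfies the same exchange relation with \<open>Y\<close> as \<open>X\<close> itself; the
  commutation of \<open>Y\<^sub>l Y\<^sub>k\<close> with the braid operator makes the induction work.
\<close>

lemma XYX_relation:
  fixes k l :: "'l::finite"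
  assumes kl: "k \<noteq> l"
  shows "leg1 k Ymat ** braid_op qent k l ** leg1 k (matpow (Xmat ** Ymat) m ** Xmat) =
    leg1 l (matpow (Xmat ** Ymat) m ** Xmat) ** braid_op qent k l ** (leg1 l Ymat :: ('l, 'n::{finite,linorder}) leg_op)"
proof (induction m)
  case 0
  then show ?case using relations(3)[OF kl] by simp
next
  case (Suc m)
  let ?T = "matpow (Xmat ** Ymat) m ** Xmat :: 'n qmat" and ?h = "braid_op qent k l :: ('l, 'n) leg_op"
  let ?X = "\<lambda>k. leg1 k Xmat :: ('l, 'n) leg_op" and ?Y = "\<lambda>k. leg1 k Ymat :: ('l, 'n) leg_op"
  have T: "matpow (Xmat ** Ymat) (Suc m) ** Xmat = Xmat ** Ymat ** ?T" by (simp add: matrix_mul_assoc)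
  have "leg1 l (Xmat ** Ymat ** ?T) ** ?h ** ?Y l = ?X l ** ?Y l ** (leg1 l ?T ** ?h ** ?Y l)"
    by (simp only: leg1_mult matrix_mul_assoc)
  also have "\<dots> = ?X l ** (?Y l ** ?Y k ** ?h) ** leg1 k ?T"
    by (simp only: Suc.IH[symmetric] matrix_mul_assoc)
  also have "\<dots> = (?X l ** ?h ** ?Y l) ** ?Y k ** leg1 k ?T"
    by (simp only: relations(2)[OF kl, symmetric] matrix_mul_assoc)
  also have "\<dots> = ?Y k ** ?h ** leg1 k (Xmat ** Ymat ** ?T)"
    by (simp only: relations(3)[OF kl, symmetric] leg1_mult matrix_mul_assoc)
  finally show ?case unfolding T by (rule sym)
qed

lemma weighted_trace_leg1:
  fixes k :: "'l::finite"
  assumes "\<And>m. m \<noteq> k \<Longrightarrow> W m = (\<lambda>a. if a = a0 then 1 else 0)"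
  shows "weighted_trace W (leg1 k A) = (\<Sum>a\<in>UNIV. of_F (W k a) * A $ a $ a)"
proof -
  let ?f = "\<lambda>_ :: unit. k"
  have f: "inj ?f" by (simp add: inj_def)
  have "weighted_trace W (embed_legs ?f (leg1 () A)) = weighted_trace (W \<circ> ?f) (leg1 () A)"
    by (rule weighted_trace_embed_legs[OF f]) (use assms in auto)
  also have "\<dots> = (\<Sum>I\<in>UNIV. of_F (W k (I ())) * A $ I () $ I ())"
    by (simp add: weighted_trace_def leg1_def UNIV_unit)
  also have "\<dots> = (\<Sum>a\<in>UNIV. of_F (W k a) * A $ a $ a)"
    by (rule sum.reindex_bij_witness[of _ "\<lambda>a _. a" "\<lambda>I. I ()"]) auto
  finally show ?thesis by (simp add: embed_legs_leg1[OF f])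
qed

text \<open>
  Close the exchange relation between \<open>T = (X Y)\<^sup>m X\<close> and \<open>Y\<close> by the weights of \<open>D'\<close> and \<open>D\<close>: on one side the
  crossing disappears with the first leg and leaves \<open>T Y\<close>, on the other with the second leg and leaves
  \<open>Y T\<close>.
\<close>

lemma trace_exchange:
  "(\<Sum>a\<in>UNIV. of_F (weight_D a) * matpow (Xmat ** Ymat) k $ a $ a) =
   (\<Sum>a\<in>UNIV. of_F (weight_D' a) * matpow (Ymat ** Xmat) k $ a $ (a :: 'n::{finite,linorder}))"
proof (cases k)
  case 0
  have "(\<Sum>a\<in>UNIV. of_F (weight_D a)) = (\<Sum>a\<in>UNIV. of_F (weight_D' (a :: 'n)))"
    by (rule sum.reindex_bij_witness[of _ opp opp]) (auto simp: weight_D'_opp)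
  then show ?thesis by (simp add: 0 mat_def)
next
  case (Suc m)
  let ?T = "matpow (Xmat ** Ymat) m ** Xmat :: 'n qmat"
  \<comment> \<open>Two legs suffice; they are indexed by the booleans.\<close>
  let ?h = "braid_op qent True False :: (bool, 'n) leg_op"
  obtain a0 :: 'n where True by blast
  let ?W = "mixed_weight a0 [] [False]" and ?W' = "mixed_weight a0 [True] []"
  have TY: "?T ** Ymat = matpow (Xmat ** Ymat) k" by (simp only: Suc matpow_Suc_right matrix_mul_assoc)
  have YT: "Ymat ** ?T = matpow (Ymat ** Xmat) k"
    by (simp only: Suc matpow_Suc_right matrix_mul_assoc matpow_shift)
  have "(\<Sum>a\<in>UNIV. of_F (weight_D a) * (?T ** Ymat) $ a $ a) = weighted_trace ?W (leg1 False (?T ** Ymat))"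
    by (subst weighted_trace_leg1[of False _ a0]) (auto simp: mixed_weight_def)
  also have "\<dots> = weighted_trace ?W (leg1 False ?T ** leg1 False Ymat)" by (simp only: leg1_mult)
  also have "\<dots> = weighted_trace (?W(True := weight_D')) (leg1 False ?T ** ?h ** leg1 False Ymat)"
    by (rule weighted_trace_insert) (auto intro!: free_leg_leg1 partial_trace_braid_op_left hecke_params_qent simp: mixed_weight_def)
  also have "leg1 False ?T ** ?h ** leg1 False Ymat = leg1 True Ymat ** ?h ** leg1 True ?T"
    by (rule XYX_relation[symmetric]) simp
  also have "?W(True := weight_D') = ?W'(False := weight_D)" by (auto simp: mixed_weight_def fun_eq_iff)
  also have "weighted_trace (?W'(False := weight_D)) (leg1 True Ymat ** ?h ** leg1 True ?T) = weighted_trace ?W' (leg1 True Ymat ** leg1 True ?T)"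
    by (rule weighted_trace_insert[symmetric]) (auto intro!: free_leg_leg1 partial_trace_braid_op_right hecke_params_qent simp: mixed_weight_def)
  also have "\<dots> = weighted_trace ?W' (leg1 True (Ymat ** ?T))" by (simp only: leg1_mult)
  also have "\<dots> = (\<Sum>a\<in>UNIV. of_F (weight_D' a) * (Ymat ** ?T) $ a $ a)"
    by (subst weighted_trace_leg1[of True _ a0]) (auto simp: mixed_weight_def)
  finally show ?thesis unfolding TY YT .
qed

lemma diagmat_mult: "diagmat d ** A = (\<chi> i j. d i * A $ i $ j)"
  for A :: "'a::semiring_1^'n::finite^'n"
proof -
  have "(diagmat d ** A) $ i $ j = (\<Sum>k\<in>UNIV. if k = i then d i * A $ k $ j else 0)" for i j
    unfolding matrix_mult_nth by (intro sum.cong) (auto simp: diagmat_def)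
  then show ?thesis by (simp add: vec_eq_iff)
qed

lemma trace_diag_sq:
  fixes A :: "'n::{finite,linorder} qalg^'n::{finite,linorder}^'n::{finite,linorder}"
  shows "trace (matpow (diagmat (\<lambda>i. of_F (d i))) 2 ** A) = (\<Sum>a\<in>UNIV. of_F ((d a)\<^sup>2) * A $ a $ a)"
proof -
  have "matpow D 2 ** A = D ** (D ** A)" for D :: "'n qmat"
    by (simp add: numeral_2_eq_2 matrix_mul_assoc)
  then show ?thesis
    by (simp add: trace_def diagmat_mult power2_eq_square of_F_mult mult.assoc)
qed

lemma trace_D: "trace (matpow Dmat 2 ** A) = (\<Sum>a\<in>UNIV. of_F (weight_D a) * A $ a $ a)"
  unfolding Dmat_def trace_diag_sq by (simp add: weight_D_def mult.commute flip: power_mult)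

lemma trace_D': "trace (matpow Dmat' 2 ** A) = (\<Sum>a\<in>UNIV. of_F (weight_D' a) * A $ a $ a)"
  unfolding Dmat'_def trace_diag_sq by (simp add: weight_D'_def mult.commute flip: power_mult)

lemma bij_opp: "bij opp"
  by (rule o_bij[of opp]) (auto simp: fun_eq_iff)

lemma Tmat_prime_matpow: "Tmat prime_op (matpow (Xmat ** Ymat) k :: 'n::{finite,linorder} qmat) = reix opp (matpow (Ymat ** Xmat) k)"
proof (induction k)
  case (Suc k)
  have "Tmat prime_op (matpow (Xmat ** Ymat) (Suc k) :: 'n qmat) = reix opp (matpow (Ymat ** Xmat) k ** (Ymat ** Xmat))"
    by (simp add: Tmat_mult[OF prime_antihom] Suc Tmat_prime_X Tmat_prime_Y reix_mult[OF bij_opp])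
  then show ?case by (simp only: matpow_Suc_right)
qed (simp add: Tmat_prime_mat1 reix_mat1 bij_opp)

lemma prime_s_elem:
  "prime_op (s_elem k :: 'n::{finite,linorder} qalg) = trace (matpow Dmat' 2 ** matpow (Ymat ** Xmat) k)"
proof -
  let ?L = "matpow (Xmat ** Ymat) k :: 'n qmat" and ?M = "matpow (Ymat ** Xmat) k :: 'n qmat"
  have L: "prime_op (?L $ a $ a) = ?M $ opp a $ opp a" for a
  proof -
    have "Tmat prime_op ?L $ a $ a = reix opp ?M $ a $ a" by (simp add: Tmat_prime_matpow)
    then show ?thesis by (simp add: Tmat_def reix_def)
  qed
  have "prime_op (s_elem k) = (\<Sum>a\<in>UNIV. prime_op (of_F (weight_D a) * ?L $ a $ a))"
    by (simp add: s_elem_def trace_D antihomD(7)[OF prime_antihom])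
  also have "\<dots> = (\<Sum>a\<in>UNIV. of_F (weight_D a) * ?M $ opp a $ opp a)"
    by (intro sum.cong refl) (simp add: prime_op_scalar L weight_D_def prime_fixed_power prime_fixed_qpar)
  also have "\<dots> = (\<Sum>a\<in>UNIV. of_F (weight_D' a) * ?M $ a $ a)"
    by (rule sum.reindex_bij_witness[of _ opp opp]) (auto simp: weight_D'_opp)
  finally show ?thesis by (simp add: trace_D')
qed

section \<open>Elementary symmetric functions\<close>

lemma trace_smat: "trace (smat c A) = c * trace A"
  by (simp add: trace_def smat_def sum_distrib_left)

text \<open>
  The right hand side does not depend on \<open>a0\<close>. This matters because the operation moves \<open>a0\<close> to the
  opposite index.
\<close>

lemma sigma_elem_mixed_trace:
  assumes i: "1 \<le> i" "i \<le> CARD('n::{finite,linorder})"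
  shows "\<exists>c :: 'n ratfun. prime_fixed c \<and> (\<forall>a0. sigma_elem i = of_F c * mixed_trace a0 [] (legs_upto i :: 'n list))"
proof -
  let ?xs = "legs_upto i :: 'n list" and ?P = "antisymmetrizer qent (legs_upto CARD('n)) :: ('n, 'n) leg_op"
  define s :: "'n ratfun" where "s = ((- (qpar\<^sup>2)) ^ (i - 1)) ^ i"
  define e :: "'n ratfun" where "e = (\<Prod>k<i. (qpar\<^sup>2) ^ k)"
  have d: "distinct ?xs" using distinct_legs legs_append[OF i(2)] by (metis distinct_append)
  have hd: "hd ?xs = elt 1" using i by (simp add: legs_upto_def upt_conv_Cons del: upt_Suc)
  have "antisym_cols qent (legs_upto CARD('n)) ?P"
    by (rule antisym_antisymmetrizer[OF hecke_params_qent distinct_legs])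
  then have as: "antisym_cols qent ?xs ?P"
    unfolding legs_append[OF i(2), symmetric] by (rule antisym_cols_append)
  have "scalar_product v_vec (matpow (chain i) i *v u_vec) = trace (matpow (chain i) i ** ?P)"
    by (rule scalar_product_uv)
  also have "matpow (chain i) i ** ?P = smat (of_F s) (X_prod ?xs ** Y_prod ?xs ** ?P)"
    using matpow_twist[OF d as, of i] by (simp add: chain_eq[OF i(1)] hd s_def)
  also have "trace \<dots> = of_F s * trace (X_prod ?xs ** Y_prod ?xs ** ?P)" by (rule trace_smat)
  finally have sp: "scalar_product v_vec (matpow (chain i) i *v u_vec) = of_F s * trace (X_prod ?xs ** Y_prod ?xs ** ?P)" .
  have mixed_trace: "of_F e * trace (X_prod ?xs ** Y_prod ?xs ** ?P) = of_F (qfact (CARD('n) - i)) * mixed_trace a0 [] ?xs" for a0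
    using trace_antisymmetrizer_legs[OF i(2), of "X_prod ?xs ** Y_prod ?xs" a0]
    by (simp add: on_legs_mult on_legs_X_prod on_legs_Y_prod mixed_trace_def e_def matrix_mul_assoc)
  have e0: "e \<noteq> 0" by (simp add: e_def)
  have tr: "trace (X_prod ?xs ** Y_prod ?xs ** ?P) = of_F (qfact (CARD('n) - i) / e) * mixed_trace a0 [] ?xs" for a0
  proof -
    have "trace (X_prod ?xs ** Y_prod ?xs ** ?P) = of_F (inverse e) * (of_F e * trace (X_prod ?xs ** Y_prod ?xs ** ?P))"
      using e0 by (simp flip: of_F_mult mult.assoc)
    then show ?thesis unfolding mixed_trace[of a0] by (simp add: divide_inverse mult.commute flip: of_F_mult mult.assoc)
  qed
  \<comment> \<open>The factors come from the definition of sigma, the full twist, and the contracted legs.\<close>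
  let ?c = "inverse (qpar ^ ((i - 1) * i)) * alpha i * s * (qfact (CARD('n) - i) / e)"
  show ?thesis
  proof (intro exI conjI allI)
    show "prime_fixed ?c"
      unfolding s_def e_def alpha_def by (intro prime_fixed_intros prime_fixed_qfact)
    show "sigma_elem i = of_F ?c * mixed_trace a0 [] ?xs" for a0
      using i unfolding sigma_elem_def sp tr[of a0] by (simp only: of_F_mult mult.assoc) simp
  qed
qed

lemma prime_sigma_elem:
  assumes i: "i \<le> CARD('n::{finite,linorder})"
  shows "prime_op (sigma_elem i :: 'n qalg) = sigma_elem i"
proof (cases "i = 0")
  case True
  then show ?thesis by (simp add: sigma_elem_def prime_simps)
next
  case False
  then have "1 \<le> i" by simp
  then obtain c :: "'n ratfun" where c: "prime_fixed c" "\<And>a0. sigma_elem i = of_F c * mixed_trace a0 [] (legs_upto i :: 'n list)"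
    using sigma_elem_mixed_trace[OF _ i] by blast
  have d: "distinct (legs_upto i :: 'n list)" using distinct_legs legs_append[OF i] by (metis distinct_append)
  obtain a0 :: 'n where True by blast
  have "prime_op (sigma_elem i :: 'n qalg) = of_F c * mixed_trace (opp a0) (rev (legs_upto i :: 'n list)) []"
    unfolding c(2)[of a0] prime_op_scalar[OF c(1)] prime_mixed_trace[OF d] ..
  also have "mixed_trace (opp a0) (rev (legs_upto i :: 'n list)) [] = mixed_trace (opp a0) [] (legs_upto i :: 'n list)"
    by (rule mixed_trace_exchange[symmetric]) (use d in auto)
  finally show ?thesis unfolding c(2)[of "opp a0"] .
qed

theorem theorem3p6:
  assumes "CARD('n::{finite,linorder}) \<ge> 2"
  shows "(\<forall>i \<le> CARD('n). prime_op (sigma_elem i :: 'n qalg) = sigma_elem i) \<and>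
    (\<forall>k. prime_op (s_elem k :: 'n qalg) = trace (matpow Dmat' 2 ** matpow (Ymat ** Xmat) k) \<and>
         (trace (matpow Dmat' 2 ** matpow (Ymat ** Xmat) k) :: 'n qalg)
           = trace (matpow Dmat 2 ** matpow (Xmat ** Ymat) k) \<and>
         trace (matpow Dmat 2 ** matpow (Xmat ** Ymat) k) = (s_elem k :: 'n qalg))"
  by (intro conjI allI impI prime_sigma_elem prime_s_elem)
    (simp_all add: trace_D trace_D' trace_exchange s_elem_def)

end
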